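(* Let $E/\mathbb{F}_q$ be an elliptic function field. If the group $\mathbb{P}_E^1$ is cyclic, then for any subgroup $T$ of $T_E$ and any subgroup $A$ of $\mathrm{Aut}(E,O)$, the product set $TA=\{\tau\alpha:\tau\in T,\alpha\in A\}$ is a subgroup of $\mathrm{Aut}(E/\mathbb{F}_q)$.
   Context: $\mathbb{F}_q$ is a finite field of characteristic $p$. An elliptic function field $E/\mathbb{F}_q$ is the function field $\mathbb{F}_q(x,y)$ of an elliptic curve over $\mathbb{F}_q$ given by a nonsingular Weierstrass equation; $O$ is the common pole of $x$ and $y$ (the infinite place). $\mathbb{P}_E^1$ is the set of rational (degree one) places of $E$; it is an abelian group with zero $O$ and with $P\oplus Q=R$ iff the divisors $P+Q$ and $R+O$ are linearly equivalent. $\mathrm{Aut}(E/\mathbb{F}_q)$ is the group of field automorphisms of $E$ fixing $\mathbb{F}_q$ elementwise, acting on places by $\sigma(P)=\{\sigma(z):z\in P\}$. $\mathrm{Aut}(E,O)=\{\sigma\in\mathrm{Aut}(E/\mathbb{F}_q):\sigma(O)=O\}$. For $Q\in\mathbb{P}_E^1$, $\tau_Q\in\mathrm{Aut}(E/\mathbb{F}_q)$ is the automorphism induced by translation by $Q$: its extension to $E\overline{\mathbb{F}}_q$ sends every rational place $P$ of $E\overline{\mathbb{F}}_q$ to $P\oplus Q$. $T_E=\{\tau_Q:Q\in\mathbb{P}_E^1\}$ is the translation group. *)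

theory Defs
  imports
    "HOL-Algebra.Algebra"
    "HOL-Algebra.Algebraic_Closure_Type"
    "HOL-Library.Poly_Mapping"
begin

text \<open>
  All fields are subsets of an arbitrary field type, regarded as rings of the algebra library
  by restricting the carrier of \<^const>\<open>ring_of_type_algebra\<close>.
\<close>

abbreviation ring_on :: "'a::field set \<Rightarrow> 'a ring" where
  "ring_on F \<equiv> ring_of_type_algebra\<lparr>carrier := F\<rparr>"

definition weierstrass :: "'a::field \<Rightarrow> 'a \<Rightarrow> 'a \<Rightarrow> 'a \<Rightarrow> 'a \<Rightarrow> 'a \<Rightarrow> 'a \<Rightarrow> 'a" where
  "weierstrass a1 a2 a3 a4 a6 u v =
     v^2 + a1 * u * v + a3 * v - (u^3 + a2 * u^2 + a4 * u + a6)"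

definition weierstrass_du :: "'a::field \<Rightarrow> 'a \<Rightarrow> 'a \<Rightarrow> 'a \<Rightarrow> 'a \<Rightarrow> 'a" where
  "weierstrass_du a1 a2 a4 u v = a1 * v - (3 * u^2 + 2 * a2 * u + a4)"

definition weierstrass_dv :: "'a::field \<Rightarrow> 'a \<Rightarrow> 'a \<Rightarrow> 'a \<Rightarrow> 'a" where
  "weierstrass_dv a1 a3 u v = 2 * v + a1 * u + a3"

definition constants_closure :: "'a::field set \<Rightarrow> 'a alg_closure set" where
  "constants_closure K = {z. \<not> ring.transcendental ring_of_type_algebra (to_ac ` K) z}"

text \<open>Absence of singular affine points over the algebraic closure; the point at infinity of
  a Weierstrass cubic is always nonsingular. The suffixes
  \<open>du\<close> and \<open>dv\<close> denote the partial derivatives.\<close>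

definition nonsingular_weierstrass ::
    "'a::field set \<Rightarrow> 'a \<Rightarrow> 'a \<Rightarrow> 'a \<Rightarrow> 'a \<Rightarrow> 'a \<Rightarrow> bool" where
  "nonsingular_weierstrass K a1 a2 a3 a4 a6 \<longleftrightarrow>
     \<not> (\<exists>u\<in>constants_closure K. \<exists>v\<in>constants_closure K.
          weierstrass (to_ac a1) (to_ac a2) (to_ac a3) (to_ac a4) (to_ac a6) u v = 0 \<and>
          weierstrass_du (to_ac a1) (to_ac a2) (to_ac a4) u v = 0 \<and>
          weierstrass_dv (to_ac a1) (to_ac a3) u v = 0)"

text \<open>Transcendence of \<open>x\<close> makes \<open>K(x, y)\<close> the function field of the curve: a Weierstrass
  polynomial \<open>W\<close> is irreducible, and then \<open>W\<close> generates the ideal of all polynomial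
  relations between \<open>x\<close> and \<open>y\<close>.\<close>

definition elliptic_function_field :: "'a::field set \<Rightarrow> 'a set \<Rightarrow> 'a \<Rightarrow> 'a \<Rightarrow> bool" where
  "elliptic_function_field K E x y \<longleftrightarrow>
     finite K \<and> subfield K ring_of_type_algebra \<and>
     E = generate_field ring_of_type_algebra (K \<union> {x, y}) \<and>
     ring.transcendental ring_of_type_algebra K x \<and>
     (\<exists>a1\<in>K. \<exists>a2\<in>K. \<exists>a3\<in>K. \<exists>a4\<in>K. \<exists>a6\<in>K.
        weierstrass a1 a2 a3 a4 a6 x y = 0 \<and> nonsingular_weierstrass K a1 a2 a3 a4 a6)"


definition valuation_ring :: "'a::field set \<Rightarrow> 'a set \<Rightarrow> 'a set \<Rightarrow> bool" where
  "valuation_ring K F V \<longleftrightarrow>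
     subring V (ring_on F) \<and> K \<subset> V \<and> V \<subset> F \<and> (\<forall>z\<in>F. z \<in> V \<or> inverse z \<in> V)"

definition places :: "'a::field set \<Rightarrow> 'a set \<Rightarrow> 'a set set" where
  "places K F = {P. \<exists>V. valuation_ring K F V \<and> maximalideal P (ring_on V)}"

text \<open>The valuation ring with maximal ideal \<open>P\<close>. The case \<open>z = 0\<close> is separate because
  \<open>inverse 0 = 0\<close>.\<close>

definition place_ring :: "'a::field set \<Rightarrow> 'a set \<Rightarrow> 'a set" where
  "place_ring F P = {z \<in> F. z = 0 \<or> inverse z \<notin> P}"

definition residue_field :: "'a::field set \<Rightarrow> 'a set \<Rightarrow> 'a set ring" where
  "residue_field F P = ring_on (place_ring F P) Quot P"

text \<open>Places of degree one: the residue field has dimension 1 over the image of \<open>K\<close>.\<close>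

definition rational_places :: "'a::field set \<Rightarrow> 'a set \<Rightarrow> 'a set set" where
  "rational_places K F = {P \<in> places K F.
     ring.dimension (residue_field F P) 1
       ((\<lambda>c. P +>\<^bsub>ring_on (place_ring F P)\<^esub> c) ` K) (carrier (residue_field F P))}"

text \<open>For \<open>z \<noteq> 0\<close>: the \<open>n\<close> with \<open>z = t\<^sup>n u\<close>, where \<open>t\<close> is a uniformizer and \<open>u\<close> a unit.\<close>

definition place_val :: "'a::field set \<Rightarrow> 'a set \<Rightarrow> 'a \<Rightarrow> int" where
  "place_val F P z = (THE n. \<exists>t\<in>place_ring F P. \<exists>u\<in>place_ring F P - P.
     P = PIdl\<^bsub>ring_on (place_ring F P)\<^esub> t \<and> z = t powi n * u)"

text \<open>Divisors are elements of the free abelian group on the places, with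
  \<^const>\<open>frag_of\<close> \<open>P\<close> the prime divisor of \<open>P\<close>.\<close>

definition lin_equiv ::
    "'a::field set \<Rightarrow> 'a set \<Rightarrow> ('a set \<Rightarrow>\<^sub>0 int) \<Rightarrow> ('a set \<Rightarrow>\<^sub>0 int) \<Rightarrow> bool" where
  "lin_equiv K F D D' \<longleftrightarrow>
     (\<exists>z\<in>F. z \<noteq> 0 \<and> (\<forall>P\<in>places K F. Poly_Mapping.lookup (D - D') P = place_val F P z))"

definition infinite_place :: "'a::field set \<Rightarrow> 'a set \<Rightarrow> 'a \<Rightarrow> 'a \<Rightarrow> 'a set" where
  "infinite_place K F x y =
     (THE P. P \<in> places K F \<and> x \<notin> place_ring F P \<and> y \<notin> place_ring F P)"

definition place_group :: "'a::field set \<Rightarrow> 'a set \<Rightarrow> 'a \<Rightarrow> 'a \<Rightarrow> 'a set monoid" where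
  "place_group K F x y =
     \<lparr>carrier = rational_places K F,
      monoid.mult = (\<lambda>P Q. THE R. R \<in> rational_places K F \<and>
        lin_equiv K F (frag_of P + frag_of Q) (frag_of R + frag_of (infinite_place K F x y))),
      one = infinite_place K F x y\<rparr>"


text \<open>Automorphisms are taken in \<^const>\<open>extensional\<close> \<open>F\<close>, so that they are determined by
  their values on \<open>F\<close>. The product is composition, the right factor being applied first.\<close>

definition Aut_group :: "'a::field set \<Rightarrow> 'a set \<Rightarrow> ('a \<Rightarrow> 'a) monoid" where
  "Aut_group K F = (BijGroup F)\<lparr>carrier :=
     {\<sigma> \<in> extensional F \<inter> ring_iso (ring_on F) (ring_on F). \<forall>c\<in>K. \<sigma> c = c}\<rparr>"

definition Aut_fixing_infinity :: "'a::field set \<Rightarrow> 'a set \<Rightarrow> 'a \<Rightarrow> 'a \<Rightarrow> ('a \<Rightarrow> 'a) set" where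
  "Aut_fixing_infinity K E x y =
     {\<sigma> \<in> carrier (Aut_group K E). \<sigma> ` infinite_place K E x y = infinite_place K E x y}"

definition constant_extension :: "'a::field set \<Rightarrow> 'a set \<Rightarrow> 'a alg_closure set" where
  "constant_extension K E =
     generate_field ring_of_type_algebra (constants_closure K \<union> to_ac ` E)"

text \<open>A rational place \<open>Q\<close> of \<open>E\<close> is identified with the unique place \<open>Q'\<close> of the constant
  field extension lying over it. The extension \<open>\<sigma>'\<close> of \<open>\<sigma>\<close> fixes the algebraic closure of the
  constants and translates all rational places by \<open>Q'\<close>. These conditions determine \<open>\<sigma>\<close> from \<open>Q\<close>.\<close>

definition is_translation ::
    "'a::field set \<Rightarrow> 'a set \<Rightarrow> 'a \<Rightarrow> 'a \<Rightarrow> 'a set \<Rightarrow> ('a \<Rightarrow> 'a) \<Rightarrow> bool" where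
  "is_translation K E x y Q \<sigma> \<longleftrightarrow>
     \<sigma> \<in> carrier (Aut_group K E) \<and>
     (let K' = constants_closure K; E' = constant_extension K E;
          G' = place_group K' E' (to_ac x) (to_ac y)
      in \<exists>\<sigma>' \<in> carrier (Aut_group K' E'). \<exists>Q' \<in> rational_places K' E'.
           (\<forall>z\<in>E. \<sigma>' (to_ac z) = to_ac (\<sigma> z)) \<and>
           to_ac -` Q' \<inter> E = Q \<and>
           (\<forall>P \<in> rational_places K' E'. \<sigma>' ` P = P \<otimes>\<^bsub>G'\<^esub> Q'))"

definition translation_auts :: "'a::field set \<Rightarrow> 'a set \<Rightarrow> 'a \<Rightarrow> 'a \<Rightarrow> ('a \<Rightarrow> 'a) set" where
  "translation_auts K E x y = {\<sigma>. \<exists>Q\<in>rational_places K E. is_translation K E x y Q \<sigma>}"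

end

theory Submission
  imports Defs
begin

text \<open>Let \<open>\<alpha>\<close> fix \<open>O\<close>. It permutes the rational places and preserves linear equivalence, so it is an
  endomorphism of the group of rational places, and since that group is cyclic there is an integer
  \<open>k\<close> with \<open>\<alpha>(Q) = k Q\<close> for all \<open>Q\<close>. The map \<open>\<tau> \<mapsto> \<tau>(O)\<close> is an injective homomorphism on any group
  of translations. Hence \<open>\<alpha> \<tau> \<alpha>\<inverse>\<close>, which is again a translation, agrees with \<open>\<tau>\<^sup>k\<close> because both
  send \<open>O\<close> to \<open>\<alpha>(\<tau>(O)) = k \<tau>(O)\<close>. So \<open>A\<close> normalizes \<open>T\<close>, and \<open>T A\<close> is a group.

  That the sum of two rational places exists is the chord and tangent construction; that it is
  unique means that no function has a single simple pole. The latter holds because over an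
  algebraically closed field of constants a function with poles only at \<open>O\<close> is a polynomial in
  \<open>x\<close> and \<open>y\<close>, whose pole order is never 1.\<close>

section \<open>Subrings and polynomials over them\<close>

text \<open>Translations are defined by their action over the algebraic closure \<open>K'\<close> of
  the constants, while cyclicity concerns places over \<open>K\<close>, so the two levels must be
  linked. Points are carried up with their coordinates, \<open>chord\<close> consists of polynomial
  equations and goes with them, and only one rational place lies above a rational place. For a
  conjugate of a translation to be one again, \<open>\<alpha>\<close> itself must extend upstairs:
  it sends \<open>(x, y)\<close> to another solution of the same equation, which again generates the
  large field. Injectivity of \<open>\<tau> \<mapsto> \<tau>(O)\<close> is also settled there, as
  over the finite \<open>K\<close> there may be too few rational places to determine an
  automorphism.

  \<open>lin_equiv\<close> compares orders at all places, not only rational ones, so every place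
  must be shown to be discrete. Riemann-Roch is avoided: the function field is
  \<open>K(x) + K(x) y\<close>, and value groups, local rings and divisors of lines are found from
  norms, parity of orders and polynomial division. The place \<open>O\<close> is studied as an
  affine point of a second model with coordinates \<open>1 / x\<close> and
  \<open>y / x^2\<close>.\<close>

definition sub_ring :: "'a::field set \<Rightarrow> bool" where
  "sub_ring S \<longleftrightarrow> 1 \<in> S \<and> (\<forall>a\<in>S. \<forall>b\<in>S. a - b \<in> S \<and> a * b \<in> S)"

definition sub_field :: "'a::field set \<Rightarrow> bool" where
  "sub_field S \<longleftrightarrow> sub_ring S \<and> (\<forall>a\<in>S. inverse a \<in> S)"

lemma sub_ring_one: "sub_ring S \<Longrightarrow> 1 \<in> S"
  and sub_ring_diff: "sub_ring S \<Longrightarrow> a \<in> S \<Longrightarrow> b \<in> S \<Longrightarrow> a - b \<in> S"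
  and sub_ring_mult: "sub_ring S \<Longrightarrow> a \<in> S \<Longrightarrow> b \<in> S \<Longrightarrow> a * b \<in> S"
  by (auto simp: sub_ring_def)

lemma sub_ring_zero: "sub_ring S \<Longrightarrow> 0 \<in> S"
  using sub_ring_diff[of S 1 1] sub_ring_one by auto

lemma sub_ring_uminus: "sub_ring S \<Longrightarrow> a \<in> S \<Longrightarrow> - a \<in> S"
  using sub_ring_diff[of S 0 a] sub_ring_zero by auto

lemma sub_ring_add: "sub_ring S \<Longrightarrow> a \<in> S \<Longrightarrow> b \<in> S \<Longrightarrow> a + b \<in> S"
  using sub_ring_diff[of S a "- b"] sub_ring_uminus by auto

lemma sub_ring_power: "sub_ring S \<Longrightarrow> a \<in> S \<Longrightarrow> a ^ n \<in> S"
  by (induction n) (auto intro: sub_ring_one sub_ring_mult)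

lemma sub_ring_of_nat: "sub_ring S \<Longrightarrow> of_nat n \<in> S"
  by (induction n) (auto intro: sub_ring_one sub_ring_add sub_ring_zero)

lemma sub_ring_numeral: "sub_ring S \<Longrightarrow> numeral n \<in> S"
  using sub_ring_of_nat[of S "numeral n"] by simp

lemma sub_ring_sum: "sub_ring S \<Longrightarrow> (\<And>i. i \<in> I \<Longrightarrow> g i \<in> S) \<Longrightarrow> sum g I \<in> S"
  by (induction I rule: infinite_finite_induct) (auto intro: sub_ring_add sub_ring_zero)

lemmas sub_ring_intros = sub_ring_one sub_ring_zero sub_ring_diff sub_ring_mult sub_ring_uminus
  sub_ring_add sub_ring_power sub_ring_numeral

lemma sub_field_ring: "sub_field S \<Longrightarrow> sub_ring S"
  and sub_field_inverse: "sub_field S \<Longrightarrow> a \<in> S \<Longrightarrow> inverse a \<in> S"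
  by (auto simp: sub_field_def)

lemma sub_field_divide: "sub_field S \<Longrightarrow> a \<in> S \<Longrightarrow> b \<in> S \<Longrightarrow> a / b \<in> S"
  unfolding divide_inverse by (meson sub_field_inverse sub_field_ring sub_ring_mult)

lemma sub_field_powi: "sub_field S \<Longrightarrow> a \<in> S \<Longrightarrow> a powi n \<in> S"
  by (auto simp: power_int_def intro: sub_ring_power sub_field_inverse sub_field_ring)

lemmas sub_field_intros = sub_ring_intros[OF sub_field_ring] sub_field_inverse sub_field_divide
  sub_field_powi

definition pols :: "'a::field set \<Rightarrow> 'a poly set" where
  "pols K = {p. \<forall>n. coeff p n \<in> K}"

lemma coeff_pols: "p \<in> pols K \<Longrightarrow> coeff p n \<in> K"
  by (simp add: pols_def)

context
  fixes K :: "'a::field set"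
  assumes K: "sub_ring K"
begin

lemma pols_0: "0 \<in> pols K"
  using K by (auto simp: pols_def intro: sub_ring_zero)

lemma pols_pCons: "a \<in> K \<Longrightarrow> p \<in> pols K \<Longrightarrow> pCons a p \<in> pols K"
  by (auto simp: pols_def coeff_pCons split: nat.split)

lemma pols_1: "1 \<in> pols K"
  using pols_pCons[OF sub_ring_one[OF K] pols_0] by (simp add: one_pCons)

lemma pols_const: "a \<in> K \<Longrightarrow> [:a:] \<in> pols K"
  by (simp add: pols_pCons pols_0)

lemma pols_add: "p \<in> pols K \<Longrightarrow> q \<in> pols K \<Longrightarrow> p + q \<in> pols K"
  using K by (auto simp: pols_def intro: sub_ring_add)

lemma pols_diff: "p \<in> pols K \<Longrightarrow> q \<in> pols K \<Longrightarrow> p - q \<in> pols K"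
  using K by (auto simp: pols_def intro: sub_ring_diff)

lemma pols_uminus: "p \<in> pols K \<Longrightarrow> - p \<in> pols K"
  using K by (auto simp: pols_def intro: sub_ring_uminus)

lemma pols_mult: "p \<in> pols K \<Longrightarrow> q \<in> pols K \<Longrightarrow> p * q \<in> pols K"
  using K by (auto simp: pols_def coeff_mult intro: sub_ring_sum sub_ring_mult)

lemma pols_smult: "a \<in> K \<Longrightarrow> p \<in> pols K \<Longrightarrow> smult a p \<in> pols K"
  using K by (auto simp: pols_def intro: sub_ring_mult)

lemma pols_power: "p \<in> pols K \<Longrightarrow> p ^ n \<in> pols K"
  by (induction n) (auto intro: pols_1 pols_mult)

lemma pols_monom: "a \<in> K \<Longrightarrow> monom a n \<in> pols K"
  using K by (auto simp: pols_def intro: sub_ring_zero)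

lemma pols_reflect: "p \<in> pols K \<Longrightarrow> reflect_poly p \<in> pols K"
  using K by (auto simp: pols_def coeff_reflect_poly intro: sub_ring_zero)

text \<open>Horner's scheme only adds and multiplies, so splitting off a factor \<open>X - c\<close>
  and evaluating at \<open>c\<close> stay inside any subring.\<close>

lemma pols_synthetic_div:
  assumes "c \<in> K" shows "p \<in> pols K \<Longrightarrow> synthetic_div p c \<in> pols K \<and> poly p c \<in> K"
proof (induction p)
  case 0
  then show ?case using sub_ring_zero[OF K] by (simp add: pols_0)
next
  case (pCons a p)
  have "p \<in> pols K" "a \<in> K"
    using pCons.prems coeff_pols[of "pCons a p" K "Suc _"] coeff_pols[of "pCons a p" K 0]
    by (auto simp: pols_def)
  then show ?case using pCons assms K
    by (auto simp: synthetic_div_pCons intro: pols_pCons sub_ring_add sub_ring_mult)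
qed

end

lemma poly_pols:
  assumes "sub_ring S" "K \<subseteq> S" "c \<in> S" "p \<in> pols K" shows "poly p c \<in> S"
proof -
  have "p \<in> pols S" using assms by (auto simp: pols_def)
  then show ?thesis using pols_synthetic_div assms by blast
qed

lemmas pols_intros = pols_0 pols_1 pols_const pols_pCons pols_add pols_diff pols_uminus pols_mult
  pols_smult pols_power pols_monom

text \<open>Cancelling leading terms only uses quotients of coefficients of \<open>a\<close> and
  \<open>b\<close>, so quotient and remainder can be kept over the subfield \<open>K\<close> of the
  ambient field.\<close>

lemma pols_division:
  assumes K: "sub_field K" and b: "b \<in> pols K" "b \<noteq> 0"
  shows "a \<in> pols K \<Longrightarrow> \<exists>q\<in>pols K. \<exists>r\<in>pols K. a = b * q + r \<and> (r = 0 \<or> degree r < degree b)"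
proof (induction "degree a" arbitrary: a rule: less_induct)
  case less
  note R = sub_field_ring[OF K]
  show ?case
  proof (cases "a = 0 \<or> degree a < degree b")
    case True
    then show ?thesis using less.prems pols_0[OF R]
      by (intro bexI[of _ 0] bexI[of _ a]) auto
  next
    case False
    define c where "c = monom (lead_coeff a / lead_coeff b) (degree a - degree b)"
    have c: "c \<in> pols K" unfolding c_def using less.prems b K
      by (intro pols_monom R sub_field_divide) (auto simp: pols_def)
    define a' where "a' = a - b * c"
    have a': "a' \<in> pols K" unfolding a'_def using c b less.prems R by (intro pols_diff pols_mult)
    have c0: "lead_coeff a / lead_coeff b \<noteq> 0" using False b by simp
    have deg_c': "degree c = degree a - degree b" unfolding c_def by (rule degree_monom_eq[OF c0])
    have "c \<noteq> 0" using c0 by (simp add: c_def monom_eq_0_iff)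
    then have deg_c: "degree (b * c) = degree a"
      using False b deg_c' by (simp add: degree_mult_eq)
    have "lead_coeff (b * c) = lead_coeff a"
      using b unfolding lead_coeff_mult deg_c' by (simp add: c_def)
    then have "coeff a' (degree a) = 0" by (simp add: a'_def deg_c)
    moreover have "degree a' \<le> degree a" unfolding a'_def
      by (metis deg_c degree_diff_le le_refl)
    ultimately have "a' = 0 \<or> degree a' < degree a"
      by (metis eq_zero_or_degree_less)
    then obtain q r where "q \<in> pols K" "r \<in> pols K" "a' = b * q + r" "r = 0 \<or> degree r < degree b"
    proof
      assume "a' = 0"
      then show ?thesis using that[of 0 0] pols_0[OF R] by simp
    next
      assume "degree a' < degree a"
      then show ?thesis using less.hyps[OF _ a'] that by blast
    qed
    moreover from this have "a = b * (q + c) + r" using a'_def by (simp add: algebra_simps)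
    ultimately show ?thesis using pols_add[OF R _ c] by blast
  qed
qed

section \<open>Valuation rings\<close>

definition vring :: "'a::field set \<Rightarrow> 'a set \<Rightarrow> 'a set \<Rightarrow> bool" where
  "vring K F V \<longleftrightarrow> sub_ring V \<and> K \<subseteq> V \<and> V \<subset> F \<and> (\<forall>z\<in>F. z \<in> V \<or> inverse z \<in> V)"

text \<open>For a valuation ring this is its maximal ideal. The element 0 is listed separately
  because \<open>inverse 0 = 0\<close> lies in \<open>V\<close>.\<close>

definition nonunits :: "'a::field set \<Rightarrow> 'a set" where
  "nonunits V = {z \<in> V. z = 0 \<or> inverse z \<notin> V}"

lemma nonunits_mult: "sub_ring V \<Longrightarrow> a \<in> V \<Longrightarrow> b \<in> nonunits V \<Longrightarrow> a * b \<in> nonunits V"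
proof -
  assume V: "sub_ring V" and a: "a \<in> V" and b: "b \<in> nonunits V"
  have "inverse b \<in> V" if "inverse (a * b) \<in> V" "a * b \<noteq> 0"
  proof -
    have "a \<noteq> 0" "b \<noteq> 0" using that by auto
    then have "inverse b = a * inverse (a * b)" by (simp add: field_simps)
    then show ?thesis using sub_ring_mult[OF V a that(1)] by metis
  qed
  then show ?thesis using a b sub_ring_mult[OF V] by (auto simp: nonunits_def)
qed

locale vring_ctx =
  fixes K F V :: "'a::field set"
  assumes F: "sub_field F" and V: "vring K F V"
begin

abbreviation "P \<equiv> nonunits V"

lemma V_ring: "sub_ring V" and KV: "K \<subseteq> V" and VF: "V \<subseteq> F" "V \<noteq> F"
  and V_total: "z \<in> F \<Longrightarrow> z \<in> V \<or> inverse z \<in> V"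
  using V by (auto simp: vring_def)

lemmas V_intros = sub_ring_intros[OF V_ring]
lemmas F_intros = sub_field_intros[OF F]

lemma PV: "z \<in> P \<Longrightarrow> z \<in> V" and P_0: "0 \<in> P" and P_1: "1 \<notin> P"
  by (auto simp: nonunits_def intro: V_intros)

lemma P_mult: "a \<in> V \<Longrightarrow> b \<in> P \<Longrightarrow> a * b \<in> P" "b \<in> P \<Longrightarrow> a \<in> V \<Longrightarrow> b * a \<in> P"
  using nonunits_mult[OF V_ring, of a b] by (simp_all add: mult.commute)

lemma P_uminus: "a \<in> P \<Longrightarrow> - a \<in> P"
  using P_mult(1)[of "-1" a] V_intros(5)[OF V_intros(1)] by simp

text \<open>Of \<open>b / a\<close> and \<open>a / b\<close> one lies in \<open>V\<close>; factoring
  out its denominator leaves an element of \<open>V\<close> times a nonunit.\<close>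

lemma P_add: assumes "a \<in> P" "b \<in> P" shows "a + b \<in> P"
proof (cases "a = 0 \<or> b = 0")
  case False
  have aux: "a + b \<in> P" if ab: "a \<in> P" "b \<in> P" "a \<noteq> 0" "b / a \<in> V" for a b
  proof -
    have "(1 + b / a) * a \<in> P" by (intro P_mult V_intros ab)
    moreover have "(1 + b / a) * a = a + b" using ab by (simp add: distrib_right)
    ultimately show ?thesis by simp
  qed
  have "b / a \<in> F" using assms PV VF by (intro F_intros) auto
  then have "b / a \<in> V \<or> a / b \<in> V" using V_total[of "b / a"] by simp
  then show ?thesis using aux[of a b] aux[of b a] assms False by (auto simp: add.commute)
qed (use assms in auto)

lemma P_diff: "a \<in> P \<Longrightarrow> b \<in> P \<Longrightarrow> a - b \<in> P"
  using P_add[of a "- b"] P_uminus by simp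

lemma P_prime: assumes "a \<in> V" "b \<in> V" "a * b \<in> P" shows "a \<in> P \<or> b \<in> P"
proof (rule ccontr)
  assume "\<not> ?thesis"
  then have *: "a \<noteq> 0" "b \<noteq> 0" "inverse a \<in> V" "inverse b \<in> V" using assms by (auto simp: nonunits_def)
  then have "inverse (a * b) \<in> V" using V_intros(4) by simp
  then show False using assms * by (simp add: nonunits_def)
qed

lemma inverse_in_P: "z \<in> F \<Longrightarrow> z \<notin> V \<Longrightarrow> inverse z \<in> P"
  using V_total[of z] V_intros(2) by (auto simp: nonunits_def)

lemma unit_mult: "a \<in> V - P \<Longrightarrow> b \<in> V - P \<Longrightarrow> a * b \<in> V - P"
  using P_prime[of a b] V_intros(4)[of a b] by auto

lemma unit_iff: "a \<in> V - P \<longleftrightarrow> a \<noteq> 0 \<and> a \<in> V \<and> inverse a \<in> V"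
  by (auto simp: nonunits_def)

lemma unit_inverse: "a \<in> V - P \<Longrightarrow> inverse a \<in> V - P"
  unfolding unit_iff by auto

lemma unit_1: "1 \<in> V - P"
  using P_1 V_intros(1) by auto

lemma unit_power: "a \<in> V - P \<Longrightarrow> a ^ n \<in> V - P"
  by (induction n) (use unit_1 unit_mult in auto)

lemma unit_powi: "a \<in> V - P \<Longrightarrow> a powi n \<in> V - P"
  unfolding power_int_def using unit_power unit_inverse by metis

lemma unit_add_P: "a \<in> V - P \<Longrightarrow> b \<in> P \<Longrightarrow> a + b \<in> V - P"
  using V_intros(6)[of a b] PV[of b] P_diff[of "a + b" b] by auto

lemma P_eq: "{z \<in> F. z = 0 \<or> inverse z \<notin> P} = V"
proof -
  have "inverse z \<notin> P" if "z \<in> V" "z \<noteq> 0" for z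
    using that by (auto simp: nonunits_def)
  then show ?thesis using inverse_in_P VF by (auto simp: P_0 V_intros(2))
qed

lemma place_ring_eq: "place_ring F P = V"
  unfolding place_ring_def by (rule P_eq)

end

section \<open>Comparison with the algebra library\<close>

lemma ring_on_simps [simp]:
  "carrier (ring_on S) = S" "a \<otimes>\<^bsub>ring_on S\<^esub> b = a * b" "a \<oplus>\<^bsub>ring_on S\<^esub> b = a + b"
  "\<one>\<^bsub>ring_on S\<^esub> = 1" "\<zero>\<^bsub>ring_on S\<^esub> = 0"
  by (simp_all add: ring_of_type_algebra_def)

lemma type_algebra_simps [simp]:
  "carrier ring_of_type_algebra = UNIV" "a \<otimes>\<^bsub>ring_of_type_algebra\<^esub> b = a * b"
  "a \<oplus>\<^bsub>ring_of_type_algebra\<^esub> b = a + b"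
  "\<one>\<^bsub>ring_of_type_algebra\<^esub> = 1" "\<zero>\<^bsub>ring_of_type_algebra\<^esub> = 0"
  by (simp_all add: ring_of_type_algebra_def)

lemma ring_on_UNIV: "ring_on UNIV = ring_of_type_algebra"
  by (simp add: ring_of_type_algebra_def)

lemma cring_ring_on: assumes S: "sub_ring S" shows "cring (ring_on S)"
proof (rule cringI)
  show "abelian_group (ring_on S)"
  proof (rule abelian_groupI)
    fix x assume "x \<in> carrier (ring_on S)"
    then show "\<exists>y\<in>carrier (ring_on S). y \<oplus>\<^bsub>ring_on S\<^esub> x = \<zero>\<^bsub>ring_on S\<^esub>"
      using sub_ring_uminus[OF S] by (intro bexI[of _ "- x"]) auto
  qed (use S in \<open>auto intro: sub_ring_add sub_ring_zero\<close>)
  show "comm_monoid (ring_on S)"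
    by (rule comm_monoidI) (use S in \<open>auto intro: sub_ring_mult sub_ring_one\<close>)
qed (auto simp: algebra_simps)

lemma ring_on_uminus:
  assumes S: "sub_ring S" and a: "a \<in> S" shows "\<ominus>\<^bsub>ring_on S\<^esub> a = - a"
proof -
  interpret cring "ring_on S" by (rule cring_ring_on[OF S])
  show ?thesis by (rule minus_equality) (use a sub_ring_uminus[OF S] in auto)
qed

lemma sub_ring_UNIV: "sub_ring UNIV" and sub_field_UNIV: "sub_field UNIV"
  by (auto simp: sub_ring_def sub_field_def)

lemma subring_iff:
  assumes F: "sub_ring F" shows "subring V (ring_on F) \<longleftrightarrow> sub_ring V \<and> V \<subseteq> F"
proof
  assume s: "subring V (ring_on F)"
  have VF: "V \<subseteq> F" using subringE(1)[OF s] by simp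
  have "a - b \<in> V" if "a \<in> V" "b \<in> V" for a b
    using subringE(7)[OF s that(1) subringE(5)[OF s that(2)]] ring_on_uminus[OF F] that VF by auto
  then show "sub_ring V \<and> V \<subseteq> F"
    using VF subringE(3)[OF s] subringE(6)[OF s] by (auto simp: sub_ring_def)
next
  assume V: "sub_ring V \<and> V \<subseteq> F"
  interpret cring "ring_on F" by (rule cring_ring_on[OF F])
  show "subring V (ring_on F)"
    by (rule subringI) (use V in \<open>auto simp: ring_on_uminus[OF F] subset_iff intro: sub_ring_intros\<close>)
qed

lemma type_algebra_inv:
  assumes "(a::'a::field) \<noteq> 0" shows "inv\<^bsub>ring_of_type_algebra\<^esub> a = inverse a"
proof -
  interpret R: field "ring_of_type_algebra :: 'a ring" by (rule field_from_type_algebra)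
  show ?thesis by (rule R.comm_inv_char) (use assms in auto)
qed

lemma subfield_imp_sub_field:
  assumes "subfield K (ring_of_type_algebra :: 'a::field ring)" shows "sub_field K"
proof -
  interpret R: field "ring_of_type_algebra :: 'a ring" by (rule field_from_type_algebra)
  have r: "sub_ring K"
    using subring_iff[OF sub_ring_UNIV] subfieldE(1)[OF assms] unfolding ring_on_UNIV by auto
  moreover have "inverse a \<in> K" if "a \<in> K" for a
    using R.subfield_m_inv(1)[OF assms, of a] type_algebra_inv[of a] that
    by (cases "a = 0") (auto intro: sub_ring_zero[OF r])
  ultimately show ?thesis by (auto simp: sub_field_def)
qed

lemma sub_field_generate_field: "sub_field (generate_field ring_of_type_algebra (H :: 'a::field set))"
proof -
  interpret R: field "ring_of_type_algebra :: 'a ring" by (rule field_from_type_algebra)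
  show ?thesis by (rule subfield_imp_sub_field) (rule R.generate_field_is_subfield, simp)
qed

lemma generate_field_least:
  assumes S: "sub_field S" and H: "H \<subseteq> S"
  shows "generate_field ring_of_type_algebra H \<subseteq> S"
proof
  fix z assume "z \<in> generate_field ring_of_type_algebra H"
  then show "z \<in> S"
  proof induction
    case (a_inv h)
    then show ?case
      using ring_on_uminus[OF sub_ring_UNIV, of h] sub_field_intros[OF S] unfolding ring_on_UNIV by simp
  next
    case (m_inv h)
    then show ?case using type_algebra_inv[of h] sub_field_inverse[OF S] by simp
  qed (use H in \<open>auto intro: sub_field_intros[OF S]\<close>)
qed

text \<open>Polynomials of the algebra library are coefficient lists that start with a nonzero
  leading coefficient, so \<open>rev (coeffs p)\<close> translates between the two
  representations.\<close>

lemma transcendental_iff: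
  fixes K :: "'a::field set"
  assumes "sub_ring K"
  shows "ring.transcendental ring_of_type_algebra K x \<longleftrightarrow> (\<forall>p\<in>pols K. poly p x = 0 \<longrightarrow> p = 0)"
proof -
  let ?R = "ring_of_type_algebra :: 'a ring"
  interpret R: field ?R by (rule field_from_type_algebra)
  have sr: "subring K ?R" using subring_iff[OF sub_ring_UNIV] assms unfolding ring_on_UNIV by auto
  have eval: "R.eval (rev (coeffs p)) x = poly p x" for p
  proof (induction p)
    case (pCons a p)
    have app: "R.eval (l @ [a]) x = R.eval l x * x + a" for l
      by (rule R.eval_append_aux[simplified])
    show ?case using pCons app by (cases "p = 0 \<and> a = 0") (auto simp: cCons_def)
  qed simp
  have pol: "rev (coeffs p) \<in> carrier (K [X]\<^bsub>?R\<^esub>)" if "p \<in> pols K" for p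
    using that unfolding univ_poly_def polynomial_def
    by (auto simp: pols_def hd_rev last_coeffs_eq_coeff_degree coeffs_def)
  have repr: "\<exists>p\<in>pols K. l = rev (coeffs p)" if "l \<in> carrier (K [X]\<^bsub>?R\<^esub>)" for l
  proof
    have l: "set l \<subseteq> K" "l \<noteq> [] \<longrightarrow> hd l \<noteq> 0"
      using that unfolding univ_poly_def polynomial_def by auto
    then have "no_trailing (HOL.eq 0) (rev l)" by (cases l) auto
    then have "coeffs (Poly (rev l)) = rev l" by (simp add: coeffs_Poly dropWhile_idem_iff)
    then show "l = rev (coeffs (Poly (rev l)))" by simp
    show "Poly (rev l) \<in> pols K"
      using l sub_ring_zero[OF assms] by (auto simp: pols_def nth_default_def rev_nth subset_iff)
  qed
  show ?thesis
  proof
    assume t: "R.transcendental K x"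
    show "\<forall>p\<in>pols K. poly p x = 0 \<longrightarrow> p = 0"
      using R.eval_transcendental[unfolded over_def, OF t pol] eval by simp
  next
    assume t: "\<forall>p\<in>pols K. poly p x = 0 \<longrightarrow> p = 0"
    show "R.transcendental K x"
    proof (rule R.trivial_ker_imp_transcendental[unfolded over_def, OF sr])
      have "l = []" if l: "l \<in> carrier (K [X]\<^bsub>?R\<^esub>)" "R.eval l x = 0" for l
        using repr[OF l(1)] l(2) eval t by force
      moreover have "[] \<in> carrier (K [X]\<^bsub>?R\<^esub>)" by (simp add: univ_poly_def polynomial_def)
      ultimately show "a_kernel (K [X]\<^bsub>?R\<^esub>) ?R (\<lambda>p. R.eval p x) = {[]}"
        unfolding a_kernel_def' by auto
    qed auto
  qed
qed

context vring_ctx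
begin

lemma ideal_P: "ideal P (ring_on V)"
proof -
  interpret R: cring "ring_on V" by (rule cring_ring_on[OF V_ring])
  show ?thesis
  proof (rule idealI)
    show "subgroup P (add_monoid (ring_on V))"
    proof (rule R.add.subgroupI)
      show "P \<noteq> {}" using P_0 by auto
    next
      fix a assume "a \<in> P"
      then show "\<ominus>\<^bsub>ring_on V\<^esub> a \<in> P" using ring_on_uminus[OF V_ring PV] P_uminus by simp
    qed (auto intro: PV P_add)
  qed (auto intro: P_mult R.ring_axioms)
qed

text \<open>A member of \<open>V\<close> outside \<open>P\<close> has its inverse in
  \<open>V\<close>, so an ideal containing it is everything; hence \<open>P\<close> contains every
  proper ideal.\<close>

lemma maximalideal_iff: "maximalideal M (ring_on V) \<longleftrightarrow> M = P"
proof
  have unitI: "J = V" if "ideal J (ring_on V)" "z \<in> J" "z \<notin> P" for J z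
  proof -
    interpret ideal J "ring_on V" by fact
    have z: "z \<in> V" using that Icarr by simp
    then have "inverse z \<in> V" "z \<noteq> 0" using that by (auto simp: nonunits_def)
    then have "1 \<in> J" using I_l_closed[OF that(2), of "inverse z"] by simp
    then show "J = V" using one_imp_carrier by simp
  qed
  {
    assume M: "maximalideal M (ring_on V)"
    interpret maximalideal M "ring_on V" by fact
    have "M \<subseteq> P" using unitI[OF ideal_axioms] I_notcarr by auto
    then have "P = M \<or> P = V" using I_maximal[OF ideal_P] PV by auto
    then show "M = P" using P_1 V_intros(1) by auto
  }
  assume "M = P"
  moreover have "J = P \<or> J = V" if "ideal J (ring_on V)" "P \<subseteq> J" for J
    using unitI[OF that(1)] that(2) by blast
  moreover have "V \<noteq> P" using P_1 V_intros(1) by auto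
  ultimately show "maximalideal M (ring_on V)" using maximalidealI[OF ideal_P] by (metis ring_on_simps(1))
qed

end

text \<open>The strict inclusion of \<open>K\<close> is automatic: if the field \<open>K\<close>
  were equal to \<open>V\<close>, it would contain with \<open>inverse z\<close> also
  \<open>z\<close>, and so all of \<open>F\<close>.\<close>

lemma valuation_ring_iff:
  assumes F: "sub_field F" and K: "sub_field K"
  shows "valuation_ring K F V \<longleftrightarrow> vring K F V"
proof -
  have "K \<noteq> V" if v: "vring K F V"
  proof
    assume "K = V"
    then have "F \<subseteq> V" using v K sub_field_inverse[OF K] unfolding vring_def
      by (metis inverse_inverse_eq subsetI)
    then show False using v by (auto simp: vring_def)
  qed
  then show ?thesis unfolding valuation_ring_def subring_iff[OF sub_field_ring[OF F]]
    by (auto simp: vring_def)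
qed

lemma places_iff:
  assumes F: "sub_field F" and K: "sub_field K"
  shows "Q \<in> places K F \<longleftrightarrow> (\<exists>V. vring K F V \<and> Q = nonunits V)"
proof -
  have "maximalideal Q (ring_on V) \<longleftrightarrow> Q = nonunits V" if "vring K F V" for V
  proof -
    interpret vring_ctx K F V by unfold_locales (use F that in auto)
    show ?thesis by (rule maximalideal_iff)
  qed
  then show ?thesis unfolding places_def valuation_ring_iff[OF F K] by auto
qed

context vring_ctx
begin

text \<open>Dimension 1 says that the residue field consists of the multiples of one class by
  classes of constants. The right-hand side is the form used later, in which that class is
  1.\<close>

lemma rational_iff:
  assumes K: "sub_field K"
  shows "ring.dimension (residue_field F P) 1
       ((\<lambda>c. P +>\<^bsub>ring_on (place_ring F P)\<^esub> c) ` K) (carrier (residue_field F P)) \<longleftrightarrow>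
     (\<forall>z\<in>V. \<exists>c\<in>K. z - c \<in> P)"
proof -
  let ?R = "ring_on V" and ?Q = "ring_on V Quot P"
  interpret R: cring ?R by (rule cring_ring_on[OF V_ring])
  interpret I: ideal P ?R by (rule ideal_P)
  interpret Q: cring ?Q by (rule I.quotient_is_cring[OF R.is_cring])
  define cs where "cs z = P +>\<^bsub>?R\<^esub> z" for z
  have sub: "a \<ominus>\<^bsub>?R\<^esub> b = a - b" if "a \<in> V" "b \<in> V" for a b
    using that ring_on_uminus[OF V_ring] by (simp add: a_minus_def)
  have cs_eq: "cs a = cs b \<longleftrightarrow> a - b \<in> P" if "a \<in> V" "b \<in> V" for a b
    using R.quotient_eq_iff_same_a_r_cos[OF ideal_P, of a b] sub that by (auto simp: cs_def)
  have carr: "carrier ?Q = cs ` V"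
    by (auto simp: FactRing_simps cs_def a_r_coset_def)
  have mult: "cs a \<otimes>\<^bsub>?Q\<^esub> cs b = cs (a * b)" if "a \<in> V" "b \<in> V" for a b
    using I.rcoset_mult_add[of a b] that by (simp add: FactRing_def cs_def)
  have zero: "\<zero>\<^bsub>?Q\<^esub> = cs 0"
    using I.a_rcos_const[OF P_0] by (simp add: FactRing_def cs_def)
  have ext: "Q.line_extension (cs ` K) (cs w) {\<zero>\<^bsub>?Q\<^esub>} = (\<lambda>k. cs (k * w)) ` K" if w: "w \<in> V" for w
  proof -
    have "cs (k * w) \<oplus>\<^bsub>?Q\<^esub> \<zero>\<^bsub>?Q\<^esub> = cs (k * w)" if "k \<in> K" for k
      by (rule Q.r_zero) (use that w KV carr in \<open>auto intro: V_intros(4)\<close>)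
    moreover have "cs k \<otimes>\<^bsub>?Q\<^esub> cs w = cs (k * w)" if "k \<in> K" for k using mult that w KV by auto
    ultimately show ?thesis
      unfolding Q.line_extension_def r_coset_def set_add_def' by (auto simp: image_iff)
  qed
  have dim: "Q.dimension 1 (cs ` K) (cs ` V) \<longleftrightarrow> (\<exists>w\<in>V. w \<notin> P \<and> cs ` V = (\<lambda>k. cs (k * w)) ` K)"
  proof
    assume "Q.dimension 1 (cs ` K) (cs ` V)"
    then obtain v E' where v: "v \<in> carrier ?Q" "Q.dimension 0 (cs ` K) E'" "v \<notin> E'"
      "cs ` V = Q.line_extension (cs ` K) v E'"
      by (auto elim: Q.dimension.cases)
    have E': "E' = {\<zero>\<^bsub>?Q\<^esub>}" using v(2) by (cases rule: Q.dimension.cases) auto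
    obtain w where w: "w \<in> V" "v = cs w" using v(1) carr by auto
    have "w \<notin> P" using v(3) cs_eq[of w 0] w zero E' by (auto simp: V_intros(2))
    then show "\<exists>w\<in>V. w \<notin> P \<and> cs ` V = (\<lambda>k. cs (k * w)) ` K"
      using v(4) ext w E' by auto
  next
    assume "\<exists>w\<in>V. w \<notin> P \<and> cs ` V = (\<lambda>k. cs (k * w)) ` K"
    then obtain w where w: "w \<in> V" "w \<notin> P" "cs ` V = (\<lambda>k. cs (k * w)) ` K" by auto
    have "cs w \<notin> {\<zero>\<^bsub>?Q\<^esub>}" using w cs_eq[of w 0] zero by (auto simp: V_intros(2))
    then have "Q.dimension (Suc 0) (cs ` K) (Q.line_extension (cs ` K) (cs w) {\<zero>\<^bsub>?Q\<^esub>})"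
      by (intro Q.Suc_dim Q.zero_dim) (use w carr in auto)
    then show "Q.dimension 1 (cs ` K) (cs ` V)" using ext[OF w(1)] w(3) by simp
  qed
  have "(\<exists>w\<in>V. w \<notin> P \<and> cs ` V = (\<lambda>k. cs (k * w)) ` K) \<longleftrightarrow> (\<forall>z\<in>V. \<exists>c\<in>K. z - c \<in> P)"
  proof
    assume "\<exists>w\<in>V. w \<notin> P \<and> cs ` V = (\<lambda>k. cs (k * w)) ` K"
    then obtain w where w: "w \<in> V" "w \<notin> P" "cs ` V = (\<lambda>k. cs (k * w)) ` K" by auto
    have rep: "\<exists>k\<in>K. z - k * w \<in> P" if "z \<in> V" for z
    proof -
      obtain k where "k \<in> K" "cs z = cs (k * w)" using w(3) \<open>z \<in> V\<close> by blast
      moreover from this have "k * w \<in> V" using w KV by (intro V_intros(4)) auto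
      ultimately show ?thesis using cs_eq[of z "k * w"] that by auto
    qed
    \<comment> \<open>The class of 1 is itself a multiple \<open>k0 * w\<close>, so a residue
      \<open>k * w\<close> equals the constant \<open>k / k0\<close>: the generator \<open>w\<close>
      is traded for 1.\<close>
    obtain k0 where k0: "k0 \<in> K" "1 - k0 * w \<in> P" using rep[OF V_intros(1)] by auto
    then have "k0 \<noteq> 0" using P_1 by auto
    show "\<forall>z\<in>V. \<exists>c\<in>K. z - c \<in> P"
    proof
      fix z assume "z \<in> V"
      then obtain k where k: "k \<in> K" "z - k * w \<in> P" using rep by auto
      have c: "k / k0 \<in> K" using k k0 K by (auto intro: sub_field_intros)
      then have "(z - k * w) - (k / k0) * (1 - k0 * w) \<in> P"
        using P_diff[OF k(2) P_mult(1)[OF _ k0(2)]] KV by blast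
      also have "(z - k * w) - (k / k0) * (1 - k0 * w) = z - k / k0"
        using \<open>k0 \<noteq> 0\<close> by (simp add: field_simps)
      finally show "\<exists>c\<in>K. z - c \<in> P" using c by blast
    qed
  next
    assume *: "\<forall>z\<in>V. \<exists>c\<in>K. z - c \<in> P"
    have "cs ` V = (\<lambda>k. cs (k * 1)) ` K"
    proof
      show "cs ` V \<subseteq> (\<lambda>k. cs (k * 1)) ` K"
      proof
        fix a assume "a \<in> cs ` V"
        then obtain z where z: "z \<in> V" "a = cs z" by auto
        then obtain c where c: "c \<in> K" "z - c \<in> P" using * by auto
        then have "cs z = cs c" using cs_eq[of z c] z KV by auto
        then show "a \<in> (\<lambda>k. cs (k * 1)) ` K" using c z by auto
      qed
    qed (use KV in auto)
    then show "\<exists>w\<in>V. w \<notin> P \<and> cs ` V = (\<lambda>k. cs (k * w)) ` K"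
      using unit_1 by (intro bexI[of _ 1]) auto
  qed
  moreover have "residue_field F P = ?Q" by (simp add: residue_field_def place_ring_eq)
  moreover have "(\<lambda>c. P +>\<^bsub>ring_on (place_ring F P)\<^esub> c) = cs"
    by (rule HOL.ext) (simp add: cs_def place_ring_eq)
  ultimately show ?thesis using dim carr by metis
qed

end

lemma rational_places_iff:
  assumes F: "sub_field F" and K: "sub_field K"
  shows "Q \<in> rational_places K F \<longleftrightarrow>
    (\<exists>V. vring K F V \<and> Q = nonunits V \<and> (\<forall>z\<in>V. \<exists>c\<in>K. z - c \<in> Q))"
proof -
  have "ring.dimension (residue_field F (nonunits V)) 1
       ((\<lambda>c. nonunits V +>\<^bsub>ring_on (place_ring F (nonunits V))\<^esub> c) ` K)
       (carrier (residue_field F (nonunits V))) \<longleftrightarrow> (\<forall>z\<in>V. \<exists>c\<in>K. z - c \<in> nonunits V)"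
    if "vring K F V" for V
  proof -
    interpret vring_ctx K F V by unfold_locales (use F that in auto)
    show ?thesis by (rule rational_iff[OF K])
  qed
  then show ?thesis unfolding rational_places_def places_iff[OF F K] by auto
qed

section \<open>Chevalley's extension theorem\<close>

definition ideal_of :: "'a::field set \<Rightarrow> 'a set \<Rightarrow> bool" where
  "ideal_of I S \<longleftrightarrow> I \<subseteq> S \<and> 0 \<in> I \<and> 1 \<notin> I \<and> (\<forall>a\<in>I. \<forall>b\<in>I. a + b \<in> I) \<and> (\<forall>a\<in>S. \<forall>b\<in>I. a * b \<in> I)"

text \<open>Given such \<open>p\<close> and \<open>q\<close>, the one of larger degree can be
  replaced by one of smaller degree, again and again until 1 itself lies in \<open>I\<close>. In
  Chevalley's theorem this is what makes a maximal pair absorb \<open>z\<close> or its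
  inverse.\<close>

lemma ideal_of_no_inverse_pair:
  assumes S: "sub_ring S" and I: "ideal_of I S"
  shows "z \<noteq> 0 \<Longrightarrow> \<forall>n. coeff p n \<in> I \<Longrightarrow> \<forall>n. coeff q n \<in> I \<Longrightarrow> poly p z = 1 \<Longrightarrow>
    poly q (inverse z) = 1 \<Longrightarrow> False"
proof (induction "degree p + degree q" arbitrary: p q z rule: less_induct)
  case less
  have Iadd: "a + b \<in> I" if "a \<in> I" "b \<in> I" for a b using I that by (auto simp: ideal_of_def)
  have Imult: "a * b \<in> I" if "a \<in> S" "b \<in> I" for a b using I that by (auto simp: ideal_of_def)
  have I1: "1 \<notin> I" and I0: "0 \<in> I" and IS: "a \<in> I \<Longrightarrow> a \<in> S" for a using I by (auto simp: ideal_of_def)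
  have step: False if hyp: "\<And>p'. degree p' < degree p \<Longrightarrow> \<forall>n. coeff p' n \<in> I \<Longrightarrow> poly p' z = 1 \<Longrightarrow> False"
    and le: "degree q \<le> degree p" and z: "z \<noteq> 0" and p: "\<forall>n. coeff p n \<in> I" "poly p z = 1"
    and q: "\<forall>n. coeff q n \<in> I" "poly q (inverse z) = 1" for p q :: "'a poly" and z
  proof (cases "degree p = 0")
    case True
    then obtain c where "p = [:c:]" by (auto elim: degree_eq_zeroE)
    then show False using p I1 by (metis coeff_pCons_0 poly_const_conv)
  next
    case False
    define n m q0 pn where "n = degree p" and "m = degree q" and "q0 = coeff q 0" and "pn = lead_coeff p"
    define Q where "Q = reflect_poly q - monom q0 m"
    \<comment> \<open>Multiplying the relation for \<open>q\<close> by \<open>z ^ m\<close> gives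
      \<open>(1 - q0) * z ^ m = poly Q z\<close>. So once the lower terms of \<open>p\<close> are
      multiplied by \<open>1 - q0\<close>, the leading term can be exchanged for
      \<open>pn * z ^ (n - m) * poly Q z\<close>, which has degree below \<open>n\<close>. Carrying
      the factor \<open>1 - q0\<close> along avoids inverting it; the summand \<open>q0\<close>
      restores the value 1.\<close>
    define p' where "p' = [:q0:] + smult (1 - q0) (p - monom pn n) + smult pn (monom 1 (n - m) * Q)"
    have Q: "poly Q z = z ^ m - q0 * z ^ m"
      using z q by (simp add: Q_def poly_reflect_poly_nz poly_monom m_def)
    have "poly p' z = q0 + (1 - q0) * (1 - pn * z ^ n) + pn * (z ^ (n - m) * (z ^ m - q0 * z ^ m))"
      by (simp add: p'_def Q poly_monom p)
    also have "z ^ (n - m) * (z ^ m - q0 * z ^ m) = z ^ n - q0 * z ^ n"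
    proof -
      have "z ^ (n - m) * z ^ m = z ^ n" using le by (simp add: n_def m_def flip: power_add)
      then show ?thesis by (simp add: right_diff_distrib mult.left_commute)
    qed
    finally have "poly p' z = 1" by (simp add: algebra_simps)
    moreover have Qc: "coeff Q k = (if k < m then coeff q (m - k) else 0)" for k
      by (auto simp: Q_def coeff_reflect_poly m_def q0_def)
    then have Qco: "coeff Q k \<in> I" for k using q I0 by simp
    have c: "coeff p' k = (if k = 0 then q0 else 0) + (1 - q0) * (coeff p k - (if k = n then pn else 0))
        + pn * (if k < n - m then 0 else coeff Q (k - (n - m)))" for k
      by (simp add: p'_def coeff_monom_mult coeff_pCons split: nat.split)
    have "coeff p' k \<in> I" for k unfolding c
      by (intro Iadd Imult) (use p q Qco I0 sub_ring_intros[OF S] IS in \<open>auto simp: q0_def pn_def n_def\<close>)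
    moreover have "degree p' < n"
    proof (rule degree_lessI)
      show "p' \<noteq> 0 \<or> n > 0" using False by (simp add: n_def)
      show "\<forall>k\<ge>n. coeff p' k = 0"
        using False le by (auto simp: c Qc n_def m_def pn_def coeff_eq_0)
    qed
    ultimately show False using hyp unfolding n_def by blast
  qed
  show False
  proof (cases "degree q \<le> degree p")
    case True
    show False
    proof (rule step[OF _ True less.prems(1,2,4,3,5)])
      fix p' assume "degree p' < degree p" "\<forall>n. coeff p' n \<in> I" "poly p' z = 1"
      then show False using less.hyps[of p' q z] less.prems by auto
    qed
  next
    case False
    show False
    proof (rule step[where p = q and q = p and z = "inverse z"])
      fix p' assume "degree p' < degree q" "\<forall>n. coeff p' n \<in> I" "poly p' (inverse z) = 1"
      then show False using less.hyps[of p' p "inverse z"] less.prems by (simp add: add.commute)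
    qed (use False less.prems in auto)
  qed
qed

lemma sub_ring_adjoin: assumes "sub_ring S" shows "sub_ring ((\<lambda>p. poly p z) ` pols S)"
  unfolding sub_ring_def
proof (intro conjI ballI)
  show "1 \<in> (\<lambda>p. poly p z) ` pols S" using pols_1[OF assms] by (force simp: image_iff)
  fix a b assume "a \<in> (\<lambda>p. poly p z) ` pols S" "b \<in> (\<lambda>p. poly p z) ` pols S"
  then obtain p q where pq: "p \<in> pols S" "q \<in> pols S" "a = poly p z" "b = poly q z" by auto
  then show "a - b \<in> (\<lambda>p. poly p z) ` pols S" "a * b \<in> (\<lambda>p. poly p z) ` pols S"
    using pols_diff[OF assms pq(1,2)] pols_mult[OF assms pq(1,2)]
    by (force simp: image_iff)+
qed

lemma adjoin_self: assumes "sub_ring S" shows "z \<in> (\<lambda>p. poly p z) ` pols S"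
  using pols_pCons[OF assms sub_ring_zero[OF assms] pols_1[OF assms]] by (force simp: image_iff)

lemma adjoin_incl: assumes "sub_ring S" shows "S \<subseteq> (\<lambda>p. poly p z) ` pols S"
  using pols_const[OF assms] by (force simp: image_iff)

text \<open>A pair consisting of a subring and a proper ideal of it is coded as a subset of
  \<^typ>\<open>'a \<times> bool\<close>, so that Zorn's lemma for inclusion applies.\<close>

theorem chevalley:
  fixes F :: "'a::field set"
  assumes F: "sub_field F" and R: "sub_ring R" "R \<subseteq> F" and J: "ideal_of J R"
  obtains V where "sub_ring V" "R \<subseteq> V" "V \<subseteq> F" "\<And>z. z \<in> F \<Longrightarrow> z \<in> V \<or> inverse z \<in> V" "J \<subseteq> nonunits V"
proof -
  define st :: "('a \<times> bool) set \<Rightarrow> 'a set" where "st = (\<lambda>Y. {a. (a, True) \<in> Y})"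
  define sf :: "('a \<times> bool) set \<Rightarrow> 'a set" where "sf = (\<lambda>Y. {a. (a, False) \<in> Y})"
  define code where "code S I = S \<times> {True} \<union> I \<times> {False}" for S I :: "'a set"
  define \<A> where "\<A> = {Y. sub_ring (st Y) \<and> R \<subseteq> st Y \<and> st Y \<subseteq> F \<and> J \<subseteq> sf Y \<and> ideal_of (sf Y) (st Y)}"
  have code: "st (code S I) = S" "sf (code S I) = I" for S I by (auto simp: st_def sf_def code_def)
  have subI: "W \<subseteq> Y" if "st W \<subseteq> st Y" "sf W \<subseteq> sf Y" for W Y
  proof
    fix e assume "e \<in> W"
    then show "e \<in> Y" using that by (cases e; cases "snd e") (auto simp: st_def sf_def subset_iff)
  qed
  have "\<exists>M\<in>\<A>. \<forall>W\<in>\<A>. M \<subseteq> W \<longrightarrow> W = M"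
  proof (rule subset_Zorn_nonempty)
    have "code R J \<in> \<A>" using R J by (simp add: \<A>_def code)
    then show "\<A> \<noteq> {}" by auto
  next
    fix \<C> assume ne: "\<C> \<noteq> {}" and ch: "subset.chain \<A> \<C>"
    have CA: "W \<in> \<A>" if "W \<in> \<C>" for W using ch that by (auto simp: subset.chain_def)
    have lin: "W \<subseteq> Y \<or> Y \<subseteq> W" if "W \<in> \<C>" "Y \<in> \<C>" for W Y
      using ch that unfolding subset.chain_def by blast
    have two: "\<exists>Z\<in>\<C>. p \<in> Z \<and> q \<in> Z" if pq: "p \<in> \<Union>\<C>" "q \<in> \<Union>\<C>" for p q
    proof -
      obtain Y Z where YZ: "Y \<in> \<C>" "p \<in> Y" "Z \<in> \<C>" "q \<in> Z" using pq by auto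
      then show ?thesis using lin[of Y Z] by blast
    qed
    have inC: "sub_ring (st Z)" "ideal_of (sf Z) (st Z)" "R \<subseteq> st Z" "J \<subseteq> sf Z" "st Z \<subseteq> F"
      "st Z \<subseteq> st (\<Union>\<C>)" "sf Z \<subseteq> sf (\<Union>\<C>)" if "Z \<in> \<C>" for Z
      using CA[OF that] that by (auto simp: \<A>_def st_def sf_def)
    obtain Z0 where Z0: "Z0 \<in> \<C>" using ne by auto
    have "sub_ring (st (\<Union>\<C>))"
      unfolding sub_ring_def
    proof (intro conjI ballI)
      show "1 \<in> st (\<Union>\<C>)" using inC[OF Z0] sub_ring_one by blast
      fix a b assume "a \<in> st (\<Union>\<C>)" "b \<in> st (\<Union>\<C>)"
      then obtain Z where Z: "Z \<in> \<C>" "a \<in> st Z" "b \<in> st Z" using two[of "(a, True)" "(b, True)"]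
        by (auto simp: st_def)
      then show "a - b \<in> st (\<Union>\<C>)" "a * b \<in> st (\<Union>\<C>)"
        using inC[OF Z(1)] sub_ring_diff sub_ring_mult by blast+
    qed
    moreover have "ideal_of (sf (\<Union>\<C>)) (st (\<Union>\<C>))"
      unfolding ideal_of_def
    proof (intro conjI ballI)
      show "0 \<in> sf (\<Union>\<C>)" using inC[OF Z0] by (auto simp: ideal_of_def)
      show "sf (\<Union>\<C>) \<subseteq> st (\<Union>\<C>)"
      proof
        fix a assume "a \<in> sf (\<Union>\<C>)"
        then obtain Z where "Z \<in> \<C>" "a \<in> sf Z" by (auto simp: sf_def)
        then show "a \<in> st (\<Union>\<C>)" using inC[of Z] by (auto simp: ideal_of_def)
      qed
      show "1 \<notin> sf (\<Union>\<C>)"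
      proof
        assume "1 \<in> sf (\<Union>\<C>)"
        then obtain Z where "Z \<in> \<C>" "1 \<in> sf Z" by (auto simp: sf_def)
        then show False using inC[of Z] by (auto simp: ideal_of_def)
      qed
      fix b assume b: "b \<in> sf (\<Union>\<C>)"
      {
        fix a assume "a \<in> sf (\<Union>\<C>)"
        then obtain Z where Z: "Z \<in> \<C>" "a \<in> sf Z" "b \<in> sf Z"
          using two[of "(a, False)" "(b, False)"] b by (auto simp: sf_def)
        then have "a + b \<in> sf Z" using inC(2)[OF Z(1)] by (auto simp: ideal_of_def)
        then show "a + b \<in> sf (\<Union>\<C>)" using inC[OF Z(1)] by auto
      }
      fix a assume "a \<in> st (\<Union>\<C>)"
      then obtain Z where Z: "Z \<in> \<C>" "a \<in> st Z" "b \<in> sf Z"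
        using two[of "(a, True)" "(b, False)"] b by (auto simp: sf_def st_def)
      then have "a * b \<in> sf Z" using inC(2)[OF Z(1)] by (auto simp: ideal_of_def)
      then show "a * b \<in> sf (\<Union>\<C>)" using inC[OF Z(1)] by auto
    qed
    moreover have "R \<subseteq> st (\<Union>\<C>)" "J \<subseteq> sf (\<Union>\<C>)" using inC[OF Z0] by auto
    moreover have "st (\<Union>\<C>) \<subseteq> F" using inC(5) by (auto simp: st_def)
    ultimately show "\<Union>\<C> \<in> \<A>" by (simp add: \<A>_def)
  qed
  then obtain M where M: "M \<in> \<A>" and max: "\<And>W. W \<in> \<A> \<Longrightarrow> M \<subseteq> W \<Longrightarrow> W = M" by blast
  define S I where "S = st M" and "I = sf M"
  have S: "sub_ring S" "R \<subseteq> S" "S \<subseteq> F" "J \<subseteq> I" and I: "ideal_of I S"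
    using M by (auto simp: \<A>_def S_def I_def)
  \<comment> \<open>Maximality: for \<open>z\<close> outside \<open>S\<close> the ideal generated by
    \<open>I\<close> in \<open>S[z]\<close> cannot be proper, since otherwise the pair could be
    enlarged.\<close>
  have adj: "\<exists>p. (\<forall>n. coeff p n \<in> I) \<and> poly p z = 1" if z: "z \<in> F" "z \<notin> S" for z
  proof (rule ccontr)
    assume no: "\<not> ?thesis"
    let ?S = "(\<lambda>p. poly p z) ` pols S" and ?I = "(\<lambda>p. poly p z) ` {p. \<forall>n. coeff p n \<in> I}"
    have II: "I \<subseteq> S" "0 \<in> I" "\<And>a b. a \<in> I \<Longrightarrow> b \<in> I \<Longrightarrow> a + b \<in> I" "\<And>a b. a \<in> S \<Longrightarrow> b \<in> I \<Longrightarrow> a * b \<in> I"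
      using I by (auto simp: ideal_of_def)
    have Isum: "sum g A \<in> I" if "\<And>i. i \<in> A \<Longrightarrow> g i \<in> I" for g and A :: "nat set"
      using that by (induction A rule: infinite_finite_induct) (auto intro: II)
    have "ideal_of ?I ?S" unfolding ideal_of_def
    proof (intro conjI ballI)
      show "?I \<subseteq> ?S" using II(1) by (auto simp: pols_def)
      show "0 \<in> ?I" using II(2) by (intro image_eqI[of _ _ 0]) auto
      show "1 \<notin> ?I" using no by auto
      fix b assume "b \<in> ?I"
      then obtain q where q: "\<forall>n. coeff q n \<in> I" "b = poly q z" by auto
      {
        fix a assume "a \<in> ?I"
        then obtain p where p: "\<forall>n. coeff p n \<in> I" "a = poly p z" by auto
        then show "a + b \<in> ?I" using q II(3) by (intro image_eqI[of _ _ "p + q"]) auto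
      }
      fix a assume "a \<in> ?S"
      then obtain p where p: "p \<in> pols S" "a = poly p z" by auto
      then show "a * b \<in> ?I" using q II(4)
        by (intro image_eqI[of _ _ "p * q"]) (auto simp: coeff_mult pols_def intro!: Isum)
    qed
    moreover have "R \<subseteq> ?S" "S \<subseteq> ?S" using adjoin_incl[OF S(1), of z] S(2) by auto
    moreover have "?S \<subseteq> F"
      using poly_pols[OF sub_field_ring[OF F] S(3) z(1)] by auto
    moreover have "I \<subseteq> ?I"
    proof
      fix a assume "a \<in> I"
      then show "a \<in> ?I" using II(2)
        by (intro image_eqI[of _ _ "[:a:]"]) (auto simp: coeff_pCons split: nat.split)
    qed
    moreover have "st M \<subseteq> st (code ?S ?I)" "sf M \<subseteq> sf (code ?S ?I)"
      using calculation unfolding code S_def I_def by blast+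
    then have "M \<subseteq> code ?S ?I" by (rule subI)
    moreover have "J \<subseteq> ?I" using calculation S(4) by blast
    ultimately have "code ?S ?I \<in> \<A>" "M \<subseteq> code ?S ?I"
      using sub_ring_adjoin[OF S(1), of z] by (simp_all add: \<A>_def code)
    then have "code ?S ?I = M" by (rule max)
    then have "?S = S" using code(1) S_def by metis
    then show False using adjoin_self[OF S(1), of z] z by simp
  qed
  have "z \<in> S \<or> inverse z \<in> S" if z: "z \<in> F" for z
  proof (rule ccontr)
    assume no: "\<not> ?thesis"
    then have "z \<noteq> 0" using sub_ring_zero[OF S(1)] by auto
    then show False
      using ideal_of_no_inverse_pair[OF S(1) I] adj[OF z] adj[OF sub_field_inverse[OF F z]] no by blast
  qed
  moreover have "J \<subseteq> nonunits S"
  proof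
    fix b assume "b \<in> J"
    then have b: "b \<in> I" "b \<in> S" using S I by (auto simp: ideal_of_def)
    have "inverse b \<notin> S" if "b \<noteq> 0"
    proof
      assume "inverse b \<in> S"
      then have "inverse b * b \<in> I" using b(1) I by (auto simp: ideal_of_def)
      then show False using that I by (auto simp: ideal_of_def)
    qed
    then show "b \<in> nonunits S" using b by (auto simp: nonunits_def)
  qed
  ultimately show ?thesis using that S by blast
qed

section \<open>Discrete valuations\<close>

text \<open>A discrete valuation ring in the multiplicative form in which \<open>place_val\<close>
  reads off orders; that \<open>t\<close> generates the maximal ideal is derived in
  \<open>val_exists\<close>.\<close>

locale dvr_ctx = vring_ctx +
  assumes discrete: "\<exists>t\<in>nonunits V. \<forall>z\<in>F. z \<noteq> 0 \<longrightarrow> (\<exists>n. \<exists>u\<in>V - nonunits V. z = t powi n * u)"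
begin

abbreviation val where "val \<equiv> place_val F (nonunits V)"

text \<open>\<open>place_val\<close> admits any generator of \<open>P\<close> as uniformizer. Two
  generators differ by a unit, and \<open>t powi n\<close> is a unit only for \<open>n = 0\<close>,
  so the order does not depend on the choice and the definite description is meaningful.\<close>

lemma val_exists:
  "\<exists>t\<in>P. t \<noteq> 0 \<and> (\<forall>z\<in>F. z \<noteq> 0 \<longrightarrow> (\<exists>u\<in>V - P. z = t powi (val z) * u)) \<and>
     (\<forall>n. \<forall>u\<in>V - P. val (t powi n * u) = n)"
proof -
  obtain t where t: "t \<in> P" and rep: "\<And>z. z \<in> F \<Longrightarrow> z \<noteq> 0 \<Longrightarrow> \<exists>n. \<exists>u\<in>V - P. z = t powi n * u"
    using discrete by auto
  \<comment> \<open>Powers of 0 other than the zeroth vanish, so \<open>t = 0\<close> would make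
    every nonzero element of \<open>F\<close> a unit of \<open>V\<close>.\<close>
  have "t \<noteq> 0"
  proof
    assume "t = 0"
    obtain z where z: "z \<in> F" "z \<notin> V" using VF by auto
    then obtain n u where nu: "u \<in> V - P" "z = t powi n * u" "z \<noteq> 0" using rep V_intros(2) by metis
    then have "n = 0" using \<open>t = 0\<close> by (cases "n = 0") (auto simp: power_int_0_left_if)
    then show False using nu z by simp
  qed
  have posP: "t powi n * u \<in> P" if "n > 0" "u \<in> V" for n :: int and u
  proof -
    have "t powi n = t * t ^ (nat n - 1)"
      using that by (metis One_nat_def Suc_pred power_Suc power_int_def order_less_imp_le zero_less_nat_eq)
    then show ?thesis using that t by (auto intro!: P_mult V_intros simp: PV)
  qed
  have eq0: "n = 0" if "t powi n * u = w" "u \<in> V - P" "w \<in> V - P" for n :: int and u w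
  proof (rule ccontr)
    assume "n \<noteq> 0"
    have w: "w = t powi n * u" using that by simp
    then have "inverse w = t powi (- n) * inverse u" by (simp add: power_int_minus)
    then show False using posP[of n u] posP[of "- n" "inverse u"] that unit_inverse[OF that(2)]
        unit_inverse[OF that(3)] \<open>n \<noteq> 0\<close> by (cases "n > 0") auto
  qed
  have PIdl: "PIdl\<^bsub>ring_on V\<^esub> s = {a * s | a. a \<in> V}" for s
    by (simp add: cgenideal_def)
  have genP: "P = PIdl\<^bsub>ring_on V\<^esub> t"
  proof
    show "PIdl\<^bsub>ring_on V\<^esub> t \<subseteq> P" using t by (auto simp: PIdl intro: P_mult)
    show "P \<subseteq> PIdl\<^bsub>ring_on V\<^esub> t"
    proof
      fix z assume z: "z \<in> P"
      show "z \<in> PIdl\<^bsub>ring_on V\<^esub> t"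
      proof (cases "z = 0")
        case True
        then show ?thesis using V_intros(2) by (auto simp: PIdl)
      next
        case False
        obtain n u where nu: "u \<in> V - P" "z = t powi n * u" using rep[of z] z False PV VF by blast
        have "n > 0"
        proof (rule ccontr)
          assume "\<not> n > 0"
          have "inverse z = t powi (- n) * inverse u" using nu by (simp add: power_int_minus)
          then have "inverse z \<in> V" using posP[of "- n" "inverse u"] \<open>\<not> n > 0\<close> unit_inverse[OF nu(1)] PV
            by (cases "n = 0") auto
          then show False using z False by (simp add: nonunits_def)
        qed
        then have "t powi n = t ^ (nat n - 1) * t"
          by (metis One_nat_def Suc_pred power_Suc2 power_int_def order_less_imp_le zero_less_nat_eq)
        then have "z = (t ^ (nat n - 1) * u) * t" using nu by simp
        moreover have "t ^ (nat n - 1) * u \<in> V" using nu PV[OF t] by (auto intro!: V_intros)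
        ultimately show ?thesis unfolding PIdl by blast
      qed
    qed
  qed
  have val: "val (t powi n * u) = n" if u: "u \<in> V - P" for n u
    unfolding place_val_def place_ring_eq
  proof (rule the_equality)
    show "\<exists>t'\<in>V. \<exists>u'\<in>V - P. P = PIdl\<^bsub>ring_on V\<^esub> t' \<and> t powi n * u = t' powi n * u'"
      using genP u PV[OF t] by blast
    fix m assume "\<exists>t'\<in>V. \<exists>u'\<in>V - P. P = PIdl\<^bsub>ring_on V\<^esub> t' \<and> t powi n * u = t' powi m * u'"
    then obtain t' u' where t': "t' \<in> V" "u' \<in> V - P" "P = PIdl\<^bsub>ring_on V\<^esub> t'" "t powi n * u = t' powi m * u'"
      by auto
    obtain a where a: "a \<in> V" "t = a * t'" using t t'(3) PIdl by auto
    have "t' \<in> P" unfolding t'(3) PIdl using V_intros(1) by force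
    then obtain b where b: "b \<in> V" "t' = b * t" using genP PIdl by auto
    have "b * a = 1" using a b \<open>t \<noteq> 0\<close> by (metis mult.assoc mult_cancel_right1)
    then have bu: "b \<in> V - P" unfolding unit_iff using a b by (metis inverse_unique mult_zero_left zero_neq_one)
    have "t powi (n - m) * u = b powi m * u'"
      using t'(4) b \<open>t \<noteq> 0\<close> by (simp add: power_int_diff power_int_mult_distrib field_simps)
    then have "n - m = 0" by (rule eq0[OF _ u unit_mult[OF unit_powi[OF bu] t'(2)]])
    then show "m = n" by simp
  qed
  have "\<exists>u\<in>V - P. z = t powi (val z) * u" if "z \<in> F" "z \<noteq> 0" for z
    using rep[OF that] val by metis
  then show ?thesis using t \<open>t \<noteq> 0\<close> val by blast
qed

definition "unif = (SOME t. t \<in> P \<and> t \<noteq> 0 \<and> (\<forall>z\<in>F. z \<noteq> 0 \<longrightarrow> (\<exists>u\<in>V - P. z = t powi (val z) * u)) \<and>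
     (\<forall>n. \<forall>u\<in>V - P. val (t powi n * u) = n))"

lemma unif: "unif \<in> P" "unif \<noteq> 0" "z \<in> F \<Longrightarrow> z \<noteq> 0 \<Longrightarrow> \<exists>u\<in>V - P. z = unif powi (val z) * u"
  "u \<in> V - P \<Longrightarrow> val (unif powi n * u) = n"
proof -
  have "\<exists>t. t \<in> P \<and> t \<noteq> 0 \<and> (\<forall>z\<in>F. z \<noteq> 0 \<longrightarrow> (\<exists>u\<in>V - P. z = t powi (val z) * u)) \<and>
     (\<forall>n. \<forall>u\<in>V - P. val (t powi n * u) = n)" using val_exists by auto
  from someI_ex[OF this, folded unif_def]
  show "unif \<in> P" "unif \<noteq> 0" "z \<in> F \<Longrightarrow> z \<noteq> 0 \<Longrightarrow> \<exists>u\<in>V - P. z = unif powi (val z) * u"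
    "u \<in> V - P \<Longrightarrow> val (unif powi n * u) = n" by blast+
qed

lemma val_unif: "val unif = 1"
  using unif(4)[OF unit_1, of 1] by simp

lemma val_mult:
  assumes "z \<in> F" "z \<noteq> 0" "w \<in> F" "w \<noteq> 0" shows "val (z * w) = val z + val w"
proof -
  obtain u u' where u: "u \<in> V - P" "z = unif powi (val z) * u" "u' \<in> V - P" "w = unif powi (val w) * u'"
    using unif(3)[OF assms(1,2)] unif(3)[OF assms(3,4)] by auto
  have "z * w = (unif powi (val z) * u) * (unif powi (val w) * u')" using u by metis
  also have "\<dots> = unif powi (val z + val w) * (u * u')"
    by (simp add: power_int_add unif(2) ac_simps)
  finally show ?thesis using unif(4)[OF unit_mult[OF u(1,3)]] by simp
qed

lemma val_unit: "u \<in> V - P \<Longrightarrow> val u = 0"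
  using unif(4)[of u 0] by simp

lemma val_1: "val 1 = 0"
  by (rule val_unit[OF unit_1])

lemma val_inverse:
  assumes "z \<in> F" "z \<noteq> 0" shows "val (inverse z) = - val z"
  using val_mult[OF assms, of "inverse z"] assms val_1 F_intros by simp

lemma val_divide:
  assumes "z \<in> F" "z \<noteq> 0" "w \<in> F" "w \<noteq> 0" shows "val (z / w) = val z - val w"
  using val_mult[OF assms(1,2), of "inverse w"] assms val_inverse F_intros by (simp add: divide_inverse)

lemma val_power:
  assumes "z \<in> F" "z \<noteq> 0" shows "val (z ^ n) = int n * val z"
  by (induction n) (use assms val_1 in \<open>auto simp: val_mult F_intros algebra_simps\<close>)

lemma val_uminus: assumes "z \<in> F" "z \<noteq> 0" shows "val (- z) = val z"
proof -
  have "- 1 \<in> V - P" using unit_iff V_intros(1,5) by (metis inverse_1 inverse_minus_eq neg_equal_0_iff_equal zero_neq_one)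
  then show ?thesis using val_mult[OF assms, of "- 1"] val_unit VF by auto
qed

lemma val_pos_iff: assumes "z \<in> F" "z \<noteq> 0" shows "val z > 0 \<longleftrightarrow> z \<in> P"
  and val_zero_iff: "val z = 0 \<longleftrightarrow> z \<in> V - P"
  and val_nonneg_iff: "val z \<ge> 0 \<longleftrightarrow> z \<in> V"
proof -
  have *: "z \<in> P" if z: "val z > 0" "z \<in> F" "z \<noteq> 0" for z
  proof -
    obtain u where u: "u \<in> V - P" "z = unif powi (val z) * u" using unif(3)[OF z(2,3)] by blast
    have "unif powi (val z) = unif * unif ^ (nat (val z) - 1)"
      using z by (metis One_nat_def Suc_pred power_Suc power_int_def order_less_imp_le zero_less_nat_eq)
    then have "z = unif * (unif ^ (nat (val z) - 1) * u)" using u(2) by (metis mult.assoc)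
    moreover have "unif ^ (nat (val z) - 1) * u \<in> V" using u PV[OF unif(1)] by (auto intro!: V_intros)
    ultimately show ?thesis using unif(1) P_mult(2) by metis
  qed
  have z0: "z \<in> V - P" if "val z = 0"
    using unif(3)[OF assms] that by auto
  have neg: "z \<notin> V" if "val z < 0"
  proof
    assume "z \<in> V"
    moreover have "inverse z \<in> P" using *[of "inverse z"] that assms val_inverse[OF assms] F_intros by auto
    ultimately have "z * inverse z \<in> P" by (rule P_mult)
    then show False using assms P_1 by simp
  qed
  consider "val z > 0" | "val z = 0" | "val z < 0" by linarith
  then have "(val z > 0 \<longleftrightarrow> z \<in> P) \<and> (val z = 0 \<longleftrightarrow> z \<in> V - P) \<and> (val z \<ge> 0 \<longleftrightarrow> z \<in> V)"
  proof cases
    case 1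
    then have "z \<in> P" using * assms by blast
    then show ?thesis using 1 PV[of z] by simp
  next
    case 2
    then show ?thesis using z0 by simp
  next
    case 3
    then have "z \<notin> V" "z \<notin> P" using neg PV[of z] by blast+
    then show ?thesis using 3 by simp
  qed
  then show "val z > 0 \<longleftrightarrow> z \<in> P" "val z = 0 \<longleftrightarrow> z \<in> V - P" "val z \<ge> 0 \<longleftrightarrow> z \<in> V" by blast+
qed

text \<open>Factoring out \<open>z\<close> leaves \<open>1 + w / z\<close>, a unit because
  \<open>w / z\<close> lies in \<open>P\<close>.\<close>

lemma val_less_add:
  assumes "z \<in> F" "z \<noteq> 0" "w \<in> F" "w \<noteq> 0" "val z < val w"
  shows "z + w \<noteq> 0" "val (z + w) = val z"
proof -
  have "w / z \<in> P" using val_divide[of w z] assms val_pos_iff[of "w / z"] F_intros by auto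
  then have u: "1 + w / z \<in> V - P" by (rule unit_add_P[OF unit_1])
  have eq: "z + w = z * (1 + w / z)" using assms by (simp add: field_simps)
  have "1 + w / z \<noteq> 0" using u P_0 by auto
  then show "z + w \<noteq> 0" "val (z + w) = val z"
    unfolding eq using assms val_mult[of z "1 + w / z"] val_unit[OF u] u VF by auto
qed

end

section \<open>Quadratic extensions of a rational function field\<close>

definition qset :: "'a::field set \<Rightarrow> 'a \<Rightarrow> 'a \<Rightarrow> 'a set" where
  "qset K x y = {(poly a x + poly b x * y) / poly c x |a b c.
     a \<in> pols K \<and> b \<in> pols K \<and> c \<in> pols K \<and> c \<noteq> 0}"

text \<open>A quadratic extension of \<open>K(x)\<close>. Independence of 1 and \<open>y\<close>
  over \<open>K[x]\<close> includes, for \<open>b = 0\<close>, that \<open>x\<close> is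
  transcendental. The affine chart of the curve and the chart at infinity are both
  instances.\<close>

locale quad =
  fixes K :: "'a::field set" and x y :: 'a and h f :: "'a poly"
  assumes K: "sub_field K" and h: "h \<in> pols K" and f: "f \<in> pols K"
    and rel: "y\<^sup>2 + poly h x * y = poly f x"
    and indep: "a \<in> pols K \<Longrightarrow> b \<in> pols K \<Longrightarrow> poly a x + poly b x * y = 0 \<Longrightarrow> a = 0 \<and> b = 0"
begin

abbreviation "E \<equiv> qset K x y"

definition elt where "elt a b = poly a x + poly b x * y"

lemma K_ring: "sub_ring K" by (rule sub_field_ring[OF K])

lemmas K_pols = pols_intros[OF K_ring]

lemma poly_x_eq_0: "p \<in> pols K \<Longrightarrow> poly p x = 0 \<longleftrightarrow> p = 0"
  using indep[of p 0] K_pols(1) by auto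

lemma elt_eq_0: "a \<in> pols K \<Longrightarrow> b \<in> pols K \<Longrightarrow> elt a b = 0 \<longleftrightarrow> a = 0 \<and> b = 0"
  using indep[of a b] by (auto simp: elt_def)

lemma y_sq: "y * y = poly f x - poly h x * y"
  using rel by (simp add: power2_eq_square algebra_simps)

lemma elt_mult: "elt a b * elt a' b' = elt (a * a' + b * b' * f) (a * b' + a' * b - b * b' * h)"
proof -
  have "elt a b * elt a' b' = poly a x * poly a' x + (poly a x * poly b' x + poly a' x * poly b x) * y
      + poly b x * poly b' x * (y * y)"
    by (simp add: elt_def algebra_simps)
  then show ?thesis unfolding y_sq by (simp add: elt_def algebra_simps)
qed

lemma elt_diff: "elt a b - elt a' b' = elt (a - a') (b - b')"
  and elt_scale: "poly c x * elt a b = elt (c * a) (c * b)"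
  by (simp_all add: elt_def algebra_simps)

text \<open>The norm of \<open>a + b * y\<close> over \<open>K(x)\<close>.\<close>

definition nrm where "nrm a b = a * a - a * b * h - b * b * f"

lemma elt_conj: "elt a b * elt (a - b * h) (- b) = poly (nrm a b) x"
  unfolding elt_mult by (simp add: elt_def nrm_def algebra_simps)

lemma nrm_pols: "a \<in> pols K \<Longrightarrow> b \<in> pols K \<Longrightarrow> nrm a b \<in> pols K"
  unfolding nrm_def by (intro K_pols h f)

lemma nrm_eq_0: "a \<in> pols K \<Longrightarrow> b \<in> pols K \<Longrightarrow> nrm a b = 0 \<longleftrightarrow> a = 0 \<and> b = 0"
proof -
  assume ab: "a \<in> pols K" "b \<in> pols K"
  then have "a - b * h \<in> pols K" "- b \<in> pols K" by (intro K_pols h; simp)+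
  then show ?thesis using elt_conj[of a b] elt_eq_0[OF ab] elt_eq_0[of "a - b * h" "- b"]
      poly_x_eq_0[OF nrm_pols[OF ab]] by auto
qed

lemma E_iff: "z \<in> E \<longleftrightarrow> (\<exists>a\<in>pols K. \<exists>b\<in>pols K. \<exists>c\<in>pols K. c \<noteq> 0 \<and> z = elt a b / poly c x)"
  by (auto simp: qset_def elt_def)

lemma E_I: "a \<in> pols K \<Longrightarrow> b \<in> pols K \<Longrightarrow> c \<in> pols K \<Longrightarrow> c \<noteq> 0 \<Longrightarrow> elt a b / poly c x \<in> E"
  unfolding E_iff by blast

lemma elt_E: "a \<in> pols K \<Longrightarrow> b \<in> pols K \<Longrightarrow> elt a b \<in> E"
  using E_I[of a b 1] K_pols by auto

lemma K_E: "K \<subseteq> E" using elt_E[of "[:_:]" 0] K_pols by (auto simp: elt_def)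

lemma X_pols: "[:0, 1:] \<in> pols K"
  by (intro K_pols(1,4) sub_ring_zero[OF K_ring] sub_ring_one[OF K_ring])

lemma x_E: "x \<in> E" using elt_E[OF X_pols K_pols(1)] by (simp add: elt_def)

lemma y_E: "y \<in> E" using elt_E[of 0 1] K_pols by (auto simp: elt_def)

lemma E_field: "sub_field E"
proof -
  have 1: "1 \<in> E" using K_E sub_ring_one[OF K_ring] by auto
  have dm: "z - w \<in> E \<and> z * w \<in> E" if zw: "z \<in> E" "w \<in> E" for z w
  proof -
    obtain a b c where z: "a \<in> pols K" "b \<in> pols K" "c \<in> pols K" "c \<noteq> 0" "z = elt a b / poly c x"
      using zw(1) unfolding E_iff by blast
    obtain a' b' c' where w: "a' \<in> pols K" "b' \<in> pols K" "c' \<in> pols K" "c' \<noteq> 0" "w = elt a' b' / poly c' x"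
      using zw(2) unfolding E_iff by blast
    have "poly c x \<noteq> 0" "poly c' x \<noteq> 0" using z w poly_x_eq_0 by auto
    then have "z - w = (poly c' x * elt a b - poly c x * elt a' b') / poly (c * c') x"
      "z * w = elt a b * elt a' b' / poly (c * c') x"
      unfolding z(5) w(5) by (simp_all add: field_simps)
    then have e: "z - w = elt (c' * a - c * a') (c' * b - c * b') / poly (c * c') x"
      "z * w = elt (a * a' + b * b' * f) (a * b' + a' * b - b * b' * h) / poly (c * c') x"
      by (simp_all only: elt_scale elt_diff elt_mult)
    have "c * c' \<noteq> 0" using z w by auto
    then show ?thesis unfolding e by (intro conjI E_I K_pols h f z(1-3) w(1-3))
  qed
  have inv: "inverse z \<in> E" if "z \<in> E" for z
  proof -
    obtain a b c where z: "a \<in> pols K" "b \<in> pols K" "c \<in> pols K" "c \<noteq> 0" "z = elt a b / poly c x"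
      using \<open>z \<in> E\<close> unfolding E_iff by blast
    show ?thesis
    proof (cases "elt a b = 0")
      case True
      then show ?thesis using z 1 dm[OF 1 1] by simp
    next
      case False
      then have n: "nrm a b \<noteq> 0" using z elt_eq_0 nrm_eq_0 by simp
      then have "poly (nrm a b) x \<noteq> 0" using poly_x_eq_0[OF nrm_pols] z by simp
      \<comment> \<open>The inverse is the conjugate divided by the norm.\<close>
      then have "inverse (elt a b) = elt (a - b * h) (- b) / poly (nrm a b) x"
        using elt_conj[of a b] False by (metis inverse_unique mult_eq_0_iff nonzero_mult_div_cancel_left divide_inverse mult.assoc right_inverse)
      then have "inverse z = elt (c * (a - b * h)) (c * (- b)) / poly (nrm a b) x"
        unfolding elt_scale[symmetric] using z by (simp add: divide_inverse)
      then show ?thesis by (simp only:) (intro E_I K_pols h nrm_pols z(1-3) n)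
    qed
  qed
  show ?thesis using 1 dm inv by (auto simp: sub_field_def sub_ring_def)
qed

lemma poly_closed:
  assumes "sub_ring S" "K \<subseteq> S" "x \<in> S" "a \<in> pols K" shows "poly a x \<in> S"
  using poly_pols assms by blast

lemma elt_closed:
  assumes "sub_ring S" "K \<subseteq> S" "x \<in> S" "y \<in> S" "a \<in> pols K" "b \<in> pols K" shows "elt a b \<in> S"
  unfolding elt_def using assms poly_closed by (auto intro!: sub_ring_intros)

lemma E_least:
  assumes "sub_field S" "K \<subseteq> S" "x \<in> S" "y \<in> S" shows "E \<subseteq> S"
  using elt_closed[OF sub_field_ring[OF assms(1)] assms(2-4)] poly_closed[OF sub_field_ring[OF assms(1)] assms(2,3)]
  by (auto simp: E_iff intro!: sub_field_divide[OF assms(1)])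

end

locale quad_place = quad +
  fixes V assumes vring: "vring K (qset K x y) V" and x_V: "x \<in> V"
begin

sublocale vring_ctx K "qset K x y" V
  by unfold_locales (use E_field vring in auto)

lemma poly_V: "a \<in> pols K \<Longrightarrow> poly a x \<in> V"
  using poly_closed[OF V_ring KV x_V] .

text \<open>Integrality over \<open>K[x]\<close>: if \<open>y\<close> were outside \<open>V\<close>,
  then \<open>inverse y\<close> would be inside, and dividing the quadratic relation by
  \<open>y\<close> would express \<open>y\<close> by elements of \<open>V\<close>.\<close>

lemma y_V: "y \<in> V"
proof (rule ccontr)
  assume "y \<notin> V"
  then have "inverse y \<in> V" "y \<noteq> 0" using V_total[OF y_E] V_intros(2) by auto
  then have "poly f x * inverse y - poly h x \<in> V" by (intro V_intros poly_V h f)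
  also have "poly f x * inverse y - poly h x = y"
    using \<open>y \<noteq> 0\<close> by (simp add: field_simps flip: rel) (simp add: power2_eq_square algebra_simps)
  finally show False using \<open>y \<notin> V\<close> by simp
qed

lemma elt_V: "a \<in> pols K \<Longrightarrow> b \<in> pols K \<Longrightarrow> elt a b \<in> V"
  using elt_closed[OF V_ring KV x_V y_V] .

text \<open>Up to a constant factor, the irreducible polynomial generating the prime ideal that
  \<open>P\<close> cuts out in \<open>K[X]\<close>.\<close>

definition minpol where
  "minpol p \<longleftrightarrow> p \<in> pols K \<and> p \<noteq> 0 \<and> poly p x \<in> P \<and>
     (\<forall>q\<in>pols K. q \<noteq> 0 \<longrightarrow> poly q x \<in> P \<longrightarrow> degree p \<le> degree q)"

text \<open>If no nonzero polynomial in \<open>x\<close> lay in \<open>P\<close>, all denominators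
  would be units and \<open>V\<close> would be the whole field.\<close>

lemma minpol_exists: "\<exists>p. minpol p"
proof -
  have "\<exists>p. p \<in> pols K \<and> p \<noteq> 0 \<and> poly p x \<in> P"
  proof (rule ccontr)
    assume no: "\<not> ?thesis"
    have "elt a b / poly c x \<in> V" if "a \<in> pols K" "b \<in> pols K" "c \<in> pols K" "c \<noteq> 0" for a b c
    proof -
      have "poly c x \<in> V - P" using no that poly_V by auto
      then have "inverse (poly c x) \<in> V" using unit_inverse by blast
      then show ?thesis unfolding divide_inverse using that elt_V V_intros(4) by blast
    qed
    then have "E \<subseteq> V" unfolding E_iff by (auto simp: E_iff)
    then show False using VF by auto
  qed
  then obtain p0 where "p0 \<in> pols K \<and> p0 \<noteq> 0 \<and> poly p0 x \<in> P" by blast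
  from ex_has_least_nat[of "\<lambda>p. p \<in> pols K \<and> p \<noteq> 0 \<and> poly p x \<in> P", OF this, of degree]
  show ?thesis unfolding minpol_def by blast
qed

text \<open>The remainder modulo \<open>p\<close> again takes a value in \<open>P\<close> but has
  smaller degree, so it is 0. Splitting off \<open>p\<close> repeatedly comes to an end because
  \<open>p\<close>, not being a unit constant, has positive degree.\<close>

lemma minpol_factor:
  assumes p: "minpol p"
  shows "a \<in> pols K \<Longrightarrow> a \<noteq> 0 \<Longrightarrow> \<exists>n. \<exists>b\<in>pols K. a = p ^ n * b \<and> poly b x \<in> V - P"
proof (induction "degree a" arbitrary: a rule: less_induct)
  case less
  note pp = p[unfolded minpol_def]
  show ?case
  proof (cases "poly a x \<in> P")
    case False
    then show ?thesis using less.prems poly_V by (intro exI[of _ 0] bexI[of _ a]) auto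
  next
    case True
    obtain q r where qr: "q \<in> pols K" "r \<in> pols K" "a = p * q + r" "r = 0 \<or> degree r < degree p"
      using pols_division[OF K, of p a] pp less.prems by blast
    have "poly a x - poly q x * poly p x \<in> P" using True pp qr poly_V by (intro P_diff P_mult(1)) auto
    then have "poly r x \<in> P" using qr by (simp add: algebra_simps)
    then have "r = 0" using qr pp by (metis not_le)
    then have a: "a = p * q" using qr by simp
    have "q \<noteq> 0" using a less.prems by auto
    have "degree p > 0"
    proof (rule ccontr)
      assume "\<not> degree p > 0"
      then obtain c where c: "p = [:c:]" by (metis degree_eq_zeroE not_gr_zero)
      then have "c \<in> K" "c \<noteq> 0" using pp coeff_pols[of p K 0] by auto
      then have "inverse c \<in> V" using KV sub_field_inverse[OF K] by auto
      then have "inverse c * c \<in> P" using pp c by (intro P_mult(1)) auto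
      then show False using \<open>c \<noteq> 0\<close> P_1 by simp
    qed
    then have "degree q < degree a" unfolding a using pp \<open>q \<noteq> 0\<close> by (simp add: degree_mult_eq)
    then obtain n b where "b \<in> pols K" "q = p ^ n * b" "poly b x \<in> V - P"
      using less.hyps[OF _ qr(1) \<open>q \<noteq> 0\<close>] by blast
    then show ?thesis using a by (intro exI[of _ "Suc n"] bexI[of _ b]) auto
  qed
qed

text \<open>The function field has degree 2 over \<open>K(x)\<close>, so the value group of \<open>V\<close> contains the
  infinite cyclic value group of \<open>K(x)\<close> with index at most 2.\<close>

lemma discrete_strong:
  assumes p: "minpol p"
  shows "\<exists>t\<in>P. (\<exists>m\<in>{1, 2::nat}. \<exists>u\<in>V - P. poly p x = t ^ m * u) \<and>
    (\<forall>z\<in>E. z \<noteq> 0 \<longrightarrow> (\<exists>n. \<exists>u\<in>V - P. z = t powi n * u))"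
proof -
  define q where "q = poly p x"
  note pp = p[unfolded minpol_def]
  have q: "q \<in> P" "q \<noteq> 0" using pp poly_x_eq_0 by (auto simp: q_def)
  \<comment> \<open>\<open>sp z\<close> says that the value of \<open>z\<close> lies in the cyclic
    subgroup generated by the value of \<open>q\<close>, which is the value group of
    \<open>K(x)\<close>.\<close>
  define sp where "sp z \<longleftrightarrow> (\<exists>n::int. \<exists>u\<in>V - P. z = q powi n * u)" for z
  have sp_mult: "sp (z * w)" if "sp z" "sp w" for z w
  proof -
    obtain n u m u' where 1: "u \<in> V - P" "z = q powi n * u" and 2: "u' \<in> V - P" "w = q powi m * u'"
      using \<open>sp z\<close> \<open>sp w\<close> unfolding sp_def by blast
    have "z * w = q powi (n + m) * (u * u')" using q by (simp add: 1 2 power_int_add ac_simps)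
    then show ?thesis unfolding sp_def using unit_mult[OF 1(1) 2(1)] by blast
  qed
  have sp_inv: "sp (inverse z)" if "sp z" for z
  proof -
    obtain n u where 1: "u \<in> V - P" "z = q powi n * u" using \<open>sp z\<close> unfolding sp_def by blast
    have "inverse z = q powi (- n) * inverse u" by (simp add: 1 power_int_minus)
    then show ?thesis unfolding sp_def using unit_inverse[OF 1(1)] by blast
  qed
  have sp_div: "sp (z / w)" if "sp z" "sp w" for z w
    unfolding divide_inverse using sp_mult sp_inv that by blast
  have sp_unit: "sp u" if "u \<in> V - P" for u
    unfolding sp_def using that by (intro exI[of _ 0] bexI[of _ u]) auto
  have sp_poly: "sp (poly a x)" if a: "a \<in> pols K" "a \<noteq> 0" for a
  proof -
    obtain n b where nb: "a = p ^ n * b" "poly b x \<in> V - P" using minpol_factor[OF p a] by blast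
    have "poly a x = q powi int n * poly b x" using nb by (simp add: q_def)
    then show ?thesis using nb(2) unfolding sp_def by blast
  qed
  \<comment> \<open>This is the bound 2 on the index of the value groups: if neither of two elements
    has its value in the subgroup, then their quotient has.\<close>
  have two: "sp z \<or> sp w \<or> sp (w / z)" if zw: "z \<in> E" "z \<noteq> 0" "w \<in> E" "w \<noteq> 0" for z w
  proof -
    obtain a b c where z: "a \<in> pols K" "b \<in> pols K" "c \<in> pols K" "c \<noteq> 0" "z = elt a b / poly c x"
      using zw(1) unfolding E_iff by blast
    obtain a' b' c' where w: "a' \<in> pols K" "b' \<in> pols K" "c' \<in> pols K" "c' \<noteq> 0" "w = elt a' b' / poly c' x"
      using zw(3) unfolding E_iff by blast
    consider "b = 0" | "b' = 0" | "b \<noteq> 0" "b' \<noteq> 0" by auto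
    then show ?thesis
    proof cases
      case 1
      then have "z = poly a x / poly c x" "a \<noteq> 0" using z zw by (auto simp: elt_def)
      then show ?thesis using sp_div sp_poly z by blast
    next
      case 2
      then have "w = poly a' x / poly c' x" "a' \<noteq> 0" using w zw by (auto simp: elt_def)
      then show ?thesis using sp_div sp_poly w by blast
    next
      case 3
      \<comment> \<open>Multipliers chosen so that the \<open>y\<close>-parts of \<open>z\<close>
        and \<open>w\<close> cancel, which leaves a linear relation over
        \<open>K[x]\<close>.\<close>
      define \<alpha> \<beta> \<gamma> where "\<alpha> = b' * c" and "\<beta> = - (b * c')" and "\<gamma> = a * b' - a' * b"
      have pol: "\<alpha> \<in> pols K" "\<alpha> \<noteq> 0" "\<beta> \<in> pols K" "\<beta> \<noteq> 0" "\<gamma> \<in> pols K"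
        using 3 z w by (auto simp: \<alpha>_def \<beta>_def \<gamma>_def intro!: K_pols)
      have cz: "poly c x * z = elt a b" "poly c' x * w = elt a' b'"
        using z w poly_x_eq_0 by auto
      have "poly \<alpha> x * z + poly \<beta> x * w = poly b' x * (poly c x * z) - poly b x * (poly c' x * w)"
        by (simp add: \<alpha>_def \<beta>_def algebra_simps)
      also have "\<dots> = poly \<gamma> x" unfolding cz by (simp add: \<gamma>_def elt_def algebra_simps)
      finally have lin: "poly \<alpha> x * z + poly \<beta> x * w = poly \<gamma> x" .
      have nz: "poly \<alpha> x \<noteq> 0" "poly \<beta> x \<noteq> 0" using pol poly_x_eq_0 by auto
      show ?thesis
      proof (cases "\<gamma> = 0")
        case True
        then have "poly \<beta> x * w = - (poly \<alpha> x * z)" using lin by (simp add: add_eq_0_iff)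
        then have "w / z = (poly (- \<alpha>) x) / poly \<beta> x" using nz zw by (simp add: field_simps)
        moreover have "- \<alpha> \<in> pols K" "- \<alpha> \<noteq> 0" using K_pols(7)[OF pol(1)] pol(2) by auto
        ultimately have "sp (w / z)" using sp_div sp_poly pol(3,4) by metis
        then show ?thesis by simp
      next
        case False
        then have g: "poly \<gamma> x \<noteq> 0" "sp (poly \<gamma> x)" using pol poly_x_eq_0 sp_poly by auto
        \<comment> \<open>In \<open>A + B = 1\<close> either one summand is a unit, or both lie
          outside \<open>V\<close> and \<open>B / A\<close> is a unit. So two of the three terms of
          the linear relation have the same value.\<close>
        define A B where "A = poly \<alpha> x * z / poly \<gamma> x" and "B = poly \<beta> x * w / poly \<gamma> x"
        have AB: "A + B = 1" "A \<noteq> 0" using lin g nz zw by (auto simp: A_def B_def simp flip: add_divide_distrib)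
        have zA: "z = A * poly \<gamma> x / poly \<alpha> x" and wB: "w = B * poly \<gamma> x / poly \<beta> x"
          using g nz by (auto simp: A_def B_def)
        have spA: "sp z" if "sp A" using that g(2) sp_poly[OF pol(1,2)] unfolding zA by (intro sp_div sp_mult)
        have spB: "sp w" if "sp B" using that g(2) sp_poly[OF pol(3,4)] unfolding wB by (intro sp_div sp_mult)
        have AE: "A \<in> E" unfolding A_def using poly_V zw(1) pol VF by (intro F_intros) auto
        consider "A \<in> V - P" | "A \<in> P" | "A \<notin> V" by blast
        then show ?thesis
        proof cases
          case 1
          then show ?thesis using spA sp_unit by blast
        next
          case 2
          have "1 + - A \<in> V - P" using unit_add_P[OF unit_1] P_uminus[OF 2] by blast
          moreover have "1 + - A = B" using AB by (simp add: algebra_simps)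
          ultimately show ?thesis using spB sp_unit by metis
        next
          case 3
          then have "- 1 + inverse A \<in> V - P"
            using unit_add_P[of "- 1"] inverse_in_P[OF AE] unit_1 V_intros(5)[OF V_intros(1)] P_uminus[of "-1"]
            by auto
          moreover have "- 1 + inverse A = B / A" using AB by (simp add: field_simps)
          moreover have "w / z = (B / A) * (poly \<alpha> x / poly \<beta> x)"
            using g nz AB by (simp add: zA wB field_simps)
          ultimately show ?thesis using sp_mult sp_div sp_poly pol sp_unit by metis
        qed
      qed
    qed
  qed
  show ?thesis
  proof (cases "\<forall>z\<in>E. z \<noteq> 0 \<longrightarrow> sp z")
    case True
    then show ?thesis using q unit_1 unfolding sp_def
      by (intro bexI[of _ q] conjI bexI[of _ "1::nat"] bexI[of _ 1]) (auto simp: q_def)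
  next
    case False
    then obtain z0 where z0: "z0 \<in> E" "z0 \<noteq> 0" "\<not> sp z0" by auto
    \<comment> \<open>For \<open>z0\<close> and its square, the first and third alternatives of
      \<open>two\<close> both say \<open>sp z0\<close>.\<close>
    have "sp (z0 * z0)" using two[of z0 "z0 * z0"] z0 F_intros by auto
    then obtain n u where nu: "u \<in> V - P" "z0 * z0 = q powi n * u" unfolding sp_def by blast
    \<comment> \<open>For even \<open>n\<close> the quotient of \<open>z0\<close> by a suitable
      power of \<open>q\<close> would be a square root of a unit, hence a unit, which would give
      \<open>sp z0\<close>.\<close>
    have "odd n"
    proof
      assume "even n"
      then obtain m where m: "n = m + m" by (metis evenE mult_2)
      define s where "s = z0 / q powi m"
      have "q powi n = q powi m * q powi m" using q unfolding m by (intro power_int_add) simp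
      then have s: "s * s = u" using nu(2) q by (simp add: s_def)
      have sE: "s \<in> E" unfolding s_def using z0 PV[OF q(1)] VF by (intro F_intros) auto
      have "s \<in> V"
      proof (rule ccontr)
        assume "s \<notin> V"
        then have "inverse s \<in> P" by (rule inverse_in_P[OF sE])
        then have "inverse s * inverse s * u \<in> P" using nu PV by (intro P_mult) auto
        moreover have "s \<noteq> 0" using \<open>s \<notin> V\<close> V_intros(2) by auto
        ultimately show False using s P_1 by (auto simp: field_simps)
      qed
      moreover have "s \<notin> P" using s P_mult(1)[of s s] nu(1) \<open>s \<in> V\<close> by auto
      ultimately have "sp s" using sp_unit by blast
      moreover have "z0 = q powi m * s" using q by (simp add: s_def)
      moreover have "sp (q powi m)" unfolding sp_def using unit_1 by force
      ultimately show False using sp_mult z0 by metis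
    qed
    then obtain m where m: "n = m + m + 1" by (metis oddE mult_2)
    \<comment> \<open>As \<open>t * t = q * u\<close>, the value of \<open>t\<close> is half that of
      \<open>q\<close>. This is the ramified case, with \<open>t\<close> as uniformizer and exponent
      2.\<close>
    define t where "t = z0 / q powi m"
    have "q powi n = q powi (m + m) * q powi 1" using q unfolding m by (intro power_int_add) simp
    also have "q powi (m + m) = q powi m * q powi m" using q by (intro power_int_add) simp
    finally have tt: "t * t = q * u" using nu(2) q by (simp add: t_def)
    have tE: "t \<in> E" unfolding t_def using z0 PV[OF q(1)] VF by (intro F_intros) auto
    have ttP: "t * t \<in> P" using tt q nu P_mult(2) by auto
    have "t \<noteq> 0" using z0 q by (simp add: t_def)
    have "t \<in> V"
    proof (rule ccontr)
      assume "t \<notin> V"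
      then have "inverse t \<in> V" using PV inverse_in_P[OF tE] by blast
      then have "inverse t * inverse t * (t * t) \<in> P" using P_mult(1)[OF V_intros(4) ttP] by blast
      moreover have "inverse t * inverse t * (t * t) = 1" using \<open>t \<noteq> 0\<close> by (simp add: field_simps)
      ultimately show False using P_1 by simp
    qed
    then have tP: "t \<in> P" using ttP P_prime by blast
    have qt: "q = t ^ 2 * inverse u" using tt nu P_0 by (auto simp: power2_eq_square field_simps)
    have z0t: "z0 = t * q powi m" using q by (simp add: t_def)
    have spt: "\<exists>n. \<exists>u\<in>V - P. z = t powi n * u" if "sp z" for z
    proof -
      obtain k u' where k: "u' \<in> V - P" "z = q powi k * u'" using \<open>sp z\<close> unfolding sp_def by blast
      have "q powi k = t powi (2 * k) * inverse u powi k"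
        unfolding qt power_int_mult_distrib by (simp add: power_int_mult)
      then have "z = t powi (2 * k) * (inverse u powi k * u')" using k by simp
      then show ?thesis using unit_mult[OF unit_powi[OF unit_inverse[OF nu(1)]] k(1)] by blast
    qed
    have "\<exists>n. \<exists>u\<in>V - P. z = t powi n * u" if z: "z \<in> E" "z \<noteq> 0" for z
    proof -
      consider "sp z" | "sp (z / z0)" using two[OF z0(1,2) z] z0 by blast
      then show ?thesis
      proof cases
        case 1
        then show ?thesis by (rule spt)
      next
        case 2
        then have "sp (q powi m * (z / z0))" using sp_mult unit_1 unfolding sp_def by force
        then obtain k u' where k: "u' \<in> V - P" "q powi m * (z / z0) = t powi k * u'" using spt by blast
        have "z = t * (q powi m * (z / z0))" using z0 q by (simp add: z0t)
        also have "\<dots> = t powi (k + 1) * u'" using k \<open>t \<noteq> 0\<close> by (simp add: power_int_add)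
        finally show ?thesis using k(1) by blast
      qed
    qed
    then show ?thesis using tP qt unit_inverse[OF nu(1)]
      by (intro bexI[of _ t] conjI bexI[of _ "2::nat"] bexI[of _ "inverse u"]) (auto simp: q_def)
  qed
qed

sublocale dvr_ctx K "qset K x y" V
  by unfold_locales (use minpol_exists discrete_strong in blast)

text \<open>\<open>discrete_strong\<close> measures with its own \<open>t\<close>. Since
  \<open>unif\<close> has value 1 and is a power of \<open>t\<close> up to a unit, \<open>t\<close>
  has value 1 as well, and the exponent 1 or 2 is the value.\<close>

lemma val_minpol: assumes "minpol p" shows "val (poly p x) \<in> {1, 2}"
proof -
  obtain t m u where t: "t \<in> P" and m: "m \<in> {1, 2::nat}" and u: "u \<in> V - P" "poly p x = t ^ m * u"
    and rep: "\<And>z. z \<in> E \<Longrightarrow> z \<noteq> 0 \<Longrightarrow> \<exists>n. \<exists>u\<in>V - P. z = t powi n * u"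
    using discrete_strong[OF assms] by blast
  have "poly p x \<noteq> 0" using poly_x_eq_0 assms by (auto simp: minpol_def)
  then have "t \<noteq> 0" using u m by auto
  have tE: "t \<in> E" using PV[OF t] VF by auto
  obtain n u' where n: "u' \<in> V - P" "unif = t powi n * u'" using rep[of unif] unif PV VF by blast
  have vp: "val (t powi k) = k * val t" for k
    using val_power[OF tE \<open>t \<noteq> 0\<close>] val_inverse[of "t ^ _"] tE \<open>t \<noteq> 0\<close> F_intros(7)
    by (cases "k \<ge> 0") (auto simp: power_int_def power_inverse)
  have "t powi n \<in> E" "u' \<in> E" "u' \<noteq> 0" "t powi n \<noteq> 0" "u \<in> E" "u \<noteq> 0"
    using F_intros tE n(1) u(1) VF P_0 \<open>t \<noteq> 0\<close> by auto
  then have "1 = n * val t" using val_mult[of "t powi n" u'] n val_unif val_unit[OF n(1)] vp by simp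
  moreover have "val t > 0" using val_pos_iff[OF tE \<open>t \<noteq> 0\<close>] t by simp
  ultimately have "val t = 1" by (metis mult.commute pos_zmult_eq_1_iff)
  then have "val (poly p x) = int m"
    using u val_mult[of "t ^ m" u] val_power[OF tE \<open>t \<noteq> 0\<close>, of m] val_unit[OF u(1)] \<open>u \<in> E\<close> \<open>u \<noteq> 0\<close> \<open>t \<noteq> 0\<close> tE F_intros(7)
    by simp
  then show ?thesis using m by auto
qed

end

section \<open>Places at nonsingular points\<close>

locale quad_point = quad_place +
  fixes u0 v0
  assumes u0: "u0 \<in> K" and v0: "v0 \<in> K" and x_P: "x - u0 \<in> P" and y_P: "y - v0 \<in> P"
begin

definition ev where "ev a b = poly a u0 + poly b u0 * v0"

lemma poly_u0: "a \<in> pols K \<Longrightarrow> poly a u0 \<in> K"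
  using pols_synthetic_div[OF K_ring u0] by blast

lemma ev_K: "a \<in> pols K \<Longrightarrow> b \<in> pols K \<Longrightarrow> ev a b \<in> K"
  unfolding ev_def by (intro sub_ring_intros[OF K_ring] poly_u0 v0)

lemma poly_synth: "poly p c = poly p u + (c - u) * poly (synthetic_div p u) c" for p :: "'a poly"
  using arg_cong[OF synthetic_div_correct'[of u p], of "\<lambda>q. poly q c"] by (simp add: algebra_simps)

lemma synth_pols: "p \<in> pols K \<Longrightarrow> synthetic_div p u0 \<in> pols K"
  using pols_synthetic_div[OF K_ring u0] by blast

lemma poly_sub_P: "p \<in> pols K \<Longrightarrow> poly p x - poly p u0 \<in> P"
  using P_mult(2)[OF x_P poly_V[OF synth_pols]] poly_synth[of p x u0] by simp

lemma elt_ev: assumes "a \<in> pols K" "b \<in> pols K" shows "elt a b - ev a b \<in> P"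
proof -
  have "(poly a x - poly a u0) + ((poly b x - poly b u0) * y + poly b u0 * (y - v0)) \<in> P"
    using assms poly_u0 KV by (intro P_add P_mult(1) P_mult(2) poly_sub_P y_P y_V) auto
  then show ?thesis by (simp add: elt_def ev_def algebra_simps)
qed

lemma K_P: "c \<in> K \<Longrightarrow> c \<in> P \<longleftrightarrow> c = 0"
  using KV sub_field_inverse[OF K] P_0 by (auto simp: nonunits_def)

lemma elt_P_iff: assumes "a \<in> pols K" "b \<in> pols K" shows "elt a b \<in> P \<longleftrightarrow> ev a b = 0"
proof -
  have "elt a b \<in> P \<longleftrightarrow> ev a b \<in> P"
    using elt_ev[OF assms] P_diff[of "elt a b" "elt a b - ev a b"] P_add[of "elt a b - ev a b" "ev a b"] by auto
  then show ?thesis using K_P ev_K assms by simp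
qed

lemma poly_P_iff: "a \<in> pols K \<Longrightarrow> poly a x \<in> P \<longleftrightarrow> poly a u0 = 0"
  using elt_P_iff[OF _ K_pols(1)] by (simp add: elt_def ev_def)

lemma elt_unit: "a \<in> pols K \<Longrightarrow> b \<in> pols K \<Longrightarrow> ev a b \<noteq> 0 \<Longrightarrow> elt a b \<in> V - P"
  using elt_P_iff elt_V by auto

lemma poly_unit: "a \<in> pols K \<Longrightarrow> poly a u0 \<noteq> 0 \<Longrightarrow> poly a x \<in> V - P"
  using poly_P_iff poly_V by auto

text \<open>Modulo \<open>P\<close> the equation of the function field becomes this relation between
  constants, and 0 is the only constant in \<open>P\<close>.\<close>

lemma curve: "v0\<^sup>2 + poly h u0 * v0 = poly f u0"
proof -
  have "poly f x - poly f u0 - ((poly h x - poly h u0) * y + poly h u0 * (y - v0) + (y - v0) * (y + v0)) \<in> P"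
    using v0 poly_u0[OF h] KV
    by (intro P_diff P_add P_mult(2)[OF poly_sub_P[OF h]] P_mult(1)[of "poly h u0"] P_mult(2)[OF y_P] poly_sub_P f y_P y_V V_intros(6)) auto
  also have "poly f x - poly f u0 - ((poly h x - poly h u0) * y + poly h u0 * (y - v0) + (y - v0) * (y + v0))
    = v0\<^sup>2 + poly h u0 * v0 - poly f u0"
    by (simp flip: rel) (simp add: algebra_simps power2_eq_square)
  finally show ?thesis
    using K_P[of "v0\<^sup>2 + poly h u0 * v0 - poly f u0"] v0 poly_u0 h f
    by (auto intro: sub_ring_intros[OF K_ring])
qed

abbreviation "X0 \<equiv> [:- u0, 1:]"

lemma X0_pols: "X0 \<in> pols K"
  by (intro K_pols(1,4) sub_ring_intros[OF K_ring] u0)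

lemma minpol_X0: "minpol X0"
  unfolding minpol_def
proof (intro conjI ballI impI)
  show "X0 \<in> pols K" by (rule X0_pols)
  show "poly X0 x \<in> P" using x_P by simp
  fix q assume q: "q \<in> pols K" "q \<noteq> 0" "poly q x \<in> P"
  then have "poly q u0 = 0" using poly_P_iff by simp
  have "degree q \<noteq> 0"
  proof
    assume "degree q = 0"
    then obtain c where "q = [:c:]" by (rule degree_eq_zeroE)
    then show False using q(2) \<open>poly q u0 = 0\<close> by simp
  qed
  then show "degree X0 \<le> degree q" by simp
qed simp

text \<open>The ramification index of the place over \<open>K(x)\<close>.\<close>

definition e where "e = val (x - u0)"

lemma e: "e = 1 \<or> e = 2"
  using val_minpol[OF minpol_X0] by (simp add: e_def)

lemma x_u0: "x - u0 \<noteq> 0" "x - u0 \<in> E"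
  using poly_x_eq_0[OF X0_pols] PV[OF x_P] VF by auto

lemma lin_factor:
  assumes "a \<in> pols K" "a \<noteq> 0"
  shows "\<exists>n. \<exists>b\<in>pols K. a = X0 ^ n * b \<and> poly b u0 \<noteq> 0"
proof -
  obtain n b where b: "b \<in> pols K" "a = X0 ^ n * b" "poly b x \<in> V - P"
    using minpol_factor[OF minpol_X0 assms] by blast
  then show ?thesis using poly_P_iff by blast
qed

lemma val_lin: assumes "b \<in> pols K" "poly b u0 \<noteq> 0" shows "val (poly (X0 ^ n * b) x) = int n * e"
proof -
  have b: "poly b x \<in> V - P" by (rule poly_unit[OF assms])
  then have "poly b x \<noteq> 0" "poly b x \<in> E" using VF P_0 by auto
  then show ?thesis
    using val_mult[of "(x - u0) ^ n" "poly b x"] val_unit[OF b] val_power[OF x_u0(2,1), of n] x_u0 F_intros(7)[OF x_u0(2)]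
    by (simp add: e_def)
qed

lemma poly_synth_deriv: "poly (synthetic_div p u) u = poly (pderiv p) u" for p :: "'a poly"
proof -
  have "poly (pderiv ([:-u, 1:] * synthetic_div p u + [:poly p u:])) u = poly (synthetic_div p u) u"
    by (simp add: pderiv_mult pderiv_add pderiv_pCons del: mult_pCons_left)
  then show ?thesis unfolding synthetic_div_correct' by simp
qed

text \<open>Removes the common power of \<open>X - u0\<close>. Afterwards \<open>a1 + b1 * y\<close>
  cannot vanish at both of two distinct points above \<open>u0\<close>, which is what
  \<open>conj_unit\<close> exploits.\<close>

lemma pair_factor:
  "a \<in> pols K \<Longrightarrow> b \<in> pols K \<Longrightarrow> \<not> (a = 0 \<and> b = 0) \<Longrightarrow>
    \<exists>k. \<exists>a1\<in>pols K. \<exists>b1\<in>pols K. a = X0 ^ k * a1 \<and> b = X0 ^ k * b1 \<and> \<not> (poly a1 u0 = 0 \<and> poly b1 u0 = 0)"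
proof (induction "degree a + degree b" arbitrary: a b rule: less_induct)
  case less
  show ?case
  proof (cases "poly a u0 = 0 \<and> poly b u0 = 0")
    case False
    then show ?thesis using less.prems
      by (intro exI[of _ 0] bexI[of _ a] bexI[of _ b]) auto
  next
    case True
    define a' b' where "a' = synthetic_div a u0" and "b' = synthetic_div b u0"
    have ab: "a = X0 * a'" "b = X0 * b'" using True synthetic_div_correct'[of u0 a] synthetic_div_correct'[of u0 b]
      by (simp_all add: a'_def b'_def)
    have pol: "a' \<in> pols K" "b' \<in> pols K" using less.prems synth_pols by (auto simp: a'_def b'_def)
    have nz: "\<not> (a' = 0 \<and> b' = 0)" using ab less.prems by auto
    have da: "degree a' \<le> degree a \<and> (a' \<noteq> 0 \<longrightarrow> degree a' < degree a)"
      unfolding ab by (cases "a' = 0") (simp_all add: degree_mult_eq del: mult_pCons_left)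
    have db: "degree b' \<le> degree b \<and> (b' \<noteq> 0 \<longrightarrow> degree b' < degree b)"
      unfolding ab by (cases "b' = 0") (simp_all add: degree_mult_eq del: mult_pCons_left)
    have "degree a' + degree b' < degree a + degree b" using da db nz by linarith
    then obtain k a1 b1 where k: "a1 \<in> pols K" "b1 \<in> pols K" "a' = X0 ^ k * a1" "b' = X0 ^ k * b1"
      "\<not> (poly a1 u0 = 0 \<and> poly b1 u0 = 0)" using less.hyps[OF _ pol nz] by blast
    have "a = X0 ^ Suc k * a1" "b = X0 ^ Suc k * b1"
      unfolding ab k power_Suc by (simp_all only: mult.assoc)
    then show ?thesis using k(1,2,5) by blast
  qed
qed

lemma conj_pols: "a \<in> pols K \<Longrightarrow> b \<in> pols K \<Longrightarrow> a - b * h \<in> pols K \<and> - b \<in> pols K"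
  by (intro conjI K_pols h)

text \<open>The value of the conjugate at \<open>(u0, v0)\<close> is the value of
  \<open>a + b * y\<close> at the other point above \<open>u0\<close>, with ordinate
  \<open>- poly h u0 - v0\<close>. The two ordinates differ by \<open>poly h u0 + 2 * v0\<close>, so
  vanishing at both would force \<open>b\<close>, and then \<open>a\<close>, to vanish at
  \<open>u0\<close>.\<close>

lemma conj_unit:
  assumes "poly h u0 + 2 * v0 \<noteq> 0" "ev a b = 0" "\<not> (poly a u0 = 0 \<and> poly b u0 = 0)"
  shows "ev (a - b * h) (- b) \<noteq> 0"
proof -
  have "poly b u0 \<noteq> 0" using assms(2,3) by (auto simp: ev_def)
  moreover have "ev (a - b * h) (- b) = ev a b - poly b u0 * (poly h u0 + 2 * v0)"
    by (simp add: ev_def algebra_simps)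
  ultimately show ?thesis using assms by simp
qed

lemma elt_X0_power: "elt (X0 ^ k * a) (X0 ^ k * b) = (x - u0) ^ k * elt a b"
  by (simp add: elt_scale[symmetric] poly_power)

text \<open>For \<open>e = 2\<close> all values of \<open>K(x)\<close> would be even, so the reduced
  numerator of a uniformizer would have odd value. It vanishes at the point while its conjugate does
  not, so its value is that of its norm, which lies in \<open>K[x]\<close> and has even
  value.\<close>

lemma unramified:
  assumes ur: "poly h u0 + 2 * v0 \<noteq> 0" shows "e = 1"
proof (rule ccontr)
  assume "e \<noteq> 1"
  then have e2: "e = 2" using e by auto
  have uE: "unif \<in> E" using unif(1) PV VF by auto
  then obtain a b c where z: "a \<in> pols K" "b \<in> pols K" "c \<in> pols K" "c \<noteq> 0" "unif = elt a b / poly c x"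
    unfolding E_iff by blast
  have "\<not> (a = 0 \<and> b = 0)" using z unif(2) by (auto simp: elt_def)
  then obtain k a1 b1 where k: "a1 \<in> pols K" "b1 \<in> pols K" "a = X0 ^ k * a1" "b = X0 ^ k * b1"
    "\<not> (poly a1 u0 = 0 \<and> poly b1 u0 = 0)" using pair_factor z by blast
  obtain m c1 where c1: "c1 \<in> pols K" "c = X0 ^ m * c1" "poly c1 u0 \<noteq> 0" using lin_factor[OF z(3,4)] by blast
  have g: "elt a1 b1 \<noteq> 0" "elt a1 b1 \<in> E" using elt_eq_0[OF k(1,2)] k(5) elt_E k by auto
  have pc: "poly c x \<noteq> 0" "poly c x \<in> E" using poly_x_eq_0 poly_V z VF by auto
  have u: "unif * poly c x = (x - u0) ^ k * elt a1 b1" using z(5) pc unfolding k elt_X0_power by simp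
  have "1 + int m * 2 = int k * 2 + val (elt a1 b1)"
    using arg_cong[OF u, of val] val_mult[OF uE unif(2) pc(2,1)] val_mult[of "(x - u0) ^ k" "elt a1 b1"] g
      val_unif val_lin[OF c1(1,3), of m] e2 val_power[OF x_u0(2,1), of k] x_u0 F_intros(7)[OF x_u0(2)]
    by (simp add: e_def c1(2))
  then have odd: "odd (val (elt a1 b1))" by presburger
  then have "val (elt a1 b1) > 0" using val_nonneg_iff[OF g(2,1)] elt_V[OF k(1,2)]
    by (metis even_zero order_le_imp_less_or_eq)
  then have "ev a1 b1 = 0" using val_pos_iff[OF g(2,1)] elt_P_iff[OF k(1,2)] by simp
  then have cu: "elt (a1 - b1 * h) (- b1) \<in> V - P"
    using elt_unit conj_unit[OF ur _ k(5)] conj_pols[OF k(1,2)] by blast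
  then have cn: "elt (a1 - b1 * h) (- b1) \<noteq> 0" "elt (a1 - b1 * h) (- b1) \<in> E" using P_0 VF by auto
  have n: "nrm a1 b1 \<in> pols K" "nrm a1 b1 \<noteq> 0" using nrm_pols nrm_eq_0 k by auto
  obtain j n1 where n1: "n1 \<in> pols K" "nrm a1 b1 = X0 ^ j * n1" "poly n1 u0 \<noteq> 0" using lin_factor[OF n] by blast
  have "val (elt a1 b1) = int j * 2"
    using elt_conj[of a1 b1] val_mult[OF g(2,1) cn(2,1)] val_unit[OF cu] val_lin[OF n1(1,3), of j] e2 n1(2) by simp
  then show False using odd by simp
qed

text \<open>Expanding the equation at the point gives
  \<open>(y - v0) * (y - v0) = (x - u0) * s\<close>, where \<open>s\<close> takes the value
  \<open>poly (pderiv f) u0 - v0 * poly (pderiv h) u0\<close>, nonzero by \<open>ns\<close>. So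
  \<open>e\<close> is twice the value of \<open>y - v0\<close>, and it is 1 or 2.\<close>

lemma ramified:
  assumes r0: "poly h u0 + 2 * v0 = 0" and ns: "poly (pderiv f) u0 \<noteq> v0 * poly (pderiv h) u0"
  shows "e = 2" "val (y - v0) = 1"
proof -
  define h1 f1 where "h1 = synthetic_div h u0" and "f1 = synthetic_div f u0"
  have pol: "h1 \<in> pols K" "f1 \<in> pols K" using synth_pols h f by (auto simp: h1_def f1_def)
  have hx: "poly h x = poly h u0 + (x - u0) * poly h1 x" and fx: "poly f x = poly f u0 + (x - u0) * poly f1 x"
    using poly_synth by (auto simp: h1_def f1_def)
  have "(y - v0) * (y - v0) - (x - u0) * elt f1 (- h1) =
      (y\<^sup>2 + poly h x * y - poly f x) - (v0\<^sup>2 + poly h u0 * v0 - poly f u0) - (poly h u0 + 2 * v0) * (y - v0)"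
    unfolding hx fx elt_def power2_eq_square by (simp add: algebra_simps)
  also have "\<dots> = 0" using rel curve r0 by simp
  finally have sq: "(y - v0) * (y - v0) = (x - u0) * elt f1 (- h1)" by simp
  have "ev f1 (- h1) \<noteq> 0"
    using ns poly_synth_deriv by (simp add: ev_def h1_def f1_def mult.commute)
  then have u: "elt f1 (- h1) \<in> V - P" using elt_unit[OF pol(2) K_pols(7)[OF pol(1)]] by blast
  then have un: "elt f1 (- h1) \<noteq> 0" "elt f1 (- h1) \<in> E" using P_0 VF by auto
  have yn: "y - v0 \<noteq> 0" "y - v0 \<in> E" using sq un x_u0 PV[OF y_P] VF by auto
  have "2 * val (y - v0) = e"
    using arg_cong[OF sq, of val] val_mult[OF yn(2,1) yn(2,1)] val_mult[OF x_u0(2,1) un(2,1)] val_unit[OF u]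
    by (simp add: e_def)
  then show "e = 2" "val (y - v0) = 1" using e by presburger+
qed

text \<open>One of the partial derivatives of the equation, with respect to \<open>y\<close> or to
  \<open>x\<close>, is nonzero at the point.\<close>

abbreviation "nonsing_pt \<equiv> poly h u0 + 2 * v0 \<noteq> 0 \<or> poly (pderiv f) u0 \<noteq> v0 * poly (pderiv h) u0"

text \<open>Starting from a denominator in \<open>K[x]\<close>, its power of \<open>x - u0\<close>
  has to be cancelled. A numerator vanishing at an unramified point is first multiplied by its
  conjugate, a unit, and becomes a norm; at a ramified point it is expanded in 1 and
  \<open>y - v0\<close>, whose values have different parity. The valuation ring is thus the local
  ring of the curve.\<close>

lemma localization:
  assumes ns: nonsing_pt and z: "z \<in> V"
  shows "\<exists>a\<in>pols K. \<exists>b\<in>pols K. \<exists>c\<in>pols K. \<exists>d\<in>pols K. ev c d \<noteq> 0 \<and> z = elt a b / elt c d"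
proof (cases "z = 0")
  case True
  then show ?thesis using K_pols(1,2)
    by (intro bexI[of _ 0] bexI[of _ 1]) (auto simp: elt_def ev_def)
next
  case False
  have zE: "z \<in> E" using z VF by auto
  then obtain a b c where abc: "a \<in> pols K" "b \<in> pols K" "c \<in> pols K" "c \<noteq> 0" "z = elt a b / poly c x"
    unfolding E_iff by blast
  obtain m c1 where c1: "c1 \<in> pols K" "c = X0 ^ m * c1" "poly c1 u0 \<noteq> 0" using lin_factor[OF abc(3,4)] by blast
  have vc: "val (poly c x) = int m * e" using val_lin[OF c1(1,3)] c1 by simp
  have pc: "poly c x \<noteq> 0" "poly c x \<in> E" using poly_x_eq_0 poly_V abc VF by auto
  have pc1: "poly c1 x \<noteq> 0" using poly_x_eq_0 c1 by auto
  have cx: "poly c x = (x - u0) ^ m * poly c1 x" by (simp add: c1(2) poly_power)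
  have vz: "val z \<ge> 0" using val_nonneg_iff[OF zE False] z by simp
  have xu: "(x - u0) ^ k \<in> E" "(x - u0) ^ k \<noteq> 0" "val ((x - u0) ^ k) = int k * e" for k
    using x_u0 F_intros(7) val_power[OF x_u0(2,1)] by (auto simp: e_def)
  have ab: "\<not> (a = 0 \<and> b = 0)" using abc False by (auto simp: elt_def)
  show ?thesis
  proof (cases "poly h u0 + 2 * v0 = 0")
    case False
    have e1: "e = 1" by (rule unramified[OF False])
    obtain k a1 b1 where k: "a1 \<in> pols K" "b1 \<in> pols K" "a = X0 ^ k * a1" "b = X0 ^ k * b1"
      "\<not> (poly a1 u0 = 0 \<and> poly b1 u0 = 0)" using pair_factor abc ab by blast
    have g: "elt a1 b1 \<noteq> 0" "elt a1 b1 \<in> E" using elt_eq_0[OF k(1,2)] k(5) elt_E k by auto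
    have zz: "z * poly c x = (x - u0) ^ k * elt a1 b1" using abc(5) pc unfolding k elt_X0_power by simp
    have vv: "val z + int m = int k + val (elt a1 b1)"
      using arg_cong[OF zz, of val] val_mult[OF zE \<open>z \<noteq> 0\<close> pc(2,1)] val_mult[OF xu(1,2) g(2,1)] vc xu(3) e1 by simp
    show ?thesis
    proof (cases "ev a1 b1 = 0")
      case False
      then have "val (elt a1 b1) = 0" using val_unit elt_unit k by blast
      then have "k \<ge> m" using vv vz by simp
      then have "(x - u0) ^ k = (x - u0) ^ m * (x - u0) ^ (k - m)" by (simp flip: power_add)
      then have "(x - u0) ^ m * (z * poly c1 x) = (x - u0) ^ m * ((x - u0) ^ (k - m) * elt a1 b1)"
        using zz unfolding cx by (simp only: ac_simps)
      then have "z * poly c1 x = (x - u0) ^ (k - m) * elt a1 b1"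
        unfolding mult_left_cancel[OF xu(2)[of m]] .
      then have "z = elt (X0 ^ (k - m) * a1) (X0 ^ (k - m) * b1) / elt c1 0"
        unfolding elt_X0_power using pc1 by (simp add: elt_def field_simps)
      moreover have "ev c1 0 \<noteq> 0" using c1 by (simp add: ev_def)
      ultimately show ?thesis
        by (intro bexI[of _ "X0 ^ (k - m) * a1"] bexI[of _ "X0 ^ (k - m) * b1"] bexI[of _ c1] bexI[of _ 0] conjI
          K_pols(1) K_pols(8)[OF K_pols(10)[OF X0_pols]] k c1)
    next
      case True
      have cp: "a1 - b1 * h \<in> pols K" "- b1 \<in> pols K" using conj_pols k by auto
      have cev: "ev (a1 - b1 * h) (- b1) \<noteq> 0" using conj_unit[OF False True k(5)] .
      have cu: "elt (a1 - b1 * h) (- b1) \<in> V - P" using elt_unit[OF cp cev] .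
      then have cn: "elt (a1 - b1 * h) (- b1) \<noteq> 0" "elt (a1 - b1 * h) (- b1) \<in> E" using P_0 VF by auto
      have n: "nrm a1 b1 \<in> pols K" "nrm a1 b1 \<noteq> 0" using nrm_pols nrm_eq_0 k by auto
      obtain j n1 where n1: "n1 \<in> pols K" "nrm a1 b1 = X0 ^ j * n1" "poly n1 u0 \<noteq> 0" using lin_factor[OF n] by blast
      have "val (elt a1 b1) = int j"
        using elt_conj[of a1 b1] val_mult[OF g(2,1) cn(2,1)] val_unit[OF cu] val_lin[OF n1(1,3), of j] e1 n1(2) by simp
      then have "k + j \<ge> m" using vv vz by simp
      then have pw: "(x - u0) ^ k * (x - u0) ^ j = (x - u0) ^ m * (x - u0) ^ (k + j - m)" by (simp flip: power_add)
      \<comment> \<open>The conjugate turns the numerator into a polynomial in \<open>x\<close>,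
        which contains \<open>x - u0\<close> at least as often as the denominator does.\<close>
      have "z * poly c x * elt (a1 - b1 * h) (- b1) = (x - u0) ^ k * (x - u0) ^ j * poly n1 x"
        using elt_conj[of a1 b1] n1(2) unfolding zz by (simp add: poly_power mult.assoc)
      then have "(x - u0) ^ m * (z * (poly c1 x * elt (a1 - b1 * h) (- b1))) =
          (x - u0) ^ m * ((x - u0) ^ (k + j - m) * poly n1 x)"
        unfolding cx pw by (simp only: ac_simps)
      then have "z * (poly c1 x * elt (a1 - b1 * h) (- b1)) = (x - u0) ^ (k + j - m) * poly n1 x"
        unfolding mult_left_cancel[OF xu(2)[of m]] .
      then have "z = elt (X0 ^ (k + j - m) * n1) 0 / elt (c1 * (a1 - b1 * h)) (c1 * (- b1))"
        using pc1 cn(1) nonzero_eq_divide_eq[of "poly c1 x * elt (a1 - b1 * h) (- b1)" z]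
        unfolding elt_scale[symmetric] by (simp add: elt_def[of _ 0] poly_power)
      moreover have "ev (c1 * (a1 - b1 * h)) (c1 * (- b1)) = poly c1 u0 * ev (a1 - b1 * h) (- b1)"
        by (simp add: ev_def algebra_simps)
      then have "ev (c1 * (a1 - b1 * h)) (c1 * (- b1)) \<noteq> 0" using cev c1 by simp
      ultimately show ?thesis
        by (intro bexI[of _ "X0 ^ (k + j - m) * n1"] bexI[of _ 0] bexI[of _ "c1 * (a1 - b1 * h)"]
          bexI[of _ "c1 * (- b1)"] conjI K_pols(1) K_pols(8)[OF K_pols(10)[OF X0_pols]]
          K_pols(8)[OF c1(1)] cp n1)
    qed
  next
    case True
    then have e2: "e = 2" and vy: "val (y - v0) = 1" using ramified ns by auto
    define r where "r = y - v0"
    have "r = elt [:- v0:] 1" by (simp add: r_def elt_def)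
    then have rn: "r \<noteq> 0" "r \<in> E"
      using elt_eq_0[OF K_pols(3)[OF sub_ring_uminus[OF K_ring v0]] K_pols(2)] PV[OF y_P] VF by (auto simp: r_def)
    define a' where "a' = a + smult v0 b"
    have a': "a' \<in> pols K" unfolding a'_def by (intro K_pols abc v0)
    have el: "elt a b = poly a' x + poly b x * r" by (simp add: elt_def a'_def r_def algebra_simps)
    \<comment> \<open>The bound \<open>2 * int m - 1\<close> serves \<open>a'\<close> and
      \<open>b\<close> alike: polynomials in \<open>x\<close> have even values here, so it already
      yields \<open>2 * int m\<close>.\<close>
    have fac: "\<exists>q\<in>pols K. g = X0 ^ m * q" if g: "g \<in> pols K" and "g \<noteq> 0 \<longrightarrow> val (poly g x) \<ge> 2 * int m - 1" for g
    proof (cases "g = 0")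
      case True
      then show ?thesis using K_pols(1) by (intro bexI[of _ 0]) auto
    next
      case False
      then obtain n g1 where g1: "g1 \<in> pols K" "g = X0 ^ n * g1" "poly g1 u0 \<noteq> 0" using lin_factor[OF g] by blast
      then have "2 * int n \<ge> 2 * int m - 1" using that False val_lin[OF g1(1,3), of n] e2 by simp
      then have "n \<ge> m" by presburger
      then have "X0 ^ n = X0 ^ m * X0 ^ (n - m)" by (simp flip: power_add del: power_mult_distrib)
      then have "g = X0 ^ m * (X0 ^ (n - m) * g1)" using g1(2) by (simp only: mult.assoc)
      moreover have "X0 ^ (n - m) * g1 \<in> pols K" by (intro K_pols X0_pols g1)
      ultimately show ?thesis by blast
    qed
    have even: "even (val (poly g x))" if "g \<in> pols K" "g \<noteq> 0" for g
      using lin_factor[OF that] val_lin e2 by fastforce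
    have gE: "poly g x \<noteq> 0" "poly g x \<in> E" if "g \<in> pols K" "g \<noteq> 0" for g
      using that poly_x_eq_0 poly_V VF by auto
    have zc: "z * poly c x = poly a' x + poly b x * r" using abc(5) pc el by simp
    have vzc: "val (z * poly c x) \<ge> 2 * int m" using val_mult[OF zE \<open>z \<noteq> 0\<close> pc(2,1)] vz vc e2 by simp
    have vb: "val (poly b x * r) = val (poly b x) + 1" "poly b x * r \<in> E" "poly b x * r \<noteq> 0" if "b \<noteq> 0"
      using val_mult[OF gE(2,1) rn(2,1)] vy gE rn abc \<open>b \<noteq> 0\<close> F_intros(4) by (auto simp: r_def)
    \<comment> \<open>The two summands of \<open>z * poly c x\<close> have values of different
      parity, so they cannot cancel and each inherits the bound of the sum.\<close>
    have ge: "(a' \<noteq> 0 \<longrightarrow> val (poly a' x) \<ge> 2 * int m) \<and> (b \<noteq> 0 \<longrightarrow> val (poly b x) + 1 \<ge> 2 * int m)"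
    proof (cases "a' = 0 \<or> b = 0")
      case True
      then show ?thesis using vzc vb unfolding zc by auto
    next
      case False
      then have "val (poly a' x) \<noteq> val (poly b x * r)" using even[of a'] even[of b] vb(1) a' abc by auto
      then consider "val (poly a' x) < val (poly b x * r)" | "val (poly b x * r) < val (poly a' x)" by linarith
      then show ?thesis
      proof cases
        case 1
        then show ?thesis using val_less_add(2)[of "poly a' x" "poly b x * r"] vzc vb gE[OF a'] False unfolding zc by auto
      next
        case 2
        then show ?thesis using val_less_add(2)[of "poly b x * r" "poly a' x"] vzc vb gE[OF a'] False unfolding zc
          by (auto simp: add.commute)
      qed
    qed
    obtain a2 where a2: "a2 \<in> pols K" "a' = X0 ^ m * a2" using fac[OF a'] ge by fastforce
    obtain b2 where b2: "b2 \<in> pols K" "b = X0 ^ m * b2" using fac[OF abc(2)] ge by fastforce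
    have "(x - u0) ^ m * (z * poly c1 x) = (x - u0) ^ m * (poly a2 x + poly b2 x * r)"
      using zc unfolding cx a2(2) b2(2) by (simp add: poly_power algebra_simps)
    then have "z * poly c1 x = poly a2 x + poly b2 x * r" unfolding mult_left_cancel[OF xu(2)[of m]] .
    then have "z = elt (a2 - smult v0 b2) b2 / elt c1 0"
      using pc1 by (simp add: elt_def r_def field_simps)
    moreover have "ev c1 0 \<noteq> 0" using c1 by (simp add: ev_def)
    moreover have "a2 - smult v0 b2 \<in> pols K" by (intro K_pols a2 b2 v0)
    ultimately show ?thesis using b2 c1 K_pols(1) by blast
  qed
qed

lemma rational:
  assumes ns: nonsing_pt and z: "z \<in> V" shows "\<exists>c\<in>K. z - c \<in> P"
proof -
  obtain a b c d where *: "a \<in> pols K" "b \<in> pols K" "c \<in> pols K" "d \<in> pols K" "ev c d \<noteq> 0"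
    "z = elt a b / elt c d" using localization[OF assms] by blast
  have u: "elt c d \<in> V - P" using elt_unit * by blast
  then have nz: "elt c d \<noteq> 0" using P_0 by auto
  define w where "w = ev a b / ev c d"
  have wK: "w \<in> K" unfolding w_def using * ev_K sub_field_divide[OF K] by blast
  have "inverse (elt c d) * ((elt a b - ev a b) - w * (elt c d - ev c d)) \<in> P"
    using wK KV * u unit_inverse[OF u] by (intro P_mult(1) P_diff elt_ev) auto
  moreover have "inverse (elt c d) * ((elt a b - ev a b) - w * (elt c d - ev c d)) = z - w"
    using nz * by (simp add: w_def field_simps)
  ultimately show ?thesis using wK by auto
qed

end

text \<open>A denominator that does not vanish at the point is a unit in every place centred there,
  so \<open>localization\<close> puts \<open>V\<close> inside \<open>W\<close> and
  conversely.\<close>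

lemma (in quad) point_unique:
  assumes "quad_point K x y h f V u0 v0" "quad_point K x y h f W u0 v0"
    and ns: "poly h u0 + 2 * v0 \<noteq> 0 \<or> poly (pderiv f) u0 \<noteq> v0 * poly (pderiv h) u0"
  shows "V = W"
proof -
  have "V \<subseteq> W" if V: "quad_point K x y h f V u0 v0" and W: "quad_point K x y h f W u0 v0" for V W
  proof
    interpret V: quad_point K x y h f V u0 v0 by (rule V)
    interpret W: quad_point K x y h f W u0 v0 by (rule W)
    fix z assume "z \<in> V"
    then obtain a b c d where *: "a \<in> pols K" "b \<in> pols K" "c \<in> pols K" "d \<in> pols K" "V.ev c d \<noteq> 0"
      "z = elt a b / elt c d" using V.localization[OF ns] by blast
    have "elt c d \<in> W - nonunits W" using W.elt_unit[OF *(3,4)] *(5) by simp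
    then show "z \<in> W" unfolding *(6) divide_inverse
      using W.V_intros(4) W.elt_V[OF *(1,2)] W.unit_inverse by blast
  qed
  then show ?thesis using assms by blast
qed

text \<open>Chevalley's theorem for the coordinate ring \<open>K[x, y]\<close> and the ideal of
  functions vanishing at the point. Evaluation is well defined because 1 and \<open>y\<close> are
  independent, and multiplicative because the point satisfies the equation.\<close>

lemma (in quad) point_exists:
  assumes u0: "u0 \<in> K" and v0: "v0 \<in> K" and c: "v0\<^sup>2 + poly h u0 * v0 = poly f u0"
  shows "\<exists>V. quad_point K x y h f V u0 v0"
proof -
  define R where "R = {elt a b |a b. a \<in> pols K \<and> b \<in> pols K}"
  define J where "J = {elt a b |a b. a \<in> pols K \<and> b \<in> pols K \<and> poly a u0 + poly b u0 * v0 = 0}"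
  have v2: "v0 * v0 = poly f u0 - poly h u0 * v0" using c by (simp add: power2_eq_square algebra_simps)
  have evm: "poly (a * a' + b * b' * f) u0 + poly (a * b' + a' * b - b * b' * h) u0 * v0 =
    (poly a u0 + poly b u0 * v0) * (poly a' u0 + poly b' u0 * v0)" for a b a' b'
  proof -
    have "(poly a u0 + poly b u0 * v0) * (poly a' u0 + poly b' u0 * v0) =
      poly a u0 * poly a' u0 + (poly a u0 * poly b' u0 + poly a' u0 * poly b u0) * v0 + poly b u0 * poly b' u0 * (v0 * v0)"
      by (simp add: algebra_simps)
    then show ?thesis unfolding v2 by (simp add: algebra_simps)
  qed
  have inR: "elt a b \<in> R" if "a \<in> pols K" "b \<in> pols K" for a b using that by (auto simp: R_def)
  have inJ: "elt a b \<in> J" if "a \<in> pols K" "b \<in> pols K" "poly a u0 + poly b u0 * v0 = 0" for a b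
    using that by (auto simp: J_def)
  have cR: "k \<in> R" if "k \<in> K" for k using inR[OF K_pols(3,1)] that by (simp add: elt_def)
  have R: "sub_ring R" unfolding sub_ring_def
  proof (intro conjI ballI)
    show "1 \<in> R" using cR sub_ring_one[OF K_ring] .
    fix z w assume "z \<in> R" "w \<in> R"
    then obtain a b a' b' where *: "a \<in> pols K" "b \<in> pols K" "z = elt a b" "a' \<in> pols K" "b' \<in> pols K" "w = elt a' b'"
      unfolding R_def by blast
    then show "z - w \<in> R" "z * w \<in> R" unfolding *(3,6) elt_diff elt_mult by (intro inR K_pols h f; simp)+
  qed
  have RE: "R \<subseteq> E" using elt_E by (auto simp: R_def)
  have J: "ideal_of J R" unfolding ideal_of_def
  proof (intro conjI ballI)
    show "J \<subseteq> R" by (auto simp: J_def R_def)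
    show "0 \<in> J" using inJ[of 0 0] K_pols(1) by (simp add: elt_def)
    show "1 \<notin> J"
    proof
      assume "1 \<in> J"
      then obtain a b where ab: "a \<in> pols K" "b \<in> pols K" "elt a b = 1" "poly a u0 + poly b u0 * v0 = 0"
        by (auto simp: J_def)
      have "elt (a - 1) b = 0" using ab(3) by (simp add: elt_def algebra_simps)
      then have "a - 1 = 0 \<and> b = 0" using elt_eq_0[OF K_pols(6)[OF ab(1) K_pols(2)] ab(2)] by blast
      then show False using ab(4) by simp
    qed
    fix w assume "w \<in> J"
    then obtain a' b' where w: "a' \<in> pols K" "b' \<in> pols K" "w = elt a' b'" "poly a' u0 + poly b' u0 * v0 = 0"
      unfolding J_def by blast
    {
      fix z assume "z \<in> J"
      then obtain a b where z: "a \<in> pols K" "b \<in> pols K" "z = elt a b" "poly a u0 + poly b u0 * v0 = 0"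
        unfolding J_def by blast
      have "z + w = elt (a + a') (b + b')" by (simp add: z w elt_def algebra_simps)
      moreover have "poly (a + a') u0 + poly (b + b') u0 * v0 =
          (poly a u0 + poly b u0 * v0) + (poly a' u0 + poly b' u0 * v0)" by (simp add: algebra_simps)
      ultimately show "z + w \<in> J" using z w K_pols(5) by (auto intro!: inJ)
    }
    fix z assume "z \<in> R"
    then obtain a b where z: "a \<in> pols K" "b \<in> pols K" "z = elt a b" unfolding R_def by blast
    show "z * w \<in> J" unfolding z w elt_mult
      by (rule inJ) (use z w evm[of a a' b b'] in \<open>auto intro!: K_pols h f\<close>)
  qed
  obtain V where V: "sub_ring V" "R \<subseteq> V" "V \<subseteq> E" "\<And>z. z \<in> E \<Longrightarrow> z \<in> V \<or> inverse z \<in> V" "J \<subseteq> nonunits V"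
    using chevalley[OF E_field R RE J] by blast
  have X0: "[:- u0, 1:] \<in> pols K" by (intro K_pols(1,4) sub_ring_intros[OF K_ring] u0)
  have xJ: "x - u0 \<in> J" using inJ[OF X0 K_pols(1)] by (simp add: elt_def)
  have Y0: "[:- v0:] \<in> pols K" by (intro K_pols(3) sub_ring_intros[OF K_ring] v0)
  have yJ: "y - v0 \<in> J" using inJ[OF Y0 K_pols(2)] by (simp add: elt_def)
  have xn: "x - u0 \<noteq> 0" using poly_x_eq_0[OF X0] by auto
  have "inverse (x - u0) \<notin> V" using V(5) xJ xn by (auto simp: nonunits_def)
  moreover have "inverse (x - u0) \<in> E" using V(5,3) xJ sub_field_inverse[OF E_field] by (auto simp: nonunits_def)
  ultimately have "V \<noteq> E" by auto
  then have "vring K E V" using V cR by (auto simp: vring_def)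
  moreover have "x \<in> V" using inR[OF X_pols K_pols(1)] V(2) by (auto simp: elt_def)
  ultimately show ?thesis using xJ yJ V(5) u0 v0
    by (intro exI[of _ V]) (unfold_locales, auto)
qed

section \<open>Weierstrass curves\<close>

text \<open>Nonsingularity is asked at points over \<open>K\<close> itself. In this shape the
  setting fits both the given constants and their algebraic closure.\<close>

locale ell =
  fixes K :: "'a::field set" and x y a1 a2 a3 a4 a6 :: 'a
  assumes K_field: "sub_field K" and coeffs_K: "a1 \<in> K" "a2 \<in> K" "a3 \<in> K" "a4 \<in> K" "a6 \<in> K"
    and transc: "p \<in> pols K \<Longrightarrow> poly p x = 0 \<Longrightarrow> p = 0"
    and on_curve: "weierstrass a1 a2 a3 a4 a6 x y = 0"
    and nonsingular: "u \<in> K \<Longrightarrow> v \<in> K \<Longrightarrow> weierstrass a1 a2 a3 a4 a6 u v = 0 \<Longrightarrow>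
      \<not> (weierstrass_du a1 a2 a4 u v = 0 \<and> weierstrass_dv a1 a3 u v = 0)"
begin

abbreviation "h \<equiv> [:a3, a1:]"
abbreviation "f \<equiv> [:a6, a4, a2, 1:]"

lemma hf_pols: "h \<in> pols K" "f \<in> pols K"
  by (intro pols_intros[OF sub_field_ring[OF K_field]] coeffs_K sub_ring_one[OF sub_field_ring[OF K_field]])+

lemma weierstrass_iff: "weierstrass a1 a2 a3 a4 a6 u v = 0 \<longleftrightarrow> v\<^sup>2 + poly h u * v = poly f u"
proof -
  have "weierstrass a1 a2 a3 a4 a6 u v = v\<^sup>2 + poly h u * v - poly f u"
    by (simp add: weierstrass_def algebra_simps power2_eq_square power3_eq_cube)
  then show ?thesis by simp
qed

text \<open>A relation would give \<open>a * a - a * b * h = b * b * f\<close>. The right side has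
  the odd degree \<open>2 * degree b + 3\<close>; the left side has even degree if
  \<open>degree a \<ge> degree b + 2\<close>, and too small a degree otherwise.\<close>

lemma y_not_rational:
  assumes a: "a \<in> pols K" and b: "b \<in> pols K" and eq: "poly a x + poly b x * y = 0" shows "a = 0 \<and> b = 0"
proof -
  have ay: "poly a x = - (poly b x * y)" using eq by (simp add: eq_neg_iff_add_eq_0)
  have "poly (a * a - a * b * h - b * b * f) x = poly b x * poly b x * (y\<^sup>2 + poly h x * y - poly f x)"
    unfolding poly_diff poly_mult ay power2_eq_square by (simp add: algebra_simps)
  also have "\<dots> = 0" using on_curve weierstrass_iff by simp
  finally have "poly (a * a - a * b * h - b * b * f) x = 0" .
  then have "a * a - a * b * h - b * b * f = 0"
    by (rule transc[rotated]) (intro pols_intros(6,8)[OF sub_field_ring[OF K_field]] a b hf_pols)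
  then have id: "a * a - a * b * h = b * b * f" by simp
  have "b = 0"
  proof (rule ccontr)
    assume "b \<noteq> 0"
    then have db: "degree (b * b * f) = 2 * degree b + 3" by (simp add: degree_mult_eq del: mult_pCons_left mult_pCons_right)
    then have "a \<noteq> 0" using id by auto
    then have da: "degree (a * a) = 2 * degree a" by (simp add: degree_mult_eq)
    have "degree h \<le> 1" by simp
    then have dh: "degree (a * b * h) \<le> degree a + degree b + 1"
      using degree_mult_le[of "a * b" h] degree_mult_le[of a b] by linarith
    show False
    proof (cases "degree a \<ge> degree b + 2")
      case True
      then have "degree (a * b * h) < degree (a * a)" using da dh by linarith
      then have "degree (a * a - a * b * h) = degree (a * a)"
        using degree_add_eq_left[of "- (a * b * h)" "a * a"] by (simp del: mult_pCons_left mult_pCons_right)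
      then have "2 * degree a = 2 * degree b + 3" using id da db by metis
      then show False by presburger
    next
      case False
      then have "degree (a * b * h) < 2 * degree b + 3" "degree (a * a) < 2 * degree b + 3" using da dh by linarith+
      then have "degree (a * a - a * b * h) < 2 * degree b + 3" by (rule degree_diff_less[rotated])
      then show False using id db by (metis less_irrefl)
    qed
  qed
  then show ?thesis using eq transc a by simp
qed

sublocale quad K x y h f
  by unfold_locales (use K_field hf_pols on_curve weierstrass_iff y_not_rational in auto)

text \<open>In these coordinates the place at infinity becomes the point \<open>(0, 0)\<close>.\<close>

definition "w = 1 / x"
definition "r = y / x\<^sup>2"
abbreviation "hw \<equiv> [:0, a1, a3:]"
abbreviation "fw \<equiv> [:0, 1, a2, a4, a6:]"

lemma x_nz: "x \<noteq> 0" using poly_x_eq_0[OF X_pols] by auto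

lemma quad_infinity: "quad K w r hw fw"
proof
  show "sub_field K" by (rule K_field)
  show "hw \<in> pols K" "fw \<in> pols K" by (intro K_pols coeffs_K sub_ring_intros[OF K_ring])+
  \<comment> \<open>This is the Weierstrass equation divided by \<open>x^4\<close>, from which the
    coefficients of \<open>hw\<close> and \<open>fw\<close> are read off. Scaling \<open>y\<close>
    by \<open>x^2\<close> keeps the model monic and quadratic in its second coordinate.\<close>
  have "(r\<^sup>2 + poly hw w * r - poly fw w) * x ^ 4 = y\<^sup>2 + poly h x * y - poly f x"
    using x_nz by (simp add: w_def r_def field_simps power2_eq_square power4_eq_xxxx)
  also have "\<dots> = 0" using rel by simp
  finally show "r\<^sup>2 + poly hw w * r = poly fw w" using x_nz by simp
  fix a b assume a: "a \<in> pols K" and b: "b \<in> pols K" and eq: "poly a w + poly b w * r = 0"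
  \<comment> \<open>Multiplied by a power of \<open>x\<close>, a polynomial in \<open>1 / x\<close>
    becomes its reversal in \<open>x\<close>. So independence of 1 and \<open>r\<close> reduces to
    that of 1 and \<open>y\<close>.\<close>
  have A: "x ^ degree a * poly a w = poly (reflect_poly a) x" for a :: "'a poly"
    using poly_reflect_poly_nz[OF x_nz, of a] by (simp add: w_def inverse_eq_divide)
  have "poly ([:0, 1:] ^ (degree b + 2) * reflect_poly a) x + poly ([:0, 1:] ^ degree a * reflect_poly b) x * y =
    x ^ degree a * x ^ degree b * x\<^sup>2 * (poly a w + poly b w * r)"
    using x_nz by (simp add: A[symmetric] poly_power r_def distrib_left power_add power2_eq_square)
  then have "poly ([:0, 1:] ^ (degree b + 2) * reflect_poly a) x + poly ([:0, 1:] ^ degree a * reflect_poly b) x * y = 0"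
    using eq by simp
  then have "[:0, 1:] ^ (degree b + 2) * reflect_poly a = 0 \<and> [:0, 1:] ^ degree a * reflect_poly b = 0"
    by (rule indep[rotated 2]) (intro K_pols(8,10) X_pols pols_reflect K_ring a b)+
  then show "a = 0 \<and> b = 0" by auto
qed

sublocale inf: quad K w r hw fw by (rule quad_infinity)

lemma E_inf: "qset K w r = E"
proof
  have w: "w \<in> E" unfolding w_def by (intro sub_field_intros[OF E_field] x_E)
  have r: "r \<in> E" unfolding r_def by (intro sub_field_intros[OF E_field] x_E y_E)
  show "qset K w r \<subseteq> E" by (rule inf.E_least[OF E_field K_E w r])
  have "1 / w \<in> qset K w r" by (intro sub_field_intros[OF inf.E_field] inf.x_E)
  then have x: "x \<in> qset K w r" by (simp add: w_def)
  then have "r * x\<^sup>2 \<in> qset K w r" by (intro sub_field_intros[OF inf.E_field] inf.y_E)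
  then have "y \<in> qset K w r" using x_nz by (simp add: r_def)
  then show "E \<subseteq> qset K w r" by (rule E_least[OF inf.E_field inf.K_E x])
qed

lemma nonsing_point:
  assumes "u \<in> K" "v \<in> K" "v\<^sup>2 + poly h u * v = poly f u"
  shows "poly h u + 2 * v \<noteq> 0 \<or> poly (pderiv f) u \<noteq> v * poly (pderiv h) u"
proof -
  have "weierstrass_dv a1 a3 u v = poly h u + 2 * v" by (simp add: weierstrass_dv_def algebra_simps)
  moreover have "weierstrass_du a1 a2 a4 u v = v * poly (pderiv h) u - poly (pderiv f) u"
    by (simp add: weierstrass_du_def pderiv_pCons algebra_simps power2_eq_square)
  ultimately show ?thesis using nonsingular[OF assms(1,2)] assms(3) weierstrass_iff by auto
qed

lemma nonsing_infinity: "poly hw 0 + 2 * 0 \<noteq> 0 \<or> poly (pderiv fw) 0 \<noteq> 0 * poly (pderiv hw) 0"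
  by (simp add: pderiv_pCons)

lemma finite_place: "vring K E V \<Longrightarrow> x \<in> V \<Longrightarrow> quad_place K x y h f V"
  by unfold_locales

text \<open>\<open>w\<close> lies in the maximal ideal, and the second model writes
  \<open>r * r\<close> as \<open>w\<close> times an element of \<open>V\<close>, so \<open>r\<close>
  lies there too: every pole of \<open>x\<close> is centred at this one point.\<close>

lemma infinite_place_point:
  assumes V: "vring K E V" and x: "x \<notin> V" shows "quad_point K w r hw fw V 0 0"
proof -
  interpret V: vring_ctx K E V by unfold_locales (use E_field V in auto)
  have wP: "w \<in> nonunits V" using V.inverse_in_P[OF x_E x] by (simp add: w_def inverse_eq_divide)
  interpret W: quad_place K w r hw fw V
    by unfold_locales (use V wP in \<open>auto simp: E_inf nonunits_def\<close>)
  have "r * r = w * poly [:1, a2, a4, a6:] w - w * poly [:a1, a3:] w * r"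
    using inf.y_sq by (simp add: algebra_simps)
  moreover have "poly [:1, a2, a4, a6:] w \<in> V" "poly [:a1, a3:] w \<in> V"
    by (intro W.poly_V K_pols coeffs_K sub_ring_intros[OF K_ring])+
  ultimately have "r * r \<in> nonunits V" using wP W.y_V by (auto intro!: W.P_diff W.P_mult(2))
  then have "r \<in> nonunits V" using W.P_prime[OF W.y_V W.y_V] by blast
  then show ?thesis using wP sub_ring_zero[OF K_ring] by unfold_locales auto
qed

definition "VO = (SOME V. quad_point K w r hw fw V 0 0)"

lemma VO: "quad_point K w r hw fw VO 0 0"
  unfolding VO_def by (rule someI_ex) (rule inf.point_exists, auto intro: sub_ring_zero[OF K_ring])

lemma VO_unique: "quad_point K w r hw fw V 0 0 \<Longrightarrow> V = VO"
  by (rule inf.point_unique[OF _ VO nonsing_infinity])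

sublocale O: quad_point K w r hw fw VO 0 0
  rewrites "qset K w r = qset K x y"
  by (rule VO) (rule E_inf)

abbreviation "PO \<equiv> nonunits VO"

lemma x_VO: "x \<notin> VO"
  using O.x_P x_nz by (auto simp: nonunits_def w_def inverse_eq_divide)

definition on_E where "on_E u v \<longleftrightarrow> u \<in> K \<and> v \<in> K \<and> v\<^sup>2 + poly h u * v = poly f u"

definition "Vp u v = (SOME V. quad_point K x y h f V u v)"

lemma Vp: "on_E u v \<Longrightarrow> quad_point K x y h f (Vp u v) u v"
  unfolding Vp_def by (rule someI_ex) (rule point_exists, auto simp: on_E_def)

lemma Vp_unique: "quad_point K x y h f V u v \<Longrightarrow> on_E u v \<Longrightarrow> V = Vp u v"
  using point_unique[OF _ Vp] nonsing_point by (auto simp: on_E_def)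

fun pl where
  "pl None = PO"
| "pl (Some (u, v)) = nonunits (Vp u v)"

definition "pts = insert None (Some ` {(u, v). on_E u v})"

text \<open>The point \<open>(0, 0)\<close> of the second model is ramified and has \<open>r\<close>
  as uniformizer; the values of \<open>x = 1 / w\<close> and \<open>y = r / (w * w)\<close>
  follow.\<close>

lemma val_O: "O.val w = 2" "O.val r = 1" "O.val x = - 2" "O.val y = - 3"
proof -
  have "poly hw 0 + 2 * 0 = 0" "poly (pderiv fw) 0 \<noteq> 0 * poly (pderiv hw) 0"
    by (simp_all add: pderiv_pCons)
  from O.ramified[OF this] show w: "O.val w = 2" and r: "O.val r = 1" by (simp_all add: O.e_def)
  have wE: "w \<in> E" "w \<noteq> 0" and rE: "r \<in> E" using inf.x_E[unfolded E_inf] inf.y_E[unfolded E_inf] x_nz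
    by (auto simp: w_def)
  have rn: "r \<noteq> 0" using inf.elt_eq_0[OF K_pols(1,2)] by (simp add: inf.elt_def)
  have ww: "w * w \<in> E" "w * w \<noteq> 0" using wE O.F_intros(4) by auto
  show "O.val x = - 2" using O.val_inverse[OF wE] w by (simp add: w_def inverse_eq_divide)
  have "r / (w * w) = y" using x_nz by (simp add: r_def w_def power2_eq_square)
  then show "O.val y = - 3" using O.val_divide[OF rE rn ww] O.val_mult[OF wE wE] w r by simp
qed


lemma places_E: "Q \<in> places K E \<longleftrightarrow> (\<exists>V. vring K E V \<and> Q = nonunits V)"
  by (rule places_iff[OF E_field K_field])

lemma vring_O: "vring K E VO"
  by (rule O.V)

text \<open>Each place is visible in one of the two charts. Places of higher degree are included
  because \<open>lin_equiv\<close> compares orders everywhere.\<close>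

lemma vring_dvr: assumes V: "vring K E V" shows "dvr_ctx K E V"
proof (cases "x \<in> V")
  case True
  interpret V: quad_place K x y h f V by (rule finite_place[OF V True])
  show ?thesis by unfold_locales
next
  case False
  interpret V: quad_point K w r hw fw V 0 0 by (rule infinite_place_point[OF V False])
  show ?thesis using V.dvr_ctx_axioms by (simp add: E_inf)
qed

lemma infinite_vring: "vring K E V \<Longrightarrow> x \<notin> V \<Longrightarrow> V = VO"
  using infinite_place_point VO_unique by blast

lemma vring_ring: "vring K E V \<Longrightarrow> place_ring E (nonunits V) = V"
  by (rule vring_ctx.place_ring_eq) (unfold_locales, use E_field in auto)

lemma nonunits_inj: "vring K E V \<Longrightarrow> vring K E W \<Longrightarrow> nonunits V = nonunits W \<longleftrightarrow> V = W"
  using vring_ring by metis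

lemma vring_Vp: "on_E u v \<Longrightarrow> vring K E (Vp u v)"
proof -
  assume "on_E u v"
  then interpret V: quad_point K x y h f "Vp u v" u v by (rule Vp)
  show ?thesis by (rule V.V)
qed

lemma x_Vp: "on_E u v \<Longrightarrow> x \<in> Vp u v"
proof -
  assume "on_E u v"
  then interpret V: quad_point K x y h f "Vp u v" u v by (rule Vp)
  show ?thesis by (rule V.x_V)
qed

lemma y_VO: "y \<notin> VO"
proof -
  have "y \<noteq> 0" using elt_eq_0[OF K_pols(1,2)] by (simp add: elt_def)
  then show ?thesis using O.val_nonneg_iff[OF y_E] val_O(4) by simp
qed

lemma infinite_place_eq: "infinite_place K E x y = PO"
  unfolding infinite_place_def
proof (rule the_equality)
  show "PO \<in> places K E \<and> x \<notin> place_ring E PO \<and> y \<notin> place_ring E PO"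
    using vring_O vring_ring[OF vring_O] x_VO y_VO places_E by auto
  fix Q assume Q: "Q \<in> places K E \<and> x \<notin> place_ring E Q \<and> y \<notin> place_ring E Q"
  then obtain V where V: "vring K E V" "Q = nonunits V" unfolding places_E by blast
  then show "Q = PO" using Q vring_ring[OF V(1)] infinite_vring by simp
qed

lemma rational_E: "Q \<in> rational_places K E \<longleftrightarrow>
    (\<exists>V. vring K E V \<and> Q = nonunits V \<and> (\<forall>z\<in>V. \<exists>c\<in>K. z - c \<in> Q))"
  by (rule rational_places_iff[OF E_field K_field])

lemma pl_rational: assumes "p \<in> pts" shows "pl p \<in> rational_places K E"
proof (cases p)
  case None
  then show ?thesis using O.rational[OF nonsing_infinity] vring_O unfolding rational_E by auto
next
  case (Some q)
  then obtain u v where q: "p = Some (u, v)" "on_E u v" using assms by (auto simp: pts_def)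
  interpret V: quad_point K x y h f "Vp u v" u v by (rule Vp[OF q(2)])
  show ?thesis using V.rational[OF nonsing_point] q vring_Vp unfolding rational_E by (auto simp: on_E_def)
qed

text \<open>The residues of \<open>x\<close> and \<open>y\<close> are constants and give the
  coordinates of the point; if \<open>x\<close> has a pole, the place is \<open>PO\<close>.\<close>

lemma rational_pl: assumes "Q \<in> rational_places K E" shows "\<exists>p\<in>pts. Q = pl p"
proof -
  obtain V where V: "vring K E V" "Q = nonunits V" and res: "\<And>z. z \<in> V \<Longrightarrow> \<exists>c\<in>K. z - c \<in> Q"
    using assms unfolding rational_E by blast
  show ?thesis
  proof (cases "x \<in> V")
    case True
    interpret V: quad_place K x y h f V by (rule finite_place[OF V(1) True])
    obtain u v where uv: "u \<in> K" "x - u \<in> Q" "v \<in> K" "y - v \<in> Q" using res[OF True] res[OF V.y_V] by blast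
    then interpret V: quad_point K x y h f V u v by unfold_locales (auto simp: V(2))
    have on: "on_E u v" using uv V.curve by (simp add: on_E_def)
    then have "V = Vp u v" by (rule Vp_unique[OF V.quad_point_axioms])
    then show ?thesis using V(2) on by (intro bexI[of _ "Some (u, v)"]) (auto simp: pts_def)
  next
    case False
    then show ?thesis using infinite_vring[OF V(1)] V(2) by (intro bexI[of _ None]) (auto simp: pts_def)
  qed
qed

lemma pl_place: "p \<in> pts \<Longrightarrow> pl p \<in> places K E"
  using pl_rational by (auto simp: rational_places_def)

lemma on_E_x_P: assumes "on_E u v" shows "x - u \<in> pl (Some (u, v))" "y - v \<in> pl (Some (u, v))"
proof -
  interpret V: quad_point K x y h f "Vp u v" u v by (rule Vp[OF assms])
  show "x - u \<in> pl (Some (u, v))" "y - v \<in> pl (Some (u, v))" using V.x_P V.y_P by auto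
qed

lemma pl_Some_iff:
  assumes V: "vring K E V" and on: "on_E u v"
  shows "nonunits V = pl (Some (u, v)) \<longleftrightarrow> x \<in> V \<and> x - u \<in> nonunits V \<and> y - v \<in> nonunits V"
proof
  assume *: "nonunits V = pl (Some (u, v))"
  then have "V = Vp u v" using nonunits_inj[OF V vring_Vp[OF on]] by simp
  then show "x \<in> V \<and> x - u \<in> nonunits V \<and> y - v \<in> nonunits V"
    using on_E_x_P[OF on] x_Vp[OF on] by simp
next
  assume *: "x \<in> V \<and> x - u \<in> nonunits V \<and> y - v \<in> nonunits V"
  then interpret V: quad_place K x y h f V using finite_place[OF V] by simp
  have "quad_point K x y h f V u v" by unfold_locales (use * on in \<open>auto simp: on_E_def\<close>)
  then show "nonunits V = pl (Some (u, v))" using Vp_unique on by auto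
qed

lemma pl_O_iff: "vring K E V \<Longrightarrow> nonunits V = PO \<longleftrightarrow> x \<notin> V"
  using nonunits_inj[OF _ vring_O] infinite_vring x_VO by blast

lemma point_eq:
  assumes V: "vring K E V" and "x - u \<in> nonunits V" "y - v \<in> nonunits V" "x - u' \<in> nonunits V" "y - v' \<in> nonunits V"
    and "u \<in> K" "v \<in> K" "u' \<in> K" "v' \<in> K"
  shows "u = u'" "v = v'"
proof -
  interpret V: vring_ctx K E V by unfold_locales (use E_field V in auto)
  have K0: "c = 0" if "c \<in> K" "c \<in> nonunits V" for c
    using that V.KV sub_field_inverse[OF K_field] by (auto simp: nonunits_def)
  have "u' - u \<in> nonunits V" "v' - v \<in> nonunits V" using V.P_diff[OF assms(2,4)] V.P_diff[OF assms(3,5)] by auto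
  moreover have "u' - u \<in> K" "v' - v \<in> K" using assms sub_ring_diff[OF K_ring] by auto
  ultimately show "u = u'" "v = v'" using K0 by fastforce+
qed

lemma pl_inj: "p \<in> pts \<Longrightarrow> q \<in> pts \<Longrightarrow> pl p = pl q \<longleftrightarrow> p = q"
proof -
  have S: "p = q" if pq: "p = Some (u, v)" "on_E u v" "q \<in> pts" "pl p = pl q" for p q u v
  proof (cases q)
    case None
    then have "nonunits (Vp u v) = PO" using pq by simp
    then show ?thesis using pl_O_iff[OF vring_Vp[OF pq(2)]] x_Vp[OF pq(2)] by simp
  next
    case (Some q')
    then obtain u' v' where q': "q = Some (u', v')" "on_E u' v'" using pq(3) by (auto simp: pts_def)
    have "nonunits (Vp u v) = pl (Some (u', v'))" using pq q' by simp
    then have "x - u' \<in> nonunits (Vp u v)" "y - v' \<in> nonunits (Vp u v)"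
      using pl_Some_iff[OF vring_Vp[OF pq(2)] q'(2)] by blast+
    then show ?thesis using point_eq[OF vring_Vp[OF pq(2)]] on_E_x_P[OF pq(2)] pq(1,2) q'
      by (auto simp: on_E_def)
  qed
  assume pq: "p \<in> pts" "q \<in> pts"
  show "pl p = pl q \<longleftrightarrow> p = q"
  proof (cases "p = None \<and> q = None")
    case False
    then consider u v where "p = Some (u, v)" "on_E u v" | u v where "q = Some (u, v)" "on_E u v"
      using pq by (auto simp: pts_def)
    then show ?thesis using S[OF _ _ pq(2), of p] S[OF _ _ pq(1), of q] by cases metis+
  qed simp
qed

end

section \<open>Chords and tangents\<close>

text \<open>\<^term>\<open>None\<close> is the point at infinity. In the last case \<open>u1\<close>, \<open>u2\<close>, \<open>u3\<close> are the
  abscissae of the points in which the line \<open>v = l * u + m\<close> meets the curve, and the three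
  equations compare the coefficients of the cubic in \<open>u\<close> with its factorization.\<close>

definition chord ::
  "'a::field set \<Rightarrow> 'a \<Rightarrow> 'a \<Rightarrow> 'a \<Rightarrow> 'a \<Rightarrow> 'a \<Rightarrow> ('a \<times> 'a) option \<Rightarrow> ('a \<times> 'a) option \<Rightarrow> ('a \<times> 'a) option \<Rightarrow> bool" where
  "chord K a1 a2 a3 a4 a6 p q r \<longleftrightarrow>
     p = None \<and> r = q \<or> q = None \<and> r = p \<or>
     (\<exists>u v. p = Some (u, v) \<and> q = Some (u, - v - a1 * u - a3) \<and> r = None) \<or>
     (\<exists>l\<in>K. \<exists>m\<in>K. \<exists>u1 u2 u3. p = Some (u1, l * u1 + m) \<and> q = Some (u2, l * u2 + m) \<and>
        r = Some (u3, - (l * u3 + m) - a1 * u3 - a3) \<and>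
        l\<^sup>2 + a1 * l - a2 = u1 + u2 + u3 \<and>
        2 * l * m + a1 * m + a3 * l - a4 = - (u1 * u2 + u1 * u3 + u2 * u3) \<and>
        m\<^sup>2 + a3 * m - a6 = u1 * u2 * u3)"

context ell
begin

abbreviation "cj u v \<equiv> - v - a1 * u - a3"

lemma on_E_cj: "on_E u v \<Longrightarrow> on_E u (cj u v)"
proof -
  assume on: "on_E u v"
  then have "cj u v \<in> K" unfolding on_E_def by (intro sub_ring_intros[OF K_ring] coeffs_K) auto
  moreover have "(cj u v)\<^sup>2 + poly h u * cj u v = v\<^sup>2 + poly h u * v" by (simp add: power2_eq_square algebra_simps)
  ultimately show ?thesis using on by (simp add: on_E_def)
qed

text \<open>By the equation of the curve \<open>(y - v) * (y - cj u v)\<close> is a multiple of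
  \<open>x - u\<close>, so only these two ordinates occur above \<open>u\<close>.\<close>

lemma point_on_line:
  assumes V: "vring K E V" and x: "x \<in> V" and on: "on_E u v" and xu: "x - u \<in> nonunits V"
  shows "y - v \<in> nonunits V \<or> y - cj u v \<in> nonunits V"
proof -
  interpret V: quad_place K x y h f V by (rule finite_place[OF V x])
  have uv: "u \<in> V" "v \<in> V" "u \<in> K" using on V.KV by (auto simp: on_E_def)
  have cv: "cj u v \<in> V" using on_E_cj[OF on] V.KV by (auto simp: on_E_def)
  have "(y - v) * (y - cj u v) = (x - u) * (- a1 * y + (x * x + x * u + u * u) + a2 * (x + u) + a4) +
      (y\<^sup>2 + poly h x * y - poly f x) - (v\<^sup>2 + poly h u * v - poly f u)"
    by (simp add: algebra_simps power2_eq_square power3_eq_cube)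
  also have "\<dots> = (x - u) * (- a1 * y + (x * x + x * u + u * u) + a2 * (x + u) + a4)"
    using rel on by (simp add: on_E_def)
  finally have "(y - v) * (y - cj u v) \<in> nonunits V"
    by (simp only:) (intro V.P_mult(2)[OF xu] V.V_intros x uv V.y_V subsetD[OF V.KV] coeffs_K)
  then show ?thesis using V.P_prime V.V_intros(3) V.y_V uv cv by blast
qed

text \<open>At a zero the order is the ramification index. If the two points above \<open>u\<close>
  coincide, both indicators count and the index is 2; if they differ, one indicator counts and the
  place is unramified. At infinity the double pole of \<open>x\<close> decides.\<close>

lemma val_x:
  assumes V: "vring K E V" and on: "on_E u v"
  shows "place_val E (nonunits V) (x - u) =
    (if nonunits V = pl (Some (u, v)) then 1 else 0) + (if nonunits V = pl (Some (u, cj u v)) then 1 else 0)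
    - (if x \<in> V then 0 else 2)"
proof -
  interpret V: dvr_ctx K E V by (rule vring_dvr[OF V])
  have uK: "u \<in> K" using on by (simp add: on_E_def)
  show ?thesis
  proof (cases "x \<in> V")
    case False
    then have VO: "V = VO" using infinite_vring[OF V] by simp
    have ne: "nonunits V \<noteq> pl (Some (u, v))" "nonunits V \<noteq> pl (Some (u, cj u v))"
      using pl_Some_iff[OF V] on on_E_cj[OF on] False by auto
    have "O.val (x - u) = - 2"
    proof (cases "u = 0")
      case False
      have "- u \<in> VO - PO" using uK False O.unit_iff O.KV sub_field_intros(5)[OF K_field] sub_field_inverse[OF K_field]
        by (metis neg_equal_0_iff_equal subsetD)
      then have "O.val (- u) = 0" by (rule O.val_unit)
      moreover have "- u \<in> E" using uK K_E sub_field_intros(5)[OF K_field] by blast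
      ultimately show ?thesis using O.val_less_add(2)[OF x_E x_nz, of "- u"] val_O(3) False by simp
    qed (simp add: val_O)
    then show ?thesis using False ne VO by simp
  next
    case True
    have xV: "x - u \<in> V" using True uK V.KV V.V_intros(3) by blast
    have iff: "nonunits V = pl (Some (u, v')) \<longleftrightarrow> x - u \<in> V.P \<and> y - v' \<in> V.P" if "on_E u v'" for v'
      using pl_Some_iff[OF V that] True by simp
    show ?thesis
    proof (cases "x - u \<in> V.P")
      case False
      then have "V.val (x - u) = 0" using V.val_unit xV by blast
      then show ?thesis using iff on on_E_cj[OF on] False True by simp
    next
      case xP: True
      obtain v' where v': "v' = v \<or> v' = cj u v" "y - v' \<in> V.P"
        using point_on_line[OF V True on xP] by blast
      then have on': "on_E u v'" using on on_E_cj by auto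
      interpret Q: quad_point K x y h f V u v'
        by unfold_locales (use V True on' xP v' in \<open>auto simp: on_E_def\<close>)
      have h: "poly h u + 2 * v' = v' - cj u v'" by simp
      have both: "y - v \<in> V.P \<and> y - cj u v \<in> V.P \<longleftrightarrow> v = cj u v"
      proof
        assume "y - v \<in> V.P \<and> y - cj u v \<in> V.P"
        then show "v = cj u v" using point_eq(2)[OF V xP _ xP] on on_E_cj[OF on] by (auto simp: on_E_def)
      next
        assume vv: "v = cj u v"
        then have "v' = v" using v'(1) by metis
        then show "y - v \<in> V.P \<and> y - cj u v \<in> V.P" using v'(2) vv by metis
      qed
      show ?thesis
      proof (cases "v = cj u v")
        case True
        then have "v' = v" using v' by auto
        then have "poly h u + 2 * v' = 0" using h True by (metis right_minus_eq)
        then have "Q.e = 2" using Q.ramified(1) nonsing_point[of u v'] on' by (auto simp: on_E_def)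
        moreover have "pl (Some (u, cj u v)) = pl (Some (u, v))" unfolding True[symmetric] ..
        moreover have "nonunits V = pl (Some (u, v))" using iff[OF on] both True xP by blast
        ultimately show ?thesis using \<open>x \<in> V\<close>
          unfolding Q.e_def by (simp only: simp_thms if_True)
      next
        case False
        moreover have "cj u (cj u v) = v" by simp
        ultimately have "v' \<noteq> cj u v'" using v'(1) by metis
        then have "poly h u + 2 * v' \<noteq> 0" using h by (metis right_minus_eq)
        then have "Q.e = 1" using Q.unramified by simp
        moreover have "V.P = pl (Some (u, v)) \<longleftrightarrow> V.P \<noteq> pl (Some (u, cj u v))"
          using iff[OF on] iff[OF on_E_cj[OF on]] both False xP v' by blast
        ultimately show ?thesis using \<open>x \<in> V\<close> unfolding Q.e_def by auto
      qed
    qed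
  qed
qed

text \<open>The line times its conjugate is the norm
  \<open>- ((x - u1) * (x - u2) * (x - u3))\<close>, whose order is known from the ramification
  index. It remains to share this order between the line and its conjugate.\<close>

lemma val_line:
  assumes V: "vring K E V" and lm: "l \<in> K" "m \<in> K"
    and u: "u1 \<in> K" "u2 \<in> K" "u3 \<in> K"
    and c2: "l\<^sup>2 + a1 * l - a2 = u1 + u2 + u3"
    and c1: "2 * l * m + a1 * m + a3 * l - a4 = - (u1 * u2 + u1 * u3 + u2 * u3)"
    and c0: "m\<^sup>2 + a3 * m - a6 = u1 * u2 * u3"
  shows "on_E u1 (l * u1 + m)" "on_E u2 (l * u2 + m)" "on_E u3 (l * u3 + m)"
    "place_val E (nonunits V) (y - l * x - m) =
    (\<Sum>u\<leftarrow>[u1, u2, u3]. if nonunits V = pl (Some (u, l * u + m)) then 1 else 0) - (if x \<in> V then 0 else 3)"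
proof -
  have cubic: "(l * t + m)\<^sup>2 + poly h t * (l * t + m) - poly f t = - ((t - u1) * (t - u2) * (t - u3))" for t
  proof -
    have "(l * t + m)\<^sup>2 + poly h t * (l * t + m) - poly f t =
      - (t * t * t) + (l\<^sup>2 + a1 * l - a2) * (t * t) + (2 * l * m + a1 * m + a3 * l - a4) * t + (m\<^sup>2 + a3 * m - a6)"
      by (simp add: algebra_simps power2_eq_square)
    also have "\<dots> = - ((t - u1) * (t - u2) * (t - u3))"
      unfolding c2 c1 c0 by (simp add: algebra_simps)
    finally show ?thesis .
  qed
  have lK: "l * u + m \<in> K" if "u \<in> K" for u using that lm by (intro sub_ring_intros[OF K_ring])
  have on: "on_E t (l * t + m)" if t: "t \<in> {u1, u2, u3}" for t
  proof -
    have "(l * t + m)\<^sup>2 + poly h t * (l * t + m) - poly f t = 0" unfolding cubic using t by auto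
    moreover have "t \<in> K" using t u by blast
    ultimately show ?thesis using lK[of t] unfolding on_E_def by (metis right_minus_eq)
  qed
  then show "on_E u1 (l * u1 + m)" "on_E u2 (l * u2 + m)" "on_E u3 (l * u3 + m)" by auto
  interpret V: dvr_ctx K E V by (rule vring_dvr[OF V])
  show "place_val E (nonunits V) (y - l * x - m) =
    (\<Sum>u\<leftarrow>[u1, u2, u3]. if nonunits V = pl (Some (u, l * u + m)) then 1 else 0) - (if x \<in> V then 0 else 3)"
  proof (cases "x \<in> V")
    case False
    then have VO: "V = VO" using infinite_vring[OF V] by simp
    have ne: "nonunits V \<noteq> pl (Some (u, l * u + m))" if "u \<in> {u1, u2, u3}" for u
      using pl_Some_iff[OF V on[OF that]] False by auto
    have wE: "w \<in> E" "w \<noteq> 0" using inf.x_E[unfolded E_inf] x_nz by (auto simp: w_def)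
    \<comment> \<open>At infinity \<open>l * x + m\<close> has a pole of order at most 2, so the
      triple pole of \<open>y\<close> dominates.\<close>
    define g where "g = - (l * x + m)"
    have gE: "g \<in> E" unfolding g_def using lm K_E x_E by (intro sub_field_intros[OF E_field]) auto
    have "O.val (y + g) = - 3"
    proof (cases "g = 0")
      case True
      then show ?thesis by (simp add: val_O)
    next
      case False
      have "g * w \<in> VO"
      proof -
        have "g * w = - (l + m * w)" using x_nz by (simp add: g_def w_def field_simps)
        moreover have "- (l + m * w) \<in> VO" using lm O.KV O.PV[OF O.x_P] by (intro O.V_intros) auto
        ultimately show ?thesis by simp
      qed
      then have "O.val (g * w) \<ge> 0" using O.val_nonneg_iff[of "g * w"] gE wE False O.F_intros(4) by auto
      then have "O.val g \<ge> - 2" using O.val_mult[OF gE False wE] val_O by simp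
      moreover have "y \<noteq> 0" using y_VO O.V_intros(2) by auto
      ultimately show ?thesis using O.val_less_add(2)[OF y_E _ gE False] val_O by simp
    qed
    moreover have "y + g = y - l * x - m" by (simp add: g_def)
    ultimately show ?thesis using ne VO False by simp
  next
    case xV: True
    interpret Q: quad_place K x y h f V by (rule finite_place[OF V xV])
    define L where "L = y - l * x - m"
    have pL: "[:- m, - l:] \<in> pols K" by (intro K_pols sub_ring_intros[OF K_ring] lm)
    have L: "L = elt [:- m, - l:] 1" by (simp add: L_def elt_def)
    have LV: "L \<in> V" "L \<in> E" "L \<noteq> 0"
      unfolding L using Q.elt_V[OF pL K_pols(2)] elt_E[OF pL K_pols(2)] elt_eq_0[OF pL K_pols(2)] by auto
    define N where "N = - ((x - u1) * (x - u2) * (x - u3))"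
    define C where "C = elt ([:- m, - l:] - 1 * h) (- 1)"
    have CV: "C \<in> V" "C \<in> E" unfolding C_def using Q.elt_V elt_E pL K_pols hf_pols by (metis mult_1)+
    have LC: "L * C = N"
    proof -
      have "L * C = poly (nrm [:- m, - l:] 1) x" unfolding L C_def by (rule elt_conj)
      also have "\<dots> = (l * x + m)\<^sup>2 + poly h x * (l * x + m) - poly f x"
        by (simp add: nrm_def algebra_simps power2_eq_square)
      finally show ?thesis using cubic by (simp add: N_def)
    qed
    have iff: "nonunits V = pl (Some (u, l * u + m)) \<longleftrightarrow> x - u \<in> V.P \<and> L \<in> V.P" if u': "u \<in> {u1, u2, u3}" for u
    proof -
      have lV: "l \<in> V" using lm V.KV by auto
      have "L = (y - (l * u + m)) - l * (x - u)" by (simp add: L_def algebra_simps)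
      then have "y - (l * u + m) \<in> V.P \<longleftrightarrow> L \<in> V.P" if "x - u \<in> V.P"
        using V.P_diff[OF _ V.P_mult(1)[OF lV that]] V.P_add[OF _ V.P_mult(1)[OF lV that], of L] by auto
      then show ?thesis using pl_Some_iff[OF V on[OF u']] xV by blast
    qed
    show ?thesis
    proof (cases "L \<in> V.P")
      case False
      then have "V.val L = 0" using V.val_unit LV by blast
      then show ?thesis using iff False xV by (simp add: L_def)
    next
      case LP: True
      have xuV: "x - t \<in> V" if "t \<in> K" for t using that xV V.KV V.V_intros(3) by blast
      have "L * C \<in> V.P" using V.P_mult(2)[OF LP CV(1)] .
      then have "(x - u1) * (x - u2) * (x - u3) \<in> V.P" using V.P_uminus[of N] LC by (simp add: N_def)
      then obtain u where uu: "u \<in> {u1, u2, u3}" "x - u \<in> V.P"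
        using V.P_prime xuV V.V_intros(4) u by (metis insert_iff)
      define v where "v = l * u + m"
      have onu: "on_E u v" using on[OF uu(1)] by (simp add: v_def)
      have yP: "y - v \<in> V.P"
      proof -
        have "L + l * (x - u) \<in> V.P" using V.P_add[OF LP V.P_mult(1)[OF _ uu(2)]] lm V.KV by auto
        moreover have "L + l * (x - u) = y - v" by (simp add: L_def v_def algebra_simps)
        ultimately show ?thesis by simp
      qed
      interpret R: quad_point K x y h f V u v
        by unfold_locales (use onu uu yP in \<open>auto simp: on_E_def\<close>)
      have xt: "x - t \<in> E" "x - t \<noteq> 0" if "t \<in> K" for t
        using xuV[OF that] V.VF poly_x_eq_0[of "[:- t, 1:]"] K_pols(1,4) sub_ring_intros[OF K_ring] that by auto
      have xtP: "x - t \<in> V.P \<longleftrightarrow> t = u" if "t \<in> K" for t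
        using point_eq(1)[OF V _ yP uu(2) yP that] onu uu(2) by (auto simp: on_E_def)
      have vxt: "V.val (x - t) = (if t = u then R.e else 0)" if "t \<in> K" for t
        using xtP[OF that] V.val_unit xuV[OF that] by (auto simp: R.e_def)
      have vN: "V.val N = R.e * (\<Sum>t\<leftarrow>[u1, u2, u3]. if t = u then 1 else 0)"
      proof -
        have "V.val N = V.val ((x - u1) * (x - u2) * (x - u3))"
          unfolding N_def using xt u V.F_intros(4) by (intro V.val_uminus) auto
        also have "\<dots> = V.val (x - u1) + V.val (x - u2) + V.val (x - u3)"
          using V.val_mult[of "(x - u1) * (x - u2)" "x - u3"] V.val_mult[of "x - u1" "x - u2"] xt u V.F_intros(4) by simp
        finally show ?thesis using vxt u by (simp add: algebra_simps)
      qed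
      have Nn: "N \<noteq> 0" unfolding N_def using xt u by auto
      then have Cn: "C \<noteq> 0" using LC by auto
      have vLC: "V.val N = V.val L + V.val C" using V.val_mult[OF LV(2,3) CV(2) Cn] LC by simp
      have sum: "(\<Sum>t\<leftarrow>[u1, u2, u3]. if nonunits V = pl (Some (t, l * t + m)) then 1 else 0) =
          (\<Sum>t\<leftarrow>[u1, u2, u3]. if t = u then 1 else (0::int))"
        using iff[of u1] iff[of u2] iff[of u3] xtP[OF u(1)] xtP[OF u(2)] xtP[OF u(3)] LP by auto
      have "V.val L = (\<Sum>t\<leftarrow>[u1, u2, u3]. if t = u then 1 else 0)"
      proof (cases "poly h u + 2 * v = 0")
        case False
        \<comment> \<open>At an unramified point the conjugate does not vanish, so the line takes
          the full order of the norm.\<close>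
        have "R.ev ([:- m, - l:] - 1 * h) (- 1) = - (poly h u + 2 * v)" unfolding R.ev_def by (simp add: v_def algebra_simps)
        then have "R.ev ([:- m, - l:] - 1 * h) (- 1) \<noteq> 0" using False by (metis neg_equal_0_iff_equal)
        moreover have "[:- m, - l:] - 1 * h \<in> pols K" "- 1 \<in> pols K" by (intro K_pols pL hf_pols)+
        ultimately have "C \<in> V - V.P" unfolding C_def by (intro R.elt_unit)
        then show ?thesis using vLC vN V.val_unit R.unramified[OF False] by simp
      next
        case True
        note ram = R.ramified[OF True]
        have e2: "R.e = 2" "V.val (y - v) = 1" using ram nonsing_point[of u v] onu True by (auto simp: on_E_def)
        have yn: "y - v \<in> E" "y - v \<noteq> 0"
          using V.PV[OF yP] V.VF elt_eq_0[of "[:- v:]" 1] K_pols(2,3) sub_ring_intros(5)[OF K_ring] onu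
          by (auto simp: elt_def on_E_def)
        \<comment> \<open>At a ramified point \<open>y - v\<close> has value 1 and
          \<open>x - u\<close> value 2. Hence the line and its conjugate both have value 1, and
          comparison with the norm shows that exactly one of \<open>u1\<close>, \<open>u2\<close>,
          \<open>u3\<close> equals \<open>u\<close>.\<close>
        have lin: "V.val (y - v + k * (x - u)) = 1" if k: "k \<in> K" for k
        proof (cases "k = 0")
          case False
          have "V.val k = 0" using False k V.KV sub_field_inverse[OF K_field k] V.unit_iff V.val_unit by blast
          then have "V.val (k * (x - u)) = 2"
            using V.val_mult[of k "x - u"] k V.KV V.VF xt[of u] uu(1) u False e2 by (auto simp: R.e_def)
          moreover have "k * (x - u) \<in> E" "k * (x - u) \<noteq> 0" using k V.KV V.VF xt[of u] uu(1) u False V.F_intros(4) by auto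
          ultimately show ?thesis using V.val_less_add(2)[OF yn, of "k * (x - u)"] e2 by simp
        qed (simp add: e2)
        have "L = y - v + (- l) * (x - u)" by (simp add: L_def v_def algebra_simps)
        then have vL: "V.val L = 1" using lin[of "- l"] lm sub_ring_intros(5)[OF K_ring] by simp
        have C: "C = - (y - v + (l + a1) * (x - u)) - (poly h u + 2 * v)" by (simp add: C_def elt_def v_def algebra_simps)
        have C: "C = - (y - v + (l + a1) * (x - u))" using C unfolding True diff_zero .
        then have mC: "- C = y - v + (l + a1) * (x - u)" by simp
        have "- C \<noteq> 0" "- C \<in> E" using Cn V.F_intros(5)[OF CV(2)] by simp_all
        then have "V.val C = V.val (- C)" using V.val_uminus[of "- C"] by simp
        also have "\<dots> = 1" unfolding mC using lm coeffs_K by (intro lin sub_ring_intros[OF K_ring])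
        finally have "V.val C = 1" .
        then have "2 * (\<Sum>t\<leftarrow>[u1, u2, u3]. if t = u then 1 else 0) = (2::int)" using vLC vN e2 vL by simp
        then show ?thesis using vL by presburger
      qed
      then show ?thesis using sum xV by (simp add: L_def)
    qed
  qed
qed

lemma lookup_pl:
  "Poly_Mapping.lookup (frag_of P + frag_of Q - (frag_of R + frag_of S)) T =
   (if P = T then 1 else 0) + (if Q = T then 1 else 0) - (if R = T then 1 else 0) - (if S = T then 1 else 0)"
  by (simp add: lookup_minus lookup_add)

text \<open>The equation for the sum of the abscissae expresses the third one by constants.\<close>

lemma chord_pts:
  assumes "chord K a1 a2 a3 a4 a6 p q s" "p \<in> pts" "q \<in> pts" shows "s \<in> pts"
  using assms(1) unfolding chord_def
proof (elim disjE bexE exE conjE)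
  fix l m u1 u2 u3
  assume *: "l \<in> K" "m \<in> K" "p = Some (u1, l * u1 + m)" "q = Some (u2, l * u2 + m)"
    "s = Some (u3, - (l * u3 + m) - a1 * u3 - a3)" "l\<^sup>2 + a1 * l - a2 = u1 + u2 + u3"
    "2 * l * m + a1 * m + a3 * l - a4 = - (u1 * u2 + u1 * u3 + u2 * u3)" "m\<^sup>2 + a3 * m - a6 = u1 * u2 * u3"
  have u: "u1 \<in> K" "u2 \<in> K" using assms(2,3) * by (auto simp: pts_def on_E_def)
  have "u3 = l\<^sup>2 + a1 * l - a2 - u1 - u2" using *(6) by simp
  moreover have "l\<^sup>2 + a1 * l - a2 - u1 - u2 \<in> K" using u * coeffs_K by (intro sub_ring_intros[OF K_ring])
  ultimately have "u3 \<in> K" by simp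
  then have "on_E u3 (l * u3 + m)" using val_line(3)[OF vring_O *(1,2) u _ *(6,7,8)] by simp
  from on_E_cj[OF this] show "s \<in> pts" unfolding *(5) by (simp add: pts_def)
qed (use assms in \<open>auto simp: pts_def\<close>)

text \<open>A chord meeting the curve in \<open>P\<close>, \<open>Q\<close>, \<open>R\<close> has
  divisor \<open>P + Q + R - 3 O\<close>, and the vertical line through \<open>R\<close> and its
  conjugate \<open>S\<close> has divisor \<open>R + S - 2 O\<close>; their quotient is the function
  sought. A vertical chord serves by itself, and for a summand \<open>O\<close> the constant 1
  does.\<close>

lemma chord_lin_equiv:
  assumes ch: "chord K a1 a2 a3 a4 a6 p q s" and p: "p \<in> pts" and q: "q \<in> pts"
  shows "lin_equiv K E (frag_of (pl p) + frag_of (pl q)) (frag_of (pl s) + frag_of PO)"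
proof -
  have lin: ?thesis if "z \<in> E" "z \<noteq> 0"
    "\<And>V. vring K E V \<Longrightarrow> place_val E (nonunits V) z = (if pl p = nonunits V then 1 else 0) +
      (if pl q = nonunits V then 1 else 0) - (if pl s = nonunits V then 1 else 0) - (if PO = nonunits V then 1 else 0)" for z
    unfolding lin_equiv_def lookup_pl
  proof (intro bexI[of _ z] conjI ballI)
    fix T assume "T \<in> places K E"
    then obtain V where V: "vring K E V" "T = nonunits V" unfolding places_E by blast
    show "(if pl p = T then 1 else 0) + (if pl q = T then 1 else 0) - (if pl s = T then 1 else 0) -
        (if PO = T then 1 else 0) = place_val E T z"
      unfolding V(2) that(3)[OF V(1)] ..
  qed (use that in auto)
  have v1: "place_val E (nonunits V) 1 = 0" if "vring K E V" for V
    using dvr_ctx.val_1[OF vring_dvr[OF that]] .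
  have one: "1 \<in> E" using sub_field_intros(1)[OF E_field] .
  have PO: "PO = nonunits V \<longleftrightarrow> x \<notin> V" if "vring K E V" for V
    using pl_O_iff[OF that] by auto
  show ?thesis using ch unfolding chord_def
  proof (elim disjE bexE exE conjE)
    assume "p = None" "s = q"
    then show ?thesis by (intro lin[OF one]) (auto simp: v1)
  next
    assume "q = None" "s = p"
    then show ?thesis by (intro lin[OF one]) (auto simp: v1)
  next
    fix u v assume *: "p = Some (u, v)" "q = Some (u, cj u v)" "s = None"
    have on: "on_E u v" using p * by (auto simp: pts_def)
    have xu: "x - u \<in> E" "x - u \<noteq> 0" using x_E K_E on sub_field_intros(3)[OF E_field]
        poly_x_eq_0[of "[:- u, 1:]"] K_pols(1,4) sub_ring_intros[OF K_ring] by (auto simp: on_E_def)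
    show ?thesis
    proof (rule lin[OF xu])
      fix V assume V: "vring K E V"
      show "place_val E (nonunits V) (x - u) = (if pl p = nonunits V then 1 else 0) +
        (if pl q = nonunits V then 1 else 0) - (if pl s = nonunits V then 1 else 0) - (if PO = nonunits V then 1 else 0)"
        unfolding val_x[OF V on] * using PO[OF V] by (simp add: eq_commute[of "nonunits V"])
    qed
  next
    fix l m u1 u2 u3
    assume *: "l \<in> K" "m \<in> K" "p = Some (u1, l * u1 + m)" "q = Some (u2, l * u2 + m)"
      "s = Some (u3, - (l * u3 + m) - a1 * u3 - a3)" "l\<^sup>2 + a1 * l - a2 = u1 + u2 + u3"
      "2 * l * m + a1 * m + a3 * l - a4 = - (u1 * u2 + u1 * u3 + u2 * u3)" "m\<^sup>2 + a3 * m - a6 = u1 * u2 * u3"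
    have u: "u1 \<in> K" "u2 \<in> K" using p q * by (auto simp: pts_def on_E_def)
    have "s \<in> pts" using chord_pts[OF ch p q] .
    then have u3: "u3 \<in> K" using * by (auto simp: pts_def on_E_def)
    have on: "on_E u3 (l * u3 + m)" using val_line(3)[OF vring_O *(1,2) u u3 *(6,7,8)] .
    have xu: "x - u3 \<in> E" "x - u3 \<noteq> 0" using x_E K_E u3 sub_field_intros(3)[OF E_field]
        poly_x_eq_0[of "[:- u3, 1:]"] K_pols(1,4) sub_ring_intros[OF K_ring] by (auto simp: on_E_def)
    define L where "L = y - l * x - m"
    have pL: "[:- m, - l:] \<in> pols K" by (intro K_pols sub_ring_intros[OF K_ring] *)
    have "L = elt [:- m, - l:] 1" by (simp add: L_def elt_def)
    then have L: "L \<in> E" "L \<noteq> 0" using elt_E[OF pL K_pols(2)] elt_eq_0[OF pL K_pols(2)] by auto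
    have LE: "L / (x - u3) \<in> E" "L / (x - u3) \<noteq> 0" using sub_field_divide[OF E_field L(1) xu(1)] L xu by auto
    show ?thesis
    proof (rule lin[OF LE])
      fix V assume V: "vring K E V"
      have "place_val E (nonunits V) (L / (x - u3)) = place_val E (nonunits V) L - place_val E (nonunits V) (x - u3)"
        by (rule dvr_ctx.val_divide[OF vring_dvr[OF V] L xu])
      also have "\<dots> = (if pl p = nonunits V then 1 else 0) +
        (if pl q = nonunits V then 1 else 0) - (if pl s = nonunits V then 1 else 0) - (if PO = nonunits V then 1 else 0)"
        unfolding val_x[OF V on] L_def val_line(4)[OF V *(1,2) u u3 *(6,7,8)] *(3,4,5) using PO[OF V]
        by (simp add: eq_commute[of "nonunits V"])
      finally show "place_val E (nonunits V) (L / (x - u3)) = (if pl p = nonunits V then 1 else 0) +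
        (if pl q = nonunits V then 1 else 0) - (if pl s = nonunits V then 1 else 0) - (if PO = nonunits V then 1 else 0)" .
    qed
  qed
qed

lemma chord_exists:
  assumes p: "p \<in> pts" and q: "q \<in> pts" shows "\<exists>s\<in>pts. chord K a1 a2 a3 a4 a6 p q s"
proof -
  have "\<exists>s. chord K a1 a2 a3 a4 a6 p q s"
  proof (cases "p = None \<or> q = None")
    case True
    then show ?thesis unfolding chord_def by blast
  next
    case False
    then obtain u1 v1 u2 v2 where pq: "p = Some (u1, v1)" "q = Some (u2, v2)" "on_E u1 v1" "on_E u2 v2"
      using p q by (auto simp: pts_def)
    have K: "u1 \<in> K" "v1 \<in> K" "u2 \<in> K" "v2 \<in> K" using pq by (auto simp: on_E_def)
    show ?thesis
    proof (cases "u1 = u2 \<and> v2 = cj u1 v1")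
      case True
      then show ?thesis unfolding chord_def pq by blast
    next
      case False
      define l where "l = (if u1 = u2 then
        (3 * u1\<^sup>2 + 2 * a2 * u1 + a4 - a1 * v1) / (2 * v1 + a1 * u1 + a3) else (v2 - v1) / (u2 - u1))"
      define m where "m = v1 - l * u1"
      define u3 where "u3 = l\<^sup>2 + a1 * l - a2 - u1 - u2"
      have lK: "l \<in> K" unfolding l_def using K coeffs_K by (auto intro!: sub_field_intros[OF K_field])
      then have mK: "m \<in> K" unfolding m_def using K by (intro sub_field_intros[OF K_field])
      \<comment> \<open>\<open>u3\<close> makes the quadratic terms agree, so on the line the cubic
        misses its intended factorization by a linear polynomial
        \<open>\<alpha> * t + \<beta>\<close>. This vanishes at \<open>u1\<close>; that
        \<open>\<alpha> = 0\<close> follows from the second zero \<open>u2\<close>, or for a tangent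
        from the choice of the slope.\<close>
      define \<alpha> \<beta> where "\<alpha> = 2 * l * m + a1 * m + a3 * l - a4 + (u1 * u2 + u1 * u3 + u2 * u3)"
        and "\<beta> = m\<^sup>2 + a3 * m - a6 - u1 * u2 * u3"
      have G: "\<alpha> * t + \<beta> = (l * t + m)\<^sup>2 + poly h t * (l * t + m) - poly f t + (t - u1) * (t - u2) * (t - u3)" for t
        by (simp add: \<alpha>_def \<beta>_def u3_def algebra_simps power2_eq_square)
      have v1: "l * u1 + m = v1" by (simp add: m_def)
      have r1: "\<alpha> * u1 + \<beta> = 0" unfolding G v1 using pq(3) by (simp add: on_E_def)
      have v2\<alpha>: "l * u2 + m = v2 \<and> \<alpha> = 0"
      proof (cases "u1 = u2")
        case False
        then have "l * (u2 - u1) = v2 - v1" by (simp add: l_def)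
        then have v2: "l * u2 + m = v2" by (simp add: m_def algebra_simps)
        have "\<alpha> * u2 + \<beta> = 0" unfolding G v2 using pq(4) by (simp add: on_E_def)
        then have "\<alpha> * u1 = \<alpha> * u2" using r1 by (metis add_right_cancel)
        then show ?thesis using False v2 by simp
      next
        case True
        have "(v2 - v1) * (v2 - cj u1 v1) = (v2\<^sup>2 + poly h u2 * v2 - poly f u2) - (v1\<^sup>2 + poly h u1 * v1 - poly f u1)"
          unfolding True by (simp add: algebra_simps power2_eq_square)
        also have "\<dots> = 0" using pq(3,4) by (simp add: on_E_def)
        finally have vv: "v2 = v1" using False True by (metis mult_eq_0_iff right_minus_eq)
        then have "v1 \<noteq> cj u1 v1" using False True by metis
        moreover have "v1 - cj u1 v1 = 2 * v1 + a1 * u1 + a3" by (simp add: algebra_simps)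
        ultimately have d: "2 * v1 + a1 * u1 + a3 \<noteq> 0" by (metis right_minus_eq)
        have "l * (2 * v1 + a1 * u1 + a3) = 3 * u1\<^sup>2 + 2 * a2 * u1 + a4 - a1 * v1" using d True by (simp add: l_def)
        moreover have "\<alpha> = l * (2 * v1 + a1 * u1 + a3) - (3 * u1\<^sup>2 + 2 * a2 * u1 + a4 - a1 * v1)"
          unfolding \<alpha>_def u3_def m_def True[symmetric] by (simp add: algebra_simps power2_eq_square)
        ultimately show ?thesis using vv v1 True by simp
      qed
      then have ab: "\<alpha> = 0" "\<beta> = 0" and v2: "l * u2 + m = v2" using r1 by auto
      have "chord K a1 a2 a3 a4 a6 p q (Some (u3, - (l * u3 + m) - a1 * u3 - a3))"
        unfolding chord_def
      proof (intro disjI2, rule bexI[OF _ lK], rule bexI[OF _ mK],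
          rule exI[of _ u1], rule exI[of _ u2], rule exI[of _ u3], intro conjI)
        show "l\<^sup>2 + a1 * l - a2 = u1 + u2 + u3" by (simp add: u3_def)
        show "2 * l * m + a1 * m + a3 * l - a4 = - (u1 * u2 + u1 * u3 + u2 * u3)"
          by (rule iffD2[OF eq_neg_iff_add_eq_0 ab(1)[unfolded \<alpha>_def]])
        show "m\<^sup>2 + a3 * m - a6 = u1 * u2 * u3" using ab(2) unfolding \<beta>_def by simp
      qed (use pq v1 v2 in auto)
      then show ?thesis by blast
    qed
  qed
  then show ?thesis using chord_pts[OF _ p q] by blast
qed

text \<open>Pulling out \<open>x ^ degree a\<close> leaves the reversed polynomial in
  \<open>w\<close>. Its constant term is the leading coefficient of \<open>a\<close>, so it is a
  unit at \<open>O\<close>.\<close>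

lemma val_poly_O:
  assumes a: "a \<in> pols K" "a \<noteq> 0" shows "O.val (poly a x) = - 2 * int (degree a)"
proof -
  define b where "b = reflect_poly a"
  have b: "b \<in> pols K" unfolding b_def by (rule pols_reflect[OF K_ring a(1)])
  have "poly b 0 \<noteq> 0" using a(2) by (simp add: b_def poly_0_coeff_0)
  then have u: "poly b w \<in> VO - PO" by (rule O.poly_unit[OF b])
  then have bn: "poly b w \<noteq> 0" "poly b w \<in> E" using O.P_0 O.VF by auto
  have xn: "x ^ degree a \<noteq> 0" "x ^ degree a \<in> E" using x_nz x_E sub_field_intros(7)[OF E_field] by auto
  have "w ^ degree a * poly a x = poly b w"
    using poly_reflect_poly_nz[of w a] x_nz by (simp add: b_def w_def)
  then have "poly a x = x ^ degree a * poly b w" using x_nz by (simp add: w_def field_simps)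
  then show ?thesis
    using O.val_mult[OF xn(2,1) bn(2,1)] O.val_power[OF x_E x_nz, of "degree a"] O.val_unit[OF u] val_O(3) by simp
qed

text \<open>At \<open>O\<close> polynomials in \<open>x\<close> have even value and their multiples
  by \<open>y\<close> odd value. So nothing cancels, and the term with \<open>y\<close> already has
  a pole of order at least 3.\<close>

lemma val_elt_O:
  assumes a: "a \<in> pols K" and b: "b \<in> pols K" "b \<noteq> 0"
  shows "O.val (elt a b) \<le> - 3"
proof -
  have pb: "poly b x \<in> E" "poly b x \<noteq> 0" using elt_E[OF b(1) K_pols(1)] poly_x_eq_0 b by (auto simp: elt_def)
  have y: "y \<noteq> 0" using y_VO O.V_intros(2) by auto
  have by1: "poly b x * y \<in> E" "poly b x * y \<noteq> 0" using pb y y_E sub_field_intros(4)[OF E_field] by auto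
  have vb: "O.val (poly b x * y) = - 2 * int (degree b) - 3"
    using O.val_mult[OF pb y_E y] val_poly_O[OF b] val_O(4) by simp
  show ?thesis
  proof (cases "a = 0")
    case True
    then show ?thesis using vb by (simp add: elt_def)
  next
    case False
    have pa: "poly a x \<in> E" "poly a x \<noteq> 0" using elt_E[OF a K_pols(1)] poly_x_eq_0 a False by (auto simp: elt_def)
    have va: "O.val (poly a x) = - 2 * int (degree a)" by (rule val_poly_O[OF a False])
    have "O.val (poly a x) \<noteq> O.val (poly b x * y)" unfolding va vb by presburger
    then consider "O.val (poly a x) < O.val (poly b x * y)" | "O.val (poly b x * y) < O.val (poly a x)" by linarith
    then show ?thesis
    proof cases
      case 1
      then have "O.val (elt a b) = O.val (poly a x)" using O.val_less_add(2)[OF pa by1] by (simp add: elt_def)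
      then show ?thesis using 1 va vb by presburger
    next
      case 2
      then have "O.val (elt a b) = O.val (poly b x * y)"
        using O.val_less_add(2)[OF by1 pa] by (simp add: elt_def add.commute)
      then show ?thesis using vb by simp
    qed
  qed
qed

end

section \<open>Functions regular away from \<open>O\<close> over algebraically closed
  constants\<close>

locale ell_closed = ell +
  assumes root: "p \<in> pols K \<Longrightarrow> degree p > 0 \<Longrightarrow> \<exists>u\<in>K. poly p u = 0"
begin

lemma point_above: assumes "u \<in> K" shows "\<exists>v. on_E u v"
proof -
  have "poly h u \<in> K" "poly f u \<in> K" using pols_synthetic_div[OF K_ring assms] hf_pols by blast+
  then have "[:- poly f u, poly h u, 1:] \<in> pols K"
    by (intro K_pols sub_ring_intros[OF K_ring]) auto
  then obtain v where "v \<in> K" "poly [:- poly f u, poly h u, 1:] v = 0" using root by force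
  then show ?thesis using assms by (intro exI[of _ v]) (auto simp: on_E_def algebra_simps power2_eq_square)
qed

text \<open>A root \<open>u\<close> of the denominator can be cancelled: regularity makes the
  numerator vanish at every point above \<open>u\<close>, and this forces both of its coefficients
  \<open>a\<close> and \<open>b\<close> to vanish at \<open>u\<close>. Repetition leaves a constant
  denominator.\<close>

lemma regular_is_polynomial:
  assumes z: "z \<in> E" and reg: "\<And>V. vring K E V \<Longrightarrow> x \<in> V \<Longrightarrow> z \<in> V"
  shows "\<exists>a\<in>pols K. \<exists>b\<in>pols K. z = elt a b"
proof -
  have "\<exists>a\<in>pols K. \<exists>b\<in>pols K. z = elt a b"
    if "a \<in> pols K" "b \<in> pols K" "c \<in> pols K" "c \<noteq> 0" "poly c x * z = elt a b" for a b c
    using that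
  proof (induction "degree c" arbitrary: a b c)
    case 0
    then obtain k where k: "c = [:k:]" by (metis degree_eq_zeroE)
    then have kK: "k \<noteq> 0" "k \<in> K" using 0 coeff_pols[of c K 0] by auto
    have "z = elt (smult (inverse k) a) (smult (inverse k) b)"
      using 0(6) kK k by (simp add: elt_def field_simps)
    moreover have "smult (inverse k) a \<in> pols K" "smult (inverse k) b \<in> pols K"
      by (intro K_pols sub_field_inverse[OF K_field] kK 0)+
    ultimately show ?case by blast
  next
    case (Suc n)
    obtain u where u: "u \<in> K" "poly c u = 0" using root[OF Suc.prems(3)] Suc.hyps(2) by auto
    obtain v where on: "on_E u v" using point_above[OF u(1)] by blast
    define X0 where "X0 = [:- u, 1:]"
    define c1 where "c1 = synthetic_div c u"
    have c1: "c = X0 * c1" "c1 \<in> pols K"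
      using synthetic_div_correct'[of u c] u pols_synthetic_div[OF K_ring u(1) Suc.prems(3)] by (simp_all add: c1_def X0_def)
    have X0: "poly X0 x = x - u" by (simp add: X0_def)
    define g where "g = poly c1 x * z"
    have gab: "elt a b = (x - u) * g" using Suc.prems(5) unfolding c1(1) by (simp add: g_def X0 mult.assoc)
    have gV: "g \<in> V" if V: "vring K E V" "x \<in> V" for V
    proof -
      interpret V: quad_place K x y h f V by (rule finite_place[OF V])
      show ?thesis unfolding g_def by (intro V.V_intros V.poly_V c1 reg V)
    qed
    have zero: "poly a u + poly b u * v' = 0" if on': "on_E u v'" for v'
    proof -
      interpret Q: quad_point K x y h f "Vp u v'" u v' by (rule Vp[OF on'])
      have "elt a b \<in> Q.P" unfolding gab by (intro Q.P_mult(2) Q.x_P gV Q.V Q.x_V)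
      then show ?thesis using Q.elt_P_iff[OF Suc.prems(1,2)] by (simp add: Q.ev_def)
    qed
    \<comment> \<open>Two distinct points above \<open>u\<close> give two linear conditions on
      \<open>poly a u\<close> and \<open>poly b u\<close>. If there is only one, ramification
      replaces the second: were \<open>poly b u\<close> nonzero, then
      \<open>poly b x * (y - v) = (x - u) * k\<close> would have value 1 on the left and at least 2
      on the right.\<close>
    have bu: "poly b u = 0"
    proof (cases "v = cj u v")
      case False
      have "poly b u * v = poly b u * cj u v"
        using zero[OF on] zero[OF on_E_cj[OF on]] by (metis add_left_cancel)
      then show ?thesis using False by (metis mult_left_cancel)
    next
      case True
      interpret Q: quad_point K x y h f "Vp u v" u v by (rule Vp[OF on])
      have h0: "poly h u + 2 * v = v - cj u v" by simp
      have h0: "poly h u + 2 * v = 0" unfolding h0 using True by (metis right_minus_eq)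
      have e2: "Q.e = 2" "Q.val (y - v) = 1" using Q.ramified[OF h0] nonsing_point[of u v] on h0 by (auto simp: on_E_def)
      show ?thesis
      proof (rule ccontr)
        assume "poly b u \<noteq> 0"
        then have ub: "poly b x \<in> Vp u v - Q.P" by (rule Q.poly_unit[OF Suc.prems(2)])
        then have bn: "poly b x \<in> E" "poly b x \<noteq> 0" using Q.VF Q.P_0 by auto
        define a' where "a' = a + smult v b"
        have a': "a' \<in> pols K" unfolding a'_def using on by (intro K_pols Suc.prems) (simp add: on_E_def)
        have "poly a' u = 0" using zero[OF on] by (simp add: a'_def mult.commute)
        then have a2: "a' = X0 * synthetic_div a' u" using synthetic_div_correct'[of u a'] by (simp add: X0_def)
        define k where "k = g - poly (synthetic_div a' u) x"
        have "synthetic_div a' u \<in> pols K" using pols_synthetic_div[OF K_ring u(1) a'] by blast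
        then have kV: "k \<in> Vp u v" unfolding k_def by (intro Q.V_intros gV Q.V Q.x_V Q.poly_V)
        have "elt a b = poly a' x + poly b x * (y - v)" by (simp add: elt_def a'_def algebra_simps)
        moreover have "poly a' x = (x - u) * poly (synthetic_div a' u) x" by (subst a2) (simp add: X0)
        ultimately have eq: "poly b x * (y - v) = (x - u) * k" unfolding gab by (simp add: k_def algebra_simps)
        have yn: "y - v \<noteq> 0" "y - v \<in> E" using elt_eq_0[of "[:- v:]" 1] K_pols(2,3) sub_ring_intros(5)[OF K_ring] on
            Q.PV[OF Q.y_P] Q.VF by (auto simp: elt_def on_E_def)
        then have "k \<noteq> 0" using eq bn by auto
        then have "Q.val k \<ge> 0" "k \<in> E" using Q.val_nonneg_iff[of k] kV Q.VF by auto
        then show False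
          using arg_cong[OF eq, of Q.val] Q.val_mult[OF bn yn(2,1)] Q.val_mult[OF Q.x_u0(2,1) \<open>k \<in> E\<close> \<open>k \<noteq> 0\<close>]
            Q.val_unit[OF ub] e2 by (simp add: Q.e_def)
      qed
    qed
    then have au: "poly a u = 0" using zero[OF on] by simp
    define a1 b1 where "a1 = synthetic_div a u" and "b1 = synthetic_div b u"
    have ab: "a = X0 * a1" "b = X0 * b1" using au bu synthetic_div_correct'[of u a] synthetic_div_correct'[of u b]
      by (simp_all add: a1_def b1_def X0_def)
    have pol: "a1 \<in> pols K" "b1 \<in> pols K" using pols_synthetic_div[OF K_ring u(1)] Suc.prems by (auto simp: a1_def b1_def)
    have "c1 \<noteq> 0" using c1 Suc.prems by auto
    moreover from this have "n = degree c1" using Suc.hyps(2) unfolding c1(1) by (simp add: X0_def degree_mult_eq del: mult_pCons_left)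
    moreover have "poly X0 x \<noteq> 0" using c1(1) Suc.prems(3,4) poly_x_eq_0 by (metis mult_zero_left poly_mult)
    then have "poly c1 x * z = elt a1 b1"
      using Suc.prems(5) unfolding c1(1) ab elt_scale[symmetric] by (simp add: mult.assoc)
    ultimately show ?case using Suc.hyps(1) pol c1(2) by blast
  qed
  moreover obtain a b c where "a \<in> pols K" "b \<in> pols K" "c \<in> pols K" "c \<noteq> 0" "z = elt a b / poly c x"
    using z unfolding E_iff by blast
  moreover from this have "poly c x * z = elt a b" using poly_x_eq_0 by simp
  ultimately show ?thesis by blast
qed

text \<open>A pole of order at most 2 at \<open>O\<close> excludes a term with \<open>y\<close> and
  leaves degree at most 1 in \<open>x\<close>.\<close>

lemma low_degree:
  assumes z: "z \<in> E" and reg: "\<And>V. vring K E V \<Longrightarrow> x \<in> V \<Longrightarrow> z \<in> V" and pole: "z / x \<in> VO"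
  shows "\<exists>k0\<in>K. \<exists>k1\<in>K. z = k0 + k1 * x"
proof (cases "z = 0")
  case True
  then show ?thesis using sub_ring_zero[OF K_ring] by (intro bexI[of _ 0]) auto
next
  case False
  obtain a b where ab: "a \<in> pols K" "b \<in> pols K" "z = elt a b" using regular_is_polynomial[OF z reg] by blast
  have zx: "z / x \<in> E" "z / x \<noteq> 0" using sub_field_divide[OF E_field z x_E] False x_nz by auto
  have v: "O.val z \<ge> - 2"
    using O.val_nonneg_iff[OF zx] pole O.val_divide[OF z False x_E x_nz] val_O by simp
  then have "b = 0" using val_elt_O[OF ab(1,2)] ab(3) by force
  then have za: "z = poly a x" using ab by (simp add: elt_def)
  then have "a \<noteq> 0" using False by auto
  then have "degree a \<le> 1" using val_poly_O[OF ab(1)] v za by simp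
  then have "a = [:coeff a 0, coeff a 1:]"
    by (intro poly_eqI) (auto simp: coeff_pCons coeff_eq_0 split: nat.split)
  then have "poly a x = poly [:coeff a 0, coeff a 1:] x" by simp
  then have "z = coeff a 0 + coeff a 1 * x" using za by simp
  then show ?thesis using coeff_pols[OF ab(1)] by blast
qed

text \<open>\<open>z * z / x \<in> VO\<close> expresses a pole of order at most 1 as a membership,
  which can be carried along a field embedding. After \<open>low_degree\<close>, a nonzero
  coefficient of \<open>x\<close> would give a pole of order 2.\<close>

lemma regular_is_constant:
  assumes z: "z \<in> E" and reg: "\<And>V. vring K E V \<Longrightarrow> x \<in> V \<Longrightarrow> z \<in> V" and pole: "z * z / x \<in> VO"
  shows "z \<in> K"
proof (cases "z = 0")
  case True
  then show ?thesis using sub_ring_zero[OF K_ring] by auto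
next
  case False
  have zz: "z * z \<in> E" "z * z \<noteq> 0" using False z sub_field_intros(4)[OF E_field] by auto
  have "z * z / x \<in> E" "z * z / x \<noteq> 0" using sub_field_divide[OF E_field zz(1) x_E] False x_nz by auto
  then have v: "2 * O.val z \<ge> - 2"
    using O.val_nonneg_iff[of "z * z / x"] pole O.val_divide[OF zz x_E x_nz] O.val_mult[OF z False z False] val_O by simp
  have zx: "z / x \<in> E" "z / x \<noteq> 0" using sub_field_divide[OF E_field z x_E] False x_nz by auto
  then have "z / x \<in> VO" using O.val_nonneg_iff[OF zx] v O.val_divide[OF z False x_E x_nz] val_O by simp
  then obtain k0 k1 where k: "k0 \<in> K" "k1 \<in> K" "z = k0 + k1 * x" using low_degree[OF z reg] by blast
  have "k1 = 0"
  proof (rule ccontr)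
    assume "k1 \<noteq> 0"
    then have "degree [:k0, k1:] = 1" "[:k0, k1:] \<noteq> 0" by auto
    then have "O.val (poly [:k0, k1:] x) = - 2" using val_poly_O[of "[:k0, k1:]"] k K_pols(3,4) by simp
    moreover have "poly [:k0, k1:] x = z" using k(3) by (simp add: mult.commute)
    ultimately show False using v by simp
  qed
  then show ?thesis using k by simp
qed

end

section \<open>Extension of the constants\<close>

locale field_hom =
  fixes \<phi> :: "'a::field \<Rightarrow> 'b::field"
  assumes hom_one [simp]: "\<phi> 1 = 1" and hom_add [simp]: "\<phi> (a + b) = \<phi> a + \<phi> b"
    and hom_mult [simp]: "\<phi> (a * b) = \<phi> a * \<phi> b"
begin

lemma hom_zero [simp]: "\<phi> 0 = 0"
  using hom_add[of 0 0] by (metis add.right_neutral add_left_cancel)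

lemma hom_uminus [simp]: "\<phi> (- a) = - \<phi> a"
  using hom_add[of "- a" a] by (simp add: eq_neg_iff_add_eq_0 del: hom_add)

lemma hom_diff [simp]: "\<phi> (a - b) = \<phi> a - \<phi> b"
  using hom_add[of a "- b"] by simp

lemma hom_eq_0 [simp]: "\<phi> a = 0 \<longleftrightarrow> a = 0"
proof
  assume "\<phi> a = 0"
  then have "\<phi> (a * inverse a) = 0" by (simp del: right_inverse)
  then show "a = 0" by (cases "a = 0") auto
qed simp

lemma hom_eq [simp]: "\<phi> a = \<phi> b \<longleftrightarrow> a = b"
  using hom_eq_0[of "a - b"] by (simp del: hom_eq_0)

lemma hom_inverse [simp]: "\<phi> (inverse a) = inverse (\<phi> a)"
proof (cases "a = 0")
  case False
  then have "\<phi> a * \<phi> (inverse a) = 1" by (simp flip: hom_mult)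
  then show ?thesis by (metis inverse_unique)
qed simp

lemma hom_divide [simp]: "\<phi> (a / b) = \<phi> a / \<phi> b"
  by (simp add: divide_inverse)

lemma hom_power [simp]: "\<phi> (a ^ n) = \<phi> a ^ n"
  by (induction n) auto

lemma hom_numeral [simp]: "\<phi> (numeral n) = numeral n"
proof -
  have "\<phi> (of_nat m) = of_nat m" for m by (induction m) auto
  from this[of "numeral n"] show ?thesis by simp
qed

lemma hom_poly: "\<phi> (poly p a) = poly (map_poly \<phi> p) (\<phi> a)"
  by (induction p) (auto simp: map_poly_pCons)

lemma map_poly_eq_0: "map_poly \<phi> p = 0 \<longleftrightarrow> p = 0"
  by (rule map_poly_eq_0_iff) auto

lemma map_poly_pols: "\<phi> ` K \<subseteq> L \<Longrightarrow> p \<in> pols K \<Longrightarrow> map_poly \<phi> p \<in> pols L"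
  by (auto simp: pols_def coeff_map_poly)

end

text \<open>Two instances matter: the embedding into the constant field extension, and the identity of an
  algebraically closed constant field, so that the uniqueness of the sum of two places is proved for
  both fields at once.\<close>

locale ell_pair = field_hom \<phi> + A: ell K x y a1 a2 a3 a4 a6 + B: ell_closed K' x' y' b1 b2 b3 b4 b6
  for \<phi> :: "'a::field \<Rightarrow> 'b::field" and K :: "'a set" and x y a1 a2 a3 a4 a6
    and K' :: "'b set" and x' y' b1 b2 b3 b4 b6 +
  assumes \<phi>K: "\<phi> ` K \<subseteq> K'" and \<phi>x: "\<phi> x = x'" and \<phi>y: "\<phi> y = y'"
    and \<phi>a: "\<phi> a1 = b1" "\<phi> a2 = b2" "\<phi> a3 = b3" "\<phi> a4 = b4" "\<phi> a6 = b6"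
    and algebraic: "u \<in> K' \<Longrightarrow> \<exists>p\<in>pols K. p \<noteq> 0 \<and> poly (map_poly \<phi> p) u = 0"
begin

lemma \<phi>E: "z \<in> A.E \<Longrightarrow> \<phi> z \<in> B.E"
proof -
  assume "z \<in> A.E"
  then obtain a b c where z: "a \<in> pols K" "b \<in> pols K" "c \<in> pols K" "c \<noteq> 0" "z = A.elt a b / poly c x"
    unfolding A.E_iff by blast
  have "\<phi> z = B.elt (map_poly \<phi> a) (map_poly \<phi> b) / poly (map_poly \<phi> c) x'"
    unfolding z(5) A.elt_def B.elt_def by (simp add: hom_poly \<phi>x \<phi>y)
  then show ?thesis using z map_poly_pols[OF \<phi>K] map_poly_eq_0 by (auto intro!: B.E_I)
qed

text \<open>What needs proof is that \<open>V\<close> does not contain the whole small field. If it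
  did, \<open>x' - u\<close> would lie in its maximal ideal for some constant \<open>u\<close>, and
  a polynomial over \<open>K\<close> with root \<open>u\<close> would give a nonzero element of the
  small field in that ideal, although its inverse lies in \<open>V\<close> too.\<close>

lemma restrict:
  assumes V: "vring K' B.E V"
  shows "vring K A.E {z \<in> A.E. \<phi> z \<in> V}" "nonunits {z \<in> A.E. \<phi> z \<in> V} = {z \<in> A.E. \<phi> z \<in> nonunits V}"
proof -
  interpret V: vring_ctx K' B.E V by unfold_locales (use B.E_field V in auto)
  have "{z \<in> A.E. \<phi> z \<in> V} \<noteq> A.E"
  proof
    assume "{z \<in> A.E. \<phi> z \<in> V} = A.E"
    then have all: "\<phi> z \<in> V" if "z \<in> A.E" for z using that by blast
    have x': "x' \<in> V" using all[OF A.x_E] by (simp add: \<phi>x)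
    interpret Q: quad_place K' x' y' B.h B.f V by (rule B.finite_place[OF V x'])
    obtain p where p: "Q.minpol p" using Q.minpol_exists by blast
    then have pp: "p \<in> pols K'" "p \<noteq> 0" "poly p x' \<in> V.P" by (auto simp: Q.minpol_def)
    have "degree p > 0"
    proof (rule ccontr)
      assume "\<not> degree p > 0"
      then obtain c where c: "p = [:c:]" by (metis degree_eq_zeroE not_gr_zero)
      then have "c \<in> K'" "c \<noteq> 0" "c \<in> V.P" using pp coeff_pols[of p K' 0] by auto
      then show False using V.KV sub_field_inverse[OF B.K_field, of c] by (auto simp: nonunits_def)
    qed
    then obtain u where u: "u \<in> K'" "poly p u = 0" using B.root pp by blast
    define q where "q = synthetic_div p u"
    have q: "p = [:- u, 1:] * q" "q \<in> pols K'"
      using synthetic_div_correct'[of u p] u pols_synthetic_div[OF B.K_ring u(1) pp(1)] by (simp_all add: q_def)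
    have "q \<noteq> 0" using q pp by auto
    then have "degree q < degree p" unfolding q(1) by (simp add: degree_mult_eq del: mult_pCons_left)
    \<comment> \<open>By minimality of \<open>p\<close> the cofactor stays outside the maximal
      ideal, so the linear factor must be inside.\<close>
    then have "poly q x' \<notin> V.P" using p q(2) \<open>q \<noteq> 0\<close> unfolding Q.minpol_def by (meson not_le)
    moreover have "(x' - u) * poly q x' \<in> V.P" using pp(3) unfolding q(1) by (simp add: algebra_simps)
    moreover have xu: "x' - u \<in> V" using x' u V.KV V.V_intros(3) by blast
    ultimately have xuP: "x' - u \<in> V.P" using V.P_prime[OF xu Q.poly_V[OF q(2)]] by blast
    obtain g where g: "g \<in> pols K" "g \<noteq> 0" "poly (map_poly \<phi> g) u = 0" using algebraic[OF u(1)] by blast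
    define g1 where "g1 = synthetic_div (map_poly \<phi> g) u"
    have g1: "map_poly \<phi> g = [:- u, 1:] * g1" "g1 \<in> pols K'"
      using synthetic_div_correct'[of u "map_poly \<phi> g"] g pols_synthetic_div[OF B.K_ring u(1) map_poly_pols[OF \<phi>K g(1)]]
      by (simp_all add: g1_def)
    have "\<phi> (poly g x) = (x' - u) * poly g1 x'" unfolding hom_poly \<phi>x g1(1) by (simp add: algebra_simps)
    then have "\<phi> (poly g x) \<in> V.P" using V.P_mult(2)[OF xuP Q.poly_V[OF g1(2)]] by simp
    moreover have gE: "poly g x \<in> A.E" using A.elt_E[OF g(1) A.K_pols(1)] by (simp add: A.elt_def)
    moreover have "poly g x \<noteq> 0" using A.poly_x_eq_0 g by simp
    ultimately show False using all[OF sub_field_inverse[OF A.E_field gE]] by (auto simp: nonunits_def)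
  qed
  moreover have "\<phi> z \<in> V \<or> inverse (\<phi> z) \<in> V" if "z \<in> A.E" for z
    using V.V_total[OF \<phi>E[OF that]] .
  ultimately show "vring K A.E {z \<in> A.E. \<phi> z \<in> V}"
    using \<phi>K V.KV A.K_E A.E_field
    by (auto simp: vring_def sub_ring_def intro: sub_field_intros V.V_intros)
  show "nonunits {z \<in> A.E. \<phi> z \<in> V} = {z \<in> A.E. \<phi> z \<in> nonunits V}"
    using sub_field_inverse[OF A.E_field] by (auto simp: nonunits_def)
qed

definition "lift = map_option (map_prod \<phi> \<phi>)"

lemma lift_simps [simp]: "lift None = None" "lift (Some (u, v)) = Some (\<phi> u, \<phi> v)"
  by (simp_all add: lift_def)

lemma on_E_lift: "A.on_E u v \<Longrightarrow> B.on_E (\<phi> u) (\<phi> v)"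
proof -
  assume on: "A.on_E u v"
  then have "\<phi> (v\<^sup>2 + poly A.h u * v) = \<phi> (poly A.f u)" by (simp add: A.on_E_def)
  then show ?thesis using on \<phi>K unfolding B.on_E_def A.on_E_def by (auto simp: \<phi>a hom_poly map_poly_pCons)
qed

lemma lift_pts: "p \<in> A.pts \<Longrightarrow> lift p \<in> B.pts"
  using on_E_lift by (auto simp: A.pts_def B.pts_def)

text \<open>\<open>chord\<close> consists of polynomial identities between coordinates with
  coefficients in \<open>K\<close>, and \<open>\<phi>\<close> preserves these. This is what makes
  addition of points commute with extension of the constants.\<close>

lemma lift_chord:
  assumes "chord K a1 a2 a3 a4 a6 p q s"
  shows "chord K' b1 b2 b3 b4 b6 (lift p) (lift q) (lift s)"
  using assms unfolding chord_def[of K]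
proof (elim disjE bexE exE conjE)
  fix l m u1 u2 u3
  assume *: "l \<in> K" "m \<in> K" "p = Some (u1, l * u1 + m)" "q = Some (u2, l * u2 + m)"
    "s = Some (u3, - (l * u3 + m) - a1 * u3 - a3)" "l\<^sup>2 + a1 * l - a2 = u1 + u2 + u3"
    "2 * l * m + a1 * m + a3 * l - a4 = - (u1 * u2 + u1 * u3 + u2 * u3)" "m\<^sup>2 + a3 * m - a6 = u1 * u2 * u3"
  have lm: "\<phi> l \<in> K'" "\<phi> m \<in> K'" using * \<phi>K by auto
  show ?thesis unfolding chord_def
  proof (intro disjI2, rule bexI[OF _ lm(1)], rule bexI[OF _ lm(2)],
      rule exI[of _ "\<phi> u1"], rule exI[of _ "\<phi> u2"], rule exI[of _ "\<phi> u3"], intro conjI)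
    show "(\<phi> l)\<^sup>2 + b1 * \<phi> l - b2 = \<phi> u1 + \<phi> u2 + \<phi> u3"
      using arg_cong[OF *(6), of \<phi>] by (simp add: \<phi>a)
    show "2 * \<phi> l * \<phi> m + b1 * \<phi> m + b3 * \<phi> l - b4 = - (\<phi> u1 * \<phi> u2 + \<phi> u1 * \<phi> u3 + \<phi> u2 * \<phi> u3)"
      using arg_cong[OF *(7), of \<phi>] by (simp add: \<phi>a)
    show "(\<phi> m)\<^sup>2 + b3 * \<phi> m - b6 = \<phi> u1 * \<phi> u2 * \<phi> u3"
      using arg_cong[OF *(8), of \<phi>] by (simp add: \<phi>a)
  qed (simp_all add: * \<phi>a)
qed (auto simp: chord_def \<phi>a)

text \<open>The restricted place is centred at the same point, and a place centred at a point of the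
  curve is determined by it.\<close>

lemma restrict_pl: assumes p: "p \<in> A.pts" shows "{z \<in> A.E. \<phi> z \<in> B.pl (lift p)} = A.pl p"
proof (cases p)
  case None
  have "x \<notin> {z \<in> A.E. \<phi> z \<in> B.VO}" using B.x_VO by (simp add: \<phi>x)
  then show ?thesis using restrict[OF B.vring_O] A.pl_O_iff None by auto
next
  case (Some q)
  then obtain u v where q: "p = Some (u, v)" "A.on_E u v" using p by (auto simp: A.pts_def)
  note on = on_E_lift[OF q(2)]
  let ?V = "B.Vp (\<phi> u) (\<phi> v)"
  note r = restrict[OF B.vring_Vp[OF on]]
  have uv: "u \<in> A.E" "v \<in> A.E" using q(2) A.K_E by (auto simp: A.on_E_def)
  have "x \<in> {z \<in> A.E. \<phi> z \<in> ?V}" using B.x_Vp[OF on] A.x_E by (simp add: \<phi>x)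
  moreover have "x - u \<in> A.E" "y - v \<in> A.E" using uv A.x_E A.y_E sub_field_intros(3)[OF A.E_field] by auto
  then have "x - u \<in> nonunits {z \<in> A.E. \<phi> z \<in> ?V}" "y - v \<in> nonunits {z \<in> A.E. \<phi> z \<in> ?V}"
    unfolding r(2) using B.on_E_x_P[OF on] by (simp_all add: \<phi>x \<phi>y)
  ultimately have "nonunits {z \<in> A.E. \<phi> z \<in> ?V} = A.pl p"
    unfolding q(1) using A.pl_Some_iff[OF r(1) q(2)] by blast
  then show ?thesis using r(2) q by simp
qed

text \<open>A pole at a finite point is moved to \<open>O\<close> by a factor \<open>x - u\<close>.
  In the large field, which supplies the roots of denominators that \<open>low_degree\<close> relies
  on, the function is then constant or linear in \<open>x'\<close>, and its zeros decide.\<close>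

lemma no_function_with_one_pole:
  assumes p: "p \<in> A.pts" and q: "q \<in> A.pts" and z: "z \<in> A.E" "z \<noteq> 0"
    and val: "\<And>V. vring K A.E V \<Longrightarrow> place_val A.E (nonunits V) z =
      (if A.pl p = nonunits V then 1 else 0) - (if A.pl q = nonunits V then 1 else 0)"
  shows "p = q"
proof -
  have reg: "\<phi> g \<in> V" if g: "g \<in> A.E" and gV: "\<And>V. vring K A.E V \<Longrightarrow> x \<in> V \<Longrightarrow> g \<in> V"
    and V: "vring K' B.E V" "x' \<in> V" for g V
    using gV[OF restrict(1)[OF V(1)]] V(2) A.x_E by (simp add: \<phi>x)
  have VO: "\<phi> g \<in> B.VO" if "g \<in> A.VO" for g
  proof -
    have "x \<notin> {z \<in> A.E. \<phi> z \<in> B.VO}" using B.x_VO by (simp add: \<phi>x)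
    then have "{z \<in> A.E. \<phi> z \<in> B.VO} = A.VO" using A.infinite_vring[OF restrict(1)[OF B.vring_O]] by blast
    then show ?thesis using that by blast
  qed
  have const: "\<phi> g \<in> K'" if g: "g \<in> A.E" "g \<noteq> 0" "\<And>V. vring K A.E V \<Longrightarrow> x \<in> V \<Longrightarrow> g \<in> V" "A.O.val g = - 1" for g
  proof (rule B.regular_is_constant[OF \<phi>E[OF g(1)]])
    have gg: "g * g \<in> A.E" "g * g \<noteq> 0" using g sub_field_intros(4)[OF A.E_field] by auto
    then have "g * g / x \<in> A.E" "g * g / x \<noteq> 0" using sub_field_divide[OF A.E_field gg(1) A.x_E] A.x_nz by auto
    then have "g * g / x \<in> A.VO"
      using A.O.val_nonneg_iff[of "g * g / x"] A.O.val_divide[OF gg A.x_E A.x_nz] A.O.val_mult[OF g(1,2) g(1,2)] A.val_O g(4) by simp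
    from VO[OF this] show "\<phi> g * \<phi> g / x' \<in> B.VO" by (simp add: \<phi>x)
  qed (rule reg[OF g(1,3)])
  \<comment> \<open>Nonzero constants are units at every place, so a function that becomes constant
    upstairs and has a zero is 0.\<close>
  have K0: "g = 0" if g: "\<phi> g \<in> K'" "g \<in> A.pl t" "t \<in> A.pts" for g t
  proof -
    have "\<phi> g \<in> B.pl (lift t)" using restrict_pl[OF g(3)] g(2) by blast
    moreover obtain V where V: "vring K' B.E V" "B.pl (lift t) = nonunits V"
      using B.pl_place[OF lift_pts[OF g(3)]] unfolding B.places_E by blast
    moreover have "K' \<subseteq> V" using V(1) by (simp add: vring_def)
    ultimately show ?thesis using sub_field_inverse[OF B.K_field g(1)] g(1) hom_eq_0[of g]
      by (auto simp: nonunits_def)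
  qed
  have mem: "z \<in> V \<longleftrightarrow> place_val A.E (nonunits V) z \<ge> 0" "z \<in> nonunits V \<longleftrightarrow> place_val A.E (nonunits V) z > 0"
    if "vring K A.E V" "z \<in> A.E" "z \<noteq> 0" for V z
    using dvr_ctx.val_nonneg_iff[OF A.vring_dvr[OF that(1)] that(2,3)]
      dvr_ctx.val_pos_iff[OF A.vring_dvr[OF that(1)] that(2,3)] by auto
  have pl_ne: "A.pl None \<noteq> A.pl (Some (u, v))" if "A.on_E u v" for u v
    using A.pl_inj[of None "Some (u, v)"] that by (auto simp: A.pts_def)
  show ?thesis
  proof (cases q)
    case None
    show ?thesis
    proof (cases p)
      case (Some p')
      then obtain u v where pu: "p = Some (u, v)" "A.on_E u v" using p by (auto simp: A.pts_def)
      have "z \<in> V" if V: "vring K A.E V" "x \<in> V" for V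
        using mem(1)[OF V(1) z] val[OF V(1)] A.pl_O_iff[OF V(1)] V(2) None by auto
      moreover have "A.O.val z = - 1" using val[OF A.vring_O] None pu pl_ne[OF pu(2)] by auto
      ultimately have "\<phi> z \<in> K'" using const z by blast
      moreover have "z \<in> A.pl p"
        using mem(2)[OF A.vring_Vp[OF pu(2)] z] val[OF A.vring_Vp[OF pu(2)]] pu None pl_ne[OF pu(2)] by auto
      ultimately show ?thesis using K0 p z by blast
    qed (use None in simp)
  next
    case (Some q')
    then obtain u v where qu: "q = Some (u, v)" "A.on_E u v" using q by (auto simp: A.pts_def)
    define c where "c = Some (u, A.cj u v)"
    have cp: "A.on_E u (A.cj u v)" "c \<in> A.pts" using A.on_E_cj[OF qu(2)] by (auto simp: A.pts_def c_def)
    have uK: "u \<in> K" using qu by (auto simp: A.on_E_def)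
    have xu: "x - u \<in> A.E" "x - u \<noteq> 0" using A.x_E A.K_E uK sub_field_intros(3)[OF A.E_field]
        A.poly_x_eq_0[of "[:- u, 1:]"] A.K_pols(1,4) sub_ring_intros[OF A.K_ring] by auto
    \<comment> \<open>Writing \<open>c\<close> for the conjugate of \<open>q\<close>, the divisor of
      \<open>g\<close> is \<open>p + c - 2 O\<close>: the pole at \<open>q\<close> has been
      cancelled.\<close>
    define g where "g = z * (x - u)"
    have g: "g \<in> A.E" "g \<noteq> 0" unfolding g_def using z xu sub_field_intros(4)[OF A.E_field] by auto
    have vg: "place_val A.E (nonunits V) g = (if A.pl p = nonunits V then 1 else 0) +
        (if A.pl c = nonunits V then 1 else 0) - (if x \<in> V then 0 else 2)" if V: "vring K A.E V" for V
      unfolding g_def dvr_ctx.val_mult[OF A.vring_dvr[OF V] z xu] val[OF V] A.val_x[OF V qu(2)] c_def qu(1)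
      by (auto simp: eq_commute[of "nonunits V"])
    have greg: "g \<in> V" if V: "vring K A.E V" "x \<in> V" for V
      using mem(1)[OF V(1) g] vg[OF V(1)] V(2) by auto
    have cO: "A.pl c \<noteq> A.pl None" using pl_ne[OF cp(1)] by (auto simp: c_def)
    have in_pl: "g \<in> A.pl t" if t: "t \<in> A.pts" "t = p \<or> t = c" "t \<noteq> None" for t
    proof -
      obtain a b where t': "t = Some (a, b)" "A.on_E a b" using t by (auto simp: A.pts_def)
      note Vt = A.vring_Vp[OF t'(2)]
      have "place_val A.E (nonunits (A.Vp a b)) g > 0" unfolding vg[OF Vt] using A.x_Vp[OF t'(2)] t(2) t' by auto
      then show ?thesis using mem(2)[OF Vt g] t'(1) by simp
    qed
    have gc: "g \<in> A.pl c" using in_pl[OF cp(2)] by (simp add: c_def)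
    show ?thesis
    proof (cases p)
      case None
      then have "A.O.val g = - 1" using vg[OF A.vring_O] A.x_VO cO by auto
      then have "\<phi> g \<in> K'" using const g greg by blast
      then show ?thesis using K0[OF _ gc cp(2)] g by blast
    next
      case (Some p')
      then obtain u' v' where pu: "p = Some (u', v')" "A.on_E u' v'" using p by (auto simp: A.pts_def)
      have gp: "g \<in> A.pl p" using in_pl[OF p] pu by simp
      have "g / x \<in> A.E" "g / x \<noteq> 0" using sub_field_divide[OF A.E_field g(1) A.x_E] g A.x_nz by auto
      moreover have "A.O.val g = - 2" using vg[OF A.vring_O] A.x_VO cO pl_ne[OF pu(2)] pu(1) by auto
      ultimately have "g / x \<in> A.VO"
        using A.O.val_nonneg_iff[of "g / x"] A.O.val_divide[OF g A.x_E A.x_nz] A.val_O by simp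
      from VO[OF this] have "\<phi> g / x' \<in> B.VO" by (simp add: \<phi>x)
      then obtain k0 k1 where k: "k0 \<in> K'" "k1 \<in> K'" "\<phi> g = k0 + k1 * x'"
        using B.low_degree[OF \<phi>E[OF g(1)] reg[OF g(1) greg]] by blast
      \<comment> \<open>The function \<open>k0 + k1 * x'\<close> depends on the abscissa alone. It
        vanishes at \<open>c\<close>, hence also at \<open>q\<close>; since \<open>g\<close> has no
        zeros besides \<open>p\<close> and \<open>c\<close>, one of these is
        \<open>q\<close>.\<close>
      have ev: "k0 + k1 * \<phi> a = 0 \<longleftrightarrow> g \<in> A.pl (Some (a, b))" if ab: "A.on_E a b" for a b
      proof -
        note on = on_E_lift[OF ab]
        interpret Q: quad_point K' x' y' B.h B.f "B.Vp (\<phi> a) (\<phi> b)" "\<phi> a" "\<phi> b" by (rule B.Vp[OF on])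
        have pol: "[:k0, k1:] \<in> pols K'" by (intro B.K_pols k)
        have "g \<in> A.pl (Some (a, b)) \<longleftrightarrow> \<phi> g \<in> Q.P"
          using restrict_pl[of "Some (a, b)"] ab g(1) by (auto simp: A.pts_def)
        also have "\<dots> \<longleftrightarrow> poly [:k0, k1:] x' \<in> Q.P" unfolding k(3) by (simp add: mult.commute)
        also have "\<dots> \<longleftrightarrow> k0 + k1 * \<phi> a = 0" unfolding Q.poly_P_iff[OF pol] by (simp add: mult.commute)
        finally show ?thesis by blast
      qed
      have e1: "k0 + k1 * \<phi> u = 0" using ev[OF cp(1)] gc by (simp add: c_def)
      have e2: "k0 + k1 * \<phi> u' = 0" using ev[OF pu(2)] gp pu(1) by simp
      have "k1 \<noteq> 0"
      proof
        assume "k1 = 0"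
        then have "\<phi> g = 0" using e1 k(3) by simp
        then show False using g by simp
      qed
      then have "u' = u" using e1 e2 by (metis add_left_cancel hom_eq mult_left_cancel)
      have gq: "g \<in> A.pl q" using ev[OF qu(2)] e1 qu(1) by simp
      have "place_val A.E (nonunits (A.Vp u v)) g > 0"
        using mem(2)[OF A.vring_Vp[OF qu(2)] g] gq qu(1) by simp
      then have "A.pl p = A.pl q \<or> A.pl c = A.pl q"
        unfolding vg[OF A.vring_Vp[OF qu(2)]] using A.x_Vp[OF qu(2)] qu(1) by (auto split: if_splits)
      then have "p = q \<or> c = q" using A.pl_inj p q cp(2) by blast
      \<comment> \<open>If \<open>q\<close> is its own conjugate, it is the only point above
        \<open>u\<close>, and \<open>p\<close> lies above \<open>u\<close> as well.\<close>
      moreover have "p = q" if "c = q"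
      proof -
        have vc: "v = A.cj u v" using that qu(1) by (simp add: c_def)
        have "A.on_E u v'" using pu(2) \<open>u' = u\<close> by simp
        then have "(v' - v) * (v' - A.cj u v) = 0"
          using qu(2) by (simp add: A.on_E_def algebra_simps power2_eq_square)
        then have "v' = v" using vc by (metis mult_eq_0_iff right_minus_eq)
        then show ?thesis using pu qu \<open>u' = u\<close> by simp
      qed
      ultimately show ?thesis by blast
    qed
  qed
qed

end

section \<open>The algebraic closure of a finite field of constants\<close>

lemma finite_bounded_pols:
  assumes "finite S" "0 \<in> S" shows "finite {q \<in> pols S. degree q < n}"
proof (rule finite_subset)
  show "finite (Poly ` {xs. set xs \<subseteq> S \<and> length xs = n})"
    using finite_lists_length_eq[OF assms(1)] by auto
  show "{q \<in> pols S. degree q < n} \<subseteq> Poly ` {xs. set xs \<subseteq> S \<and> length xs = n}"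
  proof
    fix q assume "q \<in> {q \<in> pols S. degree q < n}"
    then have q: "q \<in> pols S" "degree q < n" by auto
    have "q = Poly (map (coeff q) [0..<n])"
      using q(2) by (intro poly_eqI) (auto simp: nth_default_def coeff_eq_0)
    moreover have "set (map (coeff q) [0..<n]) \<subseteq> S" using q(1) by (auto simp: pols_def)
    ultimately show "q \<in> Poly ` {xs. set xs \<subseteq> S \<and> length xs = n}"
      by (intro image_eqI[of _ _ "map (coeff q) [0..<n]"]) auto
  qed
qed

text \<open>Reduction modulo \<open>p\<close> shows that \<open>S[z]\<close> consists of values of
  polynomials of bounded degree, and over a finite \<open>S\<close> there are finitely many of
  these.\<close>

lemma finite_adjoin:
  assumes S: "sub_field S" "finite S" and p: "p \<in> pols S" "p \<noteq> 0" "poly p z = 0"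
  shows "finite ((\<lambda>q. poly q z) ` pols S)"
proof (rule finite_subset)
  have "0 \<in> S" using sub_field_intros(2)[OF S(1)] .
  then show "finite ((\<lambda>q. poly q z) ` {q \<in> pols S. degree q < Suc (degree p)})"
    using finite_bounded_pols[OF S(2)] by blast
  show "(\<lambda>q. poly q z) ` pols S \<subseteq> (\<lambda>q. poly q z) ` {q \<in> pols S. degree q < Suc (degree p)}"
  proof safe
    fix q assume "q \<in> pols S"
    then obtain d r where dr: "r \<in> pols S" "q = p * d + r" "r = 0 \<or> degree r < degree p"
      using pols_division[OF S(1) p(1,2)] by blast
    then show "poly q z \<in> (\<lambda>q. poly q z) ` {q \<in> pols S. degree q < Suc (degree p)}"
      using p(3) by (intro image_eqI[of _ _ r]) auto
  qed
qed

lemma finite_power_eq: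
  assumes "sub_ring S" "finite S" "z \<in> S" shows "\<exists>i j. i < j \<and> z ^ i = (z ^ j :: 'a::field)"
proof -
  have "range (\<lambda>n::nat. z ^ n) \<subseteq> S" using assms sub_ring_power by auto
  then have "\<not> inj (\<lambda>n::nat. z ^ n)" using assms(2) finite_imageD finite_subset infinite_UNIV_nat by blast
  then obtain i j where "i \<noteq> j" "z ^ i = z ^ j" unfolding inj_def by blast
  then show ?thesis by (metis linorder_neqE_nat)
qed

text \<open>Two powers of \<open>z\<close> coincide; cancelling the smaller one exhibits a power of
  \<open>z\<close> as its inverse.\<close>

lemma finite_sub_ring_field:
  assumes "sub_ring S" "finite S" shows "sub_field (S :: 'a::field set)"
proof -
  have "inverse z \<in> S" if z: "z \<in> S" for z
  proof (cases "z = 0")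
    case False
    obtain i j where ij: "i < j" "z ^ i = z ^ j" using finite_power_eq[OF assms z] by blast
    then have "z ^ j = z ^ (i + Suc (j - i - 1))" by simp
    then have "z ^ j = z ^ i * (z * z ^ (j - i - 1))" unfolding power_add power_Suc .
    then have "z * z ^ (j - i - 1) = 1" using ij(2) False by simp
    then have "inverse z = z ^ (j - i - 1)" by (rule inverse_unique)
    then show ?thesis using sub_ring_power[OF assms(1) z] by simp
  qed (use z in simp)
  then show ?thesis using assms(1) by (simp add: sub_field_def)
qed

lemma field_hom_to_ac: "field_hom to_ac"
  by unfold_locales auto

interpretation to_ac: field_hom to_ac by (rule field_hom_to_ac)

locale finite_base =
  fixes K :: "'a::field set"
  assumes K_fin: "finite K" and K_fld: "sub_field K"
begin

abbreviation "K0 \<equiv> to_ac ` K"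
abbreviation "K' \<equiv> constants_closure K"

lemma K0: "sub_field K0"
  unfolding sub_field_def sub_ring_def
proof (intro conjI ballI)
  show "1 \<in> K0" using sub_field_intros(1)[OF K_fld] by (intro image_eqI[of _ _ 1]) auto
  fix a assume "a \<in> K0"
  then obtain a' where a': "a = to_ac a'" "a' \<in> K" by blast
  then show "inverse a \<in> K0" using sub_field_inverse[OF K_fld] by (intro image_eqI[of _ _ "inverse a'"]) auto
  fix b assume "b \<in> K0"
  then obtain b' where b': "b = to_ac b'" "b' \<in> K" by blast
  show "a - b \<in> K0" using a' b' sub_field_intros(3)[OF K_fld] by (intro image_eqI[of _ _ "a' - b'"]) auto
  show "a * b \<in> K0" using a' b' sub_field_intros(4)[OF K_fld] by (intro image_eqI[of _ _ "a' * b'"]) auto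
qed

lemma K0_fin: "finite K0" using K_fin by simp

lemma pols_K0: "pols K0 = map_poly to_ac ` pols K"
proof
  show "map_poly to_ac ` pols K \<subseteq> pols K0" using to_ac.map_poly_pols by blast
  show "pols K0 \<subseteq> map_poly to_ac ` pols K"
  proof
    fix p assume p: "p \<in> pols K0"
    define g where "g = inv_into K to_ac"
    have g: "to_ac (g c) = c" "g c \<in> K" if "c \<in> K0" for c
      using that by (auto simp: g_def f_inv_into_f inv_into_into)
    have "g 0 = 0" using g(1)[of 0] sub_field_intros(2)[OF K0] by simp
    then have "coeff (map_poly g p) n = g (coeff p n)" for n by (rule coeff_map_poly)
    then have "p = map_poly to_ac (map_poly g p)" "map_poly g p \<in> pols K"
      using p g by (auto simp: pols_def poly_eq_iff coeff_map_poly)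
    then show "p \<in> map_poly to_ac ` pols K" by blast
  qed
qed

lemma K'_iff_root: "z \<in> K' \<longleftrightarrow> (\<exists>p\<in>pols K0. p \<noteq> 0 \<and> poly p z = 0)"
  unfolding constants_closure_def using transcendental_iff[OF sub_field_ring[OF K0], of z] by auto

text \<open>Since \<open>K\<close> is finite, its algebraic closure is the union of the finite rings containing it.\<close>

lemma K'_iff: "z \<in> K' \<longleftrightarrow> (\<exists>S. finite S \<and> sub_ring S \<and> K0 \<subseteq> S \<and> z \<in> S)"
proof
  assume "z \<in> K'"
  then obtain p where p: "p \<in> pols K0" "p \<noteq> 0" "poly p z = 0" unfolding K'_iff_root by blast
  show "\<exists>S. finite S \<and> sub_ring S \<and> K0 \<subseteq> S \<and> z \<in> S"
    using finite_adjoin[OF K0 K0_fin p] sub_ring_adjoin[OF sub_field_ring[OF K0], of z]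
      adjoin_incl[OF sub_field_ring[OF K0], of z] adjoin_self[OF sub_field_ring[OF K0], of z] by blast
next
  assume "\<exists>S. finite S \<and> sub_ring S \<and> K0 \<subseteq> S \<and> z \<in> S"
  then obtain S where S: "finite S" "sub_ring S" "z \<in> S" by blast
  obtain i j where ij: "i < j" "z ^ i = z ^ j" using finite_power_eq[OF S(2,1,3)] by blast
  have "monom 1 j - monom 1 i \<in> pols K0"
    using pols_diff[OF sub_field_ring[OF K0]] pols_monom[OF sub_field_ring[OF K0]] sub_field_intros(1)[OF K0] by blast
  moreover have "coeff (monom 1 j - monom 1 i :: 'a alg_closure poly) j = 1" using ij by simp
  then have "monom 1 j - monom 1 i \<noteq> (0 :: 'a alg_closure poly)" by (metis coeff_0 zero_neq_one)
  moreover have "poly (monom 1 j - monom 1 i) z = 0" using ij by (simp add: poly_monom)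
  ultimately show "z \<in> K'" unfolding K'_iff_root by blast
qed

lemma K0_K': "K0 \<subseteq> K'"
  using K'_iff K0_fin sub_field_ring[OF K0] by blast

lemma adjoin_K':
  assumes S: "finite S" "sub_ring S" "K0 \<subseteq> S" and p: "p \<in> pols S" "p \<noteq> 0" "poly p z = 0"
  shows "\<exists>T. finite T \<and> sub_ring T \<and> S \<subseteq> T \<and> z \<in> T"
  using finite_adjoin[OF finite_sub_ring_field[OF S(2,1)] S(1) p] sub_ring_adjoin[OF S(2), of z]
    adjoin_incl[OF S(2), of z] adjoin_self[OF S(2), of z] by blast

text \<open>Adjoining the elements one at a time keeps the ring finite. This replaces degree
  arguments for towers of extensions: differences, products, inverses and roots of polynomials over
  \<open>K'\<close> can all be handled inside finite rings.\<close>

lemma finite_subset_K':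
  assumes "finite A" "A \<subseteq> K'" shows "\<exists>S. finite S \<and> sub_ring S \<and> K0 \<subseteq> S \<and> A \<subseteq> S"
  using assms
proof (induction A)
  case empty
  then show ?case using K0_fin sub_field_ring[OF K0] by blast
next
  case (insert z A)
  then obtain S where S: "finite S" "sub_ring S" "K0 \<subseteq> S" "A \<subseteq> S" by blast
  have "z \<in> K'" using insert.prems by simp
  then obtain p where p: "p \<in> pols K0" "p \<noteq> 0" "poly p z = 0" unfolding K'_iff_root by blast
  then have "p \<in> pols S" using S(3) by (auto simp: pols_def)
  from adjoin_K'[OF S(1-3) this p(2,3)] obtain T where "finite T" "sub_ring T" "S \<subseteq> T" "z \<in> T"
    by (elim exE conjE)
  then show ?case using S by (intro exI[of _ T]) auto
qed

lemma sub_field_K': "sub_field K'"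
proof -
  have 1: "a - b \<in> K' \<and> a * b \<in> K' \<and> inverse a \<in> K'" if ab: "a \<in> K'" "b \<in> K'" for a b
  proof -
    obtain S where S: "finite S" "sub_ring S" "K0 \<subseteq> S" "{a, b} \<subseteq> S"
      using finite_subset_K'[of "{a, b}"] ab by auto
    then have "a - b \<in> S" "a * b \<in> S" "inverse a \<in> S"
      using sub_ring_diff[OF S(2)] sub_ring_mult[OF S(2)] sub_field_inverse[OF finite_sub_ring_field[OF S(2,1)]] by auto
    moreover have "c \<in> K'" if "c \<in> S" for c
      unfolding K'_iff using S(1-3) that by (intro exI[of _ S] conjI)
    ultimately show ?thesis by simp
  qed
  have "1 \<in> K'" using K0_K' sub_field_intros(1)[OF K0] by blast
  then show ?thesis using 1 by (auto simp: sub_field_def sub_ring_def)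
qed

text \<open>The coefficients lie in one finite ring, which is a field; adjoining the root
  \<open>z\<close> to it gives a finite ring again.\<close>

lemma algebraic_over_K':
  assumes p: "p \<in> pols K'" "p \<noteq> 0" "poly p z = 0" shows "z \<in> K'"
proof -
  have "set (coeffs p) \<subseteq> K'" using p(1) by (auto simp: pols_def coeffs_def)
  from finite_subset_K'[OF _ this] obtain S where
    S: "finite S" "sub_ring S" "K0 \<subseteq> S" "set (coeffs p) \<subseteq> S" by auto
  have "p \<in> pols S" unfolding pols_def
  proof safe
    fix n
    show "coeff p n \<in> S"
    proof (cases "n \<le> degree p")
      case True
      then show ?thesis using S(4) p(2) by (metis coeff_in_coeffs subsetD)
    qed (use sub_ring_zero[OF S(2)] in \<open>simp add: coeff_eq_0\<close>)
  qed
  from adjoin_K'[OF S(1-3) this p(2,3)] obtain T where "finite T" "sub_ring T" "S \<subseteq> T" "z \<in> T"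
    by (elim exE conjE)
  then show ?thesis unfolding K'_iff using S(3) by (intro exI[of _ T] conjI) auto
qed

lemma root_K': assumes p: "p \<in> pols K'" "degree p > 0" shows "\<exists>u\<in>K'. poly p u = 0"
proof -
  obtain u where "poly p u = 0" using alg_closed_imp_poly_has_root[OF p(2)] by blast
  moreover have "p \<noteq> 0" using p(2) by auto
  ultimately show ?thesis using algebraic_over_K'[OF p(1)] by blast
qed

lemma transcendental_K':
  assumes z: "\<And>p. p \<in> pols K \<Longrightarrow> poly p z = 0 \<Longrightarrow> p = 0" and p: "p \<in> pols K'" "poly p (to_ac z) = 0"
  shows "p = 0"
proof (rule ccontr)
  assume "p \<noteq> 0"
  then have "to_ac z \<in> K'" using algebraic_over_K' p by blast
  then obtain q where q: "q \<in> pols K" "map_poly to_ac q \<noteq> 0" "poly (map_poly to_ac q) (to_ac z) = 0"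
    unfolding K'_iff_root pols_K0 by blast
  then have "poly q z = 0" by (simp flip: to_ac.hom_poly)
  then show False using z[OF q(1)] q(2) by simp
qed

text \<open>Passage from the given definitions to two parallel settings, over \<open>K\<close> and
  over its closure. Both generated fields are identified with the normal form \<open>qset\<close> by
  two inclusions.\<close>

lemma elliptic_pair:
  assumes E: "elliptic_function_field K E x y"
  shows "\<exists>a1 a2 a3 a4 a6. ell_pair to_ac K x y a1 a2 a3 a4 a6
    K' (to_ac x) (to_ac y) (to_ac a1) (to_ac a2) (to_ac a3) (to_ac a4) (to_ac a6) \<and> E = qset K x y \<and>
    constant_extension K E = qset K' (to_ac x) (to_ac y)"
proof -
  obtain a1 a2 a3 a4 a6 where a: "a1 \<in> K" "a2 \<in> K" "a3 \<in> K" "a4 \<in> K" "a6 \<in> K"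
    and W: "weierstrass a1 a2 a3 a4 a6 x y = 0" and ns: "nonsingular_weierstrass K a1 a2 a3 a4 a6"
    using E unfolding elliptic_function_field_def by blast
  have gen: "E = generate_field ring_of_type_algebra (K \<union> {x, y})"
    and tr: "\<And>p. p \<in> pols K \<Longrightarrow> poly p x = 0 \<Longrightarrow> p = 0"
    using E transcendental_iff[OF sub_field_ring[OF K_fld]] unfolding elliptic_function_field_def by auto
  have Wac: "weierstrass (to_ac a1) (to_ac a2) (to_ac a3) (to_ac a4) (to_ac a6) (to_ac u) (to_ac v) =
      to_ac (weierstrass a1 a2 a3 a4 a6 u v)"
    "weierstrass_du (to_ac a1) (to_ac a2) (to_ac a4) (to_ac u) (to_ac v) = to_ac (weierstrass_du a1 a2 a4 u v)"
    "weierstrass_dv (to_ac a1) (to_ac a3) (to_ac u) (to_ac v) = to_ac (weierstrass_dv a1 a3 u v)" for u v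
    by (simp_all add: weierstrass_def weierstrass_du_def weierstrass_dv_def)
  interpret A: ell K x y a1 a2 a3 a4 a6
  proof
    fix u v assume uv: "u \<in> K" "v \<in> K" "weierstrass a1 a2 a3 a4 a6 u v = 0"
    then have "to_ac u \<in> K'" "to_ac v \<in> K'" using K0_K' by auto
    then show "\<not> (weierstrass_du a1 a2 a4 u v = 0 \<and> weierstrass_dv a1 a3 u v = 0)"
      using ns uv(3) Wac to_ac_0 unfolding nonsingular_weierstrass_def by metis
  qed (use K_fld a W tr in auto)
  interpret B: ell_closed K' "to_ac x" "to_ac y" "to_ac a1" "to_ac a2" "to_ac a3" "to_ac a4" "to_ac a6"
  proof
    show "weierstrass (to_ac a1) (to_ac a2) (to_ac a3) (to_ac a4) (to_ac a6) (to_ac x) (to_ac y) = 0"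
      unfolding Wac W by simp
  qed (use sub_field_K' K0_K' a ns root_K' transcendental_K'[OF tr] in \<open>auto simp: nonsingular_weierstrass_def\<close>)
  have pair: "ell_pair to_ac K x y a1 a2 a3 a4 a6
    K' (to_ac x) (to_ac y) (to_ac a1) (to_ac a2) (to_ac a3) (to_ac a4) (to_ac a6)"
  proof unfold_locales
    fix u assume "u \<in> K'"
    then obtain q where "q \<in> pols K" "map_poly to_ac q \<noteq> 0" "poly (map_poly to_ac q) u = 0"
      unfolding K'_iff_root pols_K0 by blast
    moreover from this have "q \<noteq> 0" by auto
    ultimately show "\<exists>p\<in>pols K. p \<noteq> 0 \<and> poly (map_poly to_ac p) u = 0" by blast
  qed (use K0_K' in auto)
  interpret P: ell_pair to_ac K x y a1 a2 a3 a4 a6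
    K' "to_ac x" "to_ac y" "to_ac a1" "to_ac a2" "to_ac a3" "to_ac a4" "to_ac a6" by (rule pair)
  have incl: "K \<union> {x, y} \<subseteq> generate_field ring_of_type_algebra (K \<union> {x, y})"
    by (auto intro: generate_field.incl)
  have EA: "E = A.E"
  proof
    show "E \<subseteq> A.E" unfolding gen
      by (rule generate_field_least[OF A.E_field]) (use A.K_E A.x_E A.y_E in auto)
    show "A.E \<subseteq> E" unfolding gen
      by (rule A.E_least[OF sub_field_generate_field]) (use incl in auto)
  qed
  have incl': "K' \<union> to_ac ` E \<subseteq> generate_field ring_of_type_algebra (K' \<union> to_ac ` E)"
    by (auto intro: generate_field.incl)
  have "constant_extension K E = B.E"
  proof
    show "constant_extension K E \<subseteq> B.E" unfolding constant_extension_def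
      by (rule generate_field_least[OF B.E_field]) (use B.K_E P.\<phi>E EA in auto)
    show "B.E \<subseteq> constant_extension K E" unfolding constant_extension_def
      by (rule B.E_least[OF sub_field_generate_field]) (use incl' EA A.x_E A.y_E in auto)
  qed
  then show ?thesis using pair EA by blast
qed

end

section \<open>Linear equivalence of divisors and the group of rational places\<close>

context ell
begin

lemma lin_equiv_E:
  "lin_equiv K E D D' \<longleftrightarrow> (\<exists>z\<in>E. z \<noteq> 0 \<and>
    (\<forall>V. vring K E V \<longrightarrow> Poly_Mapping.lookup (D - D') (nonunits V) = place_val E (nonunits V) z))"
  unfolding lin_equiv_def using places_E by (metis (no_types, lifting))

lemma lin_equiv_refl: "lin_equiv K E D D"
  unfolding lin_equiv_E
  using sub_field_intros(1)[OF E_field] dvr_ctx.val_1[OF vring_dvr] by (intro bexI[of _ 1]) auto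

lemma lin_equiv_sym: assumes "lin_equiv K E D D'" shows "lin_equiv K E D' D"
proof -
  obtain z where z: "z \<in> E" "z \<noteq> 0"
    "\<And>V. vring K E V \<Longrightarrow> Poly_Mapping.lookup (D - D') (nonunits V) = place_val E (nonunits V) z"
    using assms unfolding lin_equiv_E by blast
  have "Poly_Mapping.lookup (D' - D) (nonunits V) = place_val E (nonunits V) (inverse z)" if "vring K E V" for V
    using z(3)[OF that] dvr_ctx.val_inverse[OF vring_dvr[OF that] z(1,2)] by (simp add: lookup_minus)
  moreover have "inverse z \<in> E" "inverse z \<noteq> 0" using z sub_field_inverse[OF E_field] by auto
  ultimately show ?thesis unfolding lin_equiv_E by blast
qed

lemma lin_equiv_add:
  assumes "lin_equiv K E C C'" "lin_equiv K E D D'" shows "lin_equiv K E (C + D) (C' + D')"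
proof -
  obtain z where z: "z \<in> E" "z \<noteq> 0"
    "\<And>V. vring K E V \<Longrightarrow> Poly_Mapping.lookup (C - C') (nonunits V) = place_val E (nonunits V) z"
    using assms(1) unfolding lin_equiv_E by blast
  obtain t where t: "t \<in> E" "t \<noteq> 0"
    "\<And>V. vring K E V \<Longrightarrow> Poly_Mapping.lookup (D - D') (nonunits V) = place_val E (nonunits V) t"
    using assms(2) unfolding lin_equiv_E by blast
  have "Poly_Mapping.lookup (C + D - (C' + D')) (nonunits V) = place_val E (nonunits V) (z * t)" if "vring K E V" for V
    using z(3)[OF that] t(3)[OF that] dvr_ctx.val_mult[OF vring_dvr[OF that] z(1,2) t(1,2)]
    by (simp add: lookup_minus lookup_add)
  moreover have "z * t \<in> E" "z * t \<noteq> 0" using z t sub_field_intros(4)[OF E_field] by auto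
  ultimately show ?thesis unfolding lin_equiv_E by blast
qed

lemma lin_equiv_cancel: "lin_equiv K E (C + D) (C' + D) \<longleftrightarrow> lin_equiv K E C C'"
  unfolding lin_equiv_def by simp

lemma lin_equiv_trans: "lin_equiv K E C D \<Longrightarrow> lin_equiv K E D D' \<Longrightarrow> lin_equiv K E C D'"
  using lin_equiv_add[of C D D D'] by (simp add: add.commute[of D D'] lin_equiv_cancel)

end

text \<open>The assumption is the fact that makes sums of places unique. Isolating it lets the group
  law be built alike for the given field and for its extension of constants.\<close>

locale ell_group = ell +
  assumes unique_place: "p \<in> pts \<Longrightarrow> q \<in> pts \<Longrightarrow> z \<in> E \<Longrightarrow> z \<noteq> 0 \<Longrightarrow>
    (\<And>V. vring K E V \<Longrightarrow> place_val E (nonunits V) z =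
      (if pl p = nonunits V then 1 else 0) - (if pl q = nonunits V then 1 else 0)) \<Longrightarrow> p = q"
begin

abbreviation "G \<equiv> place_group K E x y"

lemma G_simps: "carrier G = rational_places K E" "\<one>\<^bsub>G\<^esub> = PO"
  by (simp_all add: place_group_def infinite_place_eq)

lemma PO_rational: "PO \<in> rational_places K E"
  using pl_rational[of None] by (simp add: pts_def)

lemma rational_unique:
  assumes "R \<in> rational_places K E" "S \<in> rational_places K E" "lin_equiv K E (frag_of R) (frag_of S)"
  shows "R = S"
proof -
  obtain p q where pq: "p \<in> pts" "R = pl p" "q \<in> pts" "S = pl q" using rational_pl assms(1,2) by meson
  obtain z where z: "z \<in> E" "z \<noteq> 0"
    "\<And>V. vring K E V \<Longrightarrow> Poly_Mapping.lookup (frag_of R - frag_of S) (nonunits V) = place_val E (nonunits V) z"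
    using assms(3) unfolding lin_equiv_E by blast
  have "p = q" by (rule unique_place[OF pq(1,3) z(1,2)]) (simp add: z(3)[symmetric] pq lookup_minus)
  then show ?thesis using pq by simp
qed

text \<open>The product is a definite description, and uniqueness comes from
  \<open>rational_unique\<close>; so exhibiting one suitable place computes it.\<close>

lemma mult_eqI:
  assumes "R \<in> rational_places K E"
    "lin_equiv K E (frag_of P + frag_of Q) (frag_of R + frag_of PO)"
  shows "P \<otimes>\<^bsub>G\<^esub> Q = R"
  unfolding place_group_def monoid.simps infinite_place_eq
proof (rule the_equality)
  show "R \<in> rational_places K E \<and> lin_equiv K E (frag_of P + frag_of Q) (frag_of R + frag_of PO)"
    using assms by simp
  fix S assume S: "S \<in> rational_places K E \<and> lin_equiv K E (frag_of P + frag_of Q) (frag_of S + frag_of PO)"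
  then have "lin_equiv K E (frag_of S + frag_of PO) (frag_of R + frag_of PO)"
    using lin_equiv_trans[OF lin_equiv_sym assms(2)] by blast
  then show "S = R" using rational_unique S assms(1) lin_equiv_cancel by blast
qed

lemma mult_pl:
  assumes "chord K a1 a2 a3 a4 a6 p q s" "p \<in> pts" "q \<in> pts" shows "pl p \<otimes>\<^bsub>G\<^esub> pl q = pl s"
  by (rule mult_eqI[OF pl_rational[OF chord_pts[OF assms]] chord_lin_equiv[OF assms]])

lemma mult_prop:
  assumes "P \<in> rational_places K E" "Q \<in> rational_places K E"
  shows "P \<otimes>\<^bsub>G\<^esub> Q \<in> rational_places K E"
    "lin_equiv K E (frag_of P + frag_of Q) (frag_of (P \<otimes>\<^bsub>G\<^esub> Q) + frag_of PO)"
proof -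
  obtain p q where pq: "p \<in> pts" "P = pl p" "q \<in> pts" "Q = pl q" using rational_pl assms by meson
  obtain s where s: "s \<in> pts" "chord K a1 a2 a3 a4 a6 p q s" using chord_exists pq by blast
  then show "P \<otimes>\<^bsub>G\<^esub> Q \<in> rational_places K E"
    "lin_equiv K E (frag_of P + frag_of Q) (frag_of (P \<otimes>\<^bsub>G\<^esub> Q) + frag_of PO)"
    using mult_pl[OF s(2) pq(1,3)] chord_lin_equiv[OF s(2) pq(1,3)] pl_rational pq by auto
qed

lemma mult_comm: "P \<otimes>\<^bsub>G\<^esub> Q = Q \<otimes>\<^bsub>G\<^esub> P"
  by (simp add: place_group_def add.commute)

lemma one_mult: "Q \<in> rational_places K E \<Longrightarrow> PO \<otimes>\<^bsub>G\<^esub> Q = Q"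
  by (rule mult_eqI) (simp_all add: add.commute lin_equiv_refl)

text \<open>Either bracketing of a triple product becomes, after adding \<open>2 O\<close>,
  equivalent to \<open>P + Q + R\<close>, so the two agree by uniqueness. Inverses are conjugate
  points.\<close>

lemma comm_group_G: "comm_group G"
proof (rule comm_groupI, unfold G_simps)
  fix P Q assume "P \<in> rational_places K E" "Q \<in> rational_places K E"
  then show "P \<otimes>\<^bsub>G\<^esub> Q \<in> rational_places K E" by (rule mult_prop(1))
next
  show "PO \<in> rational_places K E" by (rule PO_rational)
next
  fix P Q R assume P: "P \<in> rational_places K E" and Q: "Q \<in> rational_places K E" and R: "R \<in> rational_places K E"
  let ?l = "lin_equiv K E" and ?f = frag_of
  note PQ = mult_prop[OF P Q] and QR = mult_prop[OF Q R]
  note L = mult_prop[OF PQ(1) R] and M = mult_prop[OF P QR(1)]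
  have "?l (?f P + ?f Q + ?f R) (?f (P \<otimes>\<^bsub>G\<^esub> Q) + ?f PO + ?f R)"
    by (rule lin_equiv_add[OF PQ(2) lin_equiv_refl])
  also have "?f (P \<otimes>\<^bsub>G\<^esub> Q) + ?f PO + ?f R = ?f (P \<otimes>\<^bsub>G\<^esub> Q) + ?f R + ?f PO" by (simp add: add.assoc add.commute)
  finally have 1: "?l (?f P + ?f Q + ?f R) (?f (P \<otimes>\<^bsub>G\<^esub> Q \<otimes>\<^bsub>G\<^esub> R) + ?f PO + ?f PO)"
    by (rule lin_equiv_trans) (rule lin_equiv_add[OF L(2) lin_equiv_refl])
  have "?l (?f P + (?f Q + ?f R)) (?f P + (?f (Q \<otimes>\<^bsub>G\<^esub> R) + ?f PO))"
    by (rule lin_equiv_add[OF lin_equiv_refl QR(2)])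
  then have "?l (?f P + ?f Q + ?f R) (?f P + ?f (Q \<otimes>\<^bsub>G\<^esub> R) + ?f PO)" by (simp only: add.assoc)
  then have 2: "?l (?f P + ?f Q + ?f R) (?f (P \<otimes>\<^bsub>G\<^esub> (Q \<otimes>\<^bsub>G\<^esub> R)) + ?f PO + ?f PO)"
    by (rule lin_equiv_trans) (rule lin_equiv_add[OF M(2) lin_equiv_refl])
  have "?l (?f (P \<otimes>\<^bsub>G\<^esub> Q \<otimes>\<^bsub>G\<^esub> R)) (?f (P \<otimes>\<^bsub>G\<^esub> (Q \<otimes>\<^bsub>G\<^esub> R)))"
    using lin_equiv_trans[OF lin_equiv_sym[OF 1] 2] lin_equiv_cancel by blast
  then show "P \<otimes>\<^bsub>G\<^esub> Q \<otimes>\<^bsub>G\<^esub> R = P \<otimes>\<^bsub>G\<^esub> (Q \<otimes>\<^bsub>G\<^esub> R)" by (rule rational_unique[OF L(1) M(1)])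
next
  fix P Q show "P \<otimes>\<^bsub>G\<^esub> Q = Q \<otimes>\<^bsub>G\<^esub> P" by (rule mult_comm)
next
  fix P assume P: "P \<in> rational_places K E"
  then show "PO \<otimes>\<^bsub>G\<^esub> P = P" by (rule one_mult)
  obtain p where p: "p \<in> pts" "P = pl p" using rational_pl P by blast
  show "\<exists>Q\<in>rational_places K E. Q \<otimes>\<^bsub>G\<^esub> P = PO"
  proof (cases p)
    case None
    then show ?thesis using p one_mult PO_rational by (intro bexI[of _ PO]) auto
  next
    case (Some q)
    then obtain u v where uv: "p = Some (u, v)" "on_E u v" using p by (auto simp: pts_def)
    then have q: "Some (u, cj u v) \<in> pts" using on_E_cj by (auto simp: pts_def)
    have "chord K a1 a2 a3 a4 a6 p (Some (u, cj u v)) None" unfolding chord_def uv by blast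
    then have "pl p \<otimes>\<^bsub>G\<^esub> pl (Some (u, cj u v)) = PO" using mult_pl[OF _ p(1) q] by simp
    then show ?thesis using pl_rational[OF q] p mult_comm by (intro bexI[of _ "pl (Some (u, cj u v))"]) auto
  qed
qed

end

lemma (in ell_pair) ell_group_A: "ell_group K x y a1 a2 a3 a4 a6"
  by unfold_locales (rule no_function_with_one_pole)

lemma (in ell_closed) ell_group_closed: "ell_group K x y a1 a2 a3 a4 a6"
proof -
  interpret ell_pair "\<lambda>z. z" K x y a1 a2 a3 a4 a6 K x y a1 a2 a3 a4 a6
  proof unfold_locales
    fix u assume u: "u \<in> K"
    have "map_poly (\<lambda>z. z) p = p" for p :: "'a poly" by (simp add: poly_eq_iff coeff_map_poly)
    moreover have "[:- u, 1:] \<in> pols K" by (intro K_pols(1,4) sub_ring_intros[OF K_ring] u)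
    ultimately show "\<exists>p\<in>pols K. p \<noteq> 0 \<and> poly (map_poly (\<lambda>z. z) p) u = 0"
      by (intro bexI[of _ "[:- u, 1:]"]) auto
  qed auto
  show ?thesis by (rule ell_group_A)
qed

section \<open>Automorphisms\<close>

lemma Aut_iff:
  "\<sigma> \<in> carrier (Aut_group K F) \<longleftrightarrow> \<sigma> \<in> extensional F \<and> bij_betw \<sigma> F F \<and> \<sigma> 1 = 1 \<and>
    (\<forall>a\<in>F. \<forall>b\<in>F. \<sigma> (a + b) = \<sigma> a + \<sigma> b \<and> \<sigma> (a * b) = \<sigma> a * \<sigma> b) \<and> (\<forall>c\<in>K. \<sigma> c = c)"
  unfolding Aut_group_def ring_iso_def ring_hom_def
  by (auto simp: bij_betw_def)

locale aut_ctx =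
  fixes K F :: "'a::field set" and \<sigma> :: "'a \<Rightarrow> 'a"
  assumes F: "sub_field F" and KF: "sub_field K" "K \<subseteq> F" and \<sigma>: "\<sigma> \<in> carrier (Aut_group K F)"
begin

lemma bij: "bij_betw \<sigma> F F" and \<sigma>1: "\<sigma> 1 = 1" and \<sigma>_add: "a \<in> F \<Longrightarrow> b \<in> F \<Longrightarrow> \<sigma> (a + b) = \<sigma> a + \<sigma> b"
  and \<sigma>_mult: "a \<in> F \<Longrightarrow> b \<in> F \<Longrightarrow> \<sigma> (a * b) = \<sigma> a * \<sigma> b" and \<sigma>K: "c \<in> K \<Longrightarrow> \<sigma> c = c"
  using \<sigma> unfolding Aut_iff by blast+

lemma \<sigma>F: "a \<in> F \<Longrightarrow> \<sigma> a \<in> F"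
  using bij bij_betwE by blast

lemma \<sigma>_eq: "a \<in> F \<Longrightarrow> b \<in> F \<Longrightarrow> \<sigma> a = \<sigma> b \<longleftrightarrow> a = b"
  using bij by (auto simp: bij_betw_def inj_on_def)

lemma \<sigma>0: "\<sigma> 0 = 0"
  using \<sigma>K sub_field_intros(2)[OF KF(1)] by blast

lemma \<sigma>_uminus: "a \<in> F \<Longrightarrow> \<sigma> (- a) = - \<sigma> a"
  using \<sigma>_add[of "- a" a] \<sigma>0 sub_field_intros(5)[OF F] by (simp add: eq_neg_iff_add_eq_0)

lemma \<sigma>_diff: "a \<in> F \<Longrightarrow> b \<in> F \<Longrightarrow> \<sigma> (a - b) = \<sigma> a - \<sigma> b"
  using \<sigma>_add[of a "- b"] \<sigma>_uminus sub_field_intros(5)[OF F] by simp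

lemma \<sigma>_inverse: assumes "a \<in> F" shows "\<sigma> (inverse a) = inverse (\<sigma> a)"
proof (cases "a = 0")
  case False
  then have "\<sigma> a * \<sigma> (inverse a) = 1" using \<sigma>_mult[of a "inverse a"] assms sub_field_inverse[OF F] \<sigma>1 by simp
  then show ?thesis by (metis inverse_unique)
qed (simp add: \<sigma>0)

lemma \<sigma>_divide: "a \<in> F \<Longrightarrow> b \<in> F \<Longrightarrow> \<sigma> (a / b) = \<sigma> a / \<sigma> b"
  unfolding divide_inverse by (simp add: \<sigma>_mult \<sigma>_inverse sub_field_inverse[OF F])

lemma \<sigma>_power: "a \<in> F \<Longrightarrow> \<sigma> (a ^ n) = \<sigma> a ^ n"
  by (induction n) (auto simp: \<sigma>1 \<sigma>_mult sub_field_intros[OF F])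

lemma \<sigma>_powi: "a \<in> F \<Longrightarrow> \<sigma> (a powi n) = \<sigma> a powi n"
  by (auto simp: power_int_def \<sigma>_power \<sigma>_inverse sub_field_inverse[OF F])

lemma \<sigma>_poly: assumes "p \<in> pols K" "a \<in> F" shows "\<sigma> (poly p a) = poly p (\<sigma> a)"
  using assms(1)
proof (induction p)
  case (pCons c p)
  have "c \<in> K" "p \<in> pols K"
    using pCons.prems coeff_pols[of "pCons c p" K 0] coeff_pols[of "pCons c p" K "Suc _"] by (auto simp: pols_def)
  moreover have "poly p a \<in> F" using poly_pols[OF sub_field_ring[OF F] KF(2) assms(2)] calculation by blast
  ultimately show ?case using pCons.IH \<sigma>K KF(2) assms(2)
    by (subst poly_pCons, subst \<sigma>_add) (auto simp: \<sigma>_mult sub_field_intros[OF F])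
qed (simp add: \<sigma>0)

lemma mem_image: "S \<subseteq> F \<Longrightarrow> z \<in> F \<Longrightarrow> \<sigma> z \<in> \<sigma> ` S \<longleftrightarrow> z \<in> S"
  using \<sigma>_eq by (auto simp: image_iff subset_iff)

lemma surj: "w \<in> F \<Longrightarrow> \<exists>z\<in>F. w = \<sigma> z"
  using bij by (auto simp: bij_betw_def)

lemma image_subset: "S \<subseteq> F \<Longrightarrow> \<sigma> ` S \<subseteq> F"
  using \<sigma>F by auto

lemma image_eq: "S \<subseteq> F \<Longrightarrow> S' \<subseteq> F \<Longrightarrow> \<sigma> ` S = \<sigma> ` S' \<longleftrightarrow> S = S'"
  using bij by (metis bij_betw_def inj_on_image_eq_iff)

lemma vring_image: assumes V: "vring K F V" shows "vring K F (\<sigma> ` V)" "nonunits (\<sigma> ` V) = \<sigma> ` nonunits V"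
proof -
  have VF: "V \<subseteq> F" "sub_ring V" "K \<subseteq> V" "V \<noteq> F" using V by (auto simp: vring_def)
  have FF: "\<sigma> ` F = F" using bij by (simp add: bij_betw_def)
  have "sub_ring (\<sigma> ` V)" unfolding sub_ring_def
  proof (intro conjI ballI)
    show "1 \<in> \<sigma> ` V" using sub_ring_one[OF VF(2)] \<sigma>1 by force
    fix a b assume "a \<in> \<sigma> ` V" "b \<in> \<sigma> ` V"
    then obtain a' b' where ab: "a' \<in> V" "a = \<sigma> a'" "b' \<in> V" "b = \<sigma> b'" by blast
    then have F': "a' \<in> F" "b' \<in> F" using VF by auto
    show "a - b \<in> \<sigma> ` V" unfolding ab \<sigma>_diff[OF F', symmetric] using sub_ring_diff[OF VF(2) ab(1,3)] by blast
    show "a * b \<in> \<sigma> ` V" unfolding ab \<sigma>_mult[OF F', symmetric] using sub_ring_mult[OF VF(2) ab(1,3)] by blast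
  qed
  moreover have "K \<subseteq> \<sigma> ` V" using \<sigma>K VF(3) by force
  moreover have "\<sigma> ` V \<subset> F" using image_subset[OF VF(1)] image_eq[OF VF(1) order_refl] FF VF(4) by auto
  moreover have "w \<in> \<sigma> ` V \<or> inverse w \<in> \<sigma> ` V" if "w \<in> F" for w
  proof -
    obtain z where z: "z \<in> F" "w = \<sigma> z" using surj \<open>w \<in> F\<close> by blast
    then have "z \<in> V \<or> inverse z \<in> V" using V by (auto simp: vring_def)
    then show ?thesis unfolding z(2) \<sigma>_inverse[OF z(1), symmetric] by blast
  qed
  ultimately show "vring K F (\<sigma> ` V)" by (simp add: vring_def)
  have iff: "inverse (\<sigma> z) \<in> \<sigma> ` V \<longleftrightarrow> inverse z \<in> V" if "z \<in> V" for z
    using \<sigma>_inverse[of z] mem_image[OF VF(1), of "inverse z"] that VF(1) sub_field_inverse[OF F] by auto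
  show "nonunits (\<sigma> ` V) = \<sigma> ` nonunits V"
  proof -
    have "\<sigma> z \<in> nonunits (\<sigma> ` V) \<longleftrightarrow> z \<in> nonunits V" if "z \<in> V" for z
      using that iff[OF that] \<sigma>_eq[of z 0] \<sigma>0 VF(1) sub_field_intros(2)[OF F] by (auto simp: nonunits_def)
    then show ?thesis by (auto simp: nonunits_def)
  qed
qed

lemma place_ring_image: assumes "Q \<subseteq> F" shows "place_ring F (\<sigma> ` Q) = \<sigma> ` place_ring F Q"
proof -
  have "\<sigma> z \<in> place_ring F (\<sigma> ` Q) \<longleftrightarrow> z \<in> place_ring F Q" if "z \<in> F" for z
    using \<sigma>F[OF that] that \<sigma>_inverse[OF that] mem_image[OF assms sub_field_inverse[OF F that]]
      \<sigma>_eq[OF that sub_field_intros(2)[OF F]] \<sigma>0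
    by (auto simp: place_ring_def)
  moreover have "place_ring F (\<sigma> ` Q) \<subseteq> F" "place_ring F Q \<subseteq> F" by (auto simp: place_ring_def)
  ultimately show ?thesis using surj by (auto simp: subset_iff) blast+
qed

text \<open>Transport of structure: \<open>\<sigma>\<close> moves the ring, the generator of the
  ideal and the unit that occur in the defining description.\<close>

lemma place_val_image:
  assumes Q: "Q \<subseteq> F" and z: "z \<in> F" shows "place_val F (\<sigma> ` Q) (\<sigma> z) = place_val F Q z"
proof -
  define R where "R = place_ring F Q"
  have RF: "R \<subseteq> F" by (auto simp: R_def place_ring_def)
  have R': "place_ring F (\<sigma> ` Q) = \<sigma> ` R" using place_ring_image[OF Q] by (simp add: R_def)
  have PI: "PIdl\<^bsub>ring_on S\<^esub> t = (\<lambda>a. a * t) ` S" for S :: "'a set" and t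
    by (auto simp: cgenideal_def)
  have eq: "(\<exists>t\<in>\<sigma> ` R. \<exists>u\<in>\<sigma> ` R - \<sigma> ` Q. \<sigma> ` Q = PIdl\<^bsub>ring_on (\<sigma> ` R)\<^esub> t \<and> \<sigma> z = t powi n * u) \<longleftrightarrow>
     (\<exists>t\<in>R. \<exists>u\<in>R - Q. Q = PIdl\<^bsub>ring_on R\<^esub> t \<and> z = t powi n * u)" for n
  proof -
    have RQ: "\<sigma> ` R - \<sigma> ` Q = \<sigma> ` (R - Q)"
      using inj_on_image_set_diff[of \<sigma> F R Q] bij RF Q by (auto simp: bij_betw_def)
    have 1: "\<sigma> ` Q = PIdl\<^bsub>ring_on (\<sigma> ` R)\<^esub> (\<sigma> t) \<longleftrightarrow> Q = PIdl\<^bsub>ring_on R\<^esub> t" if t: "t \<in> R" for t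
    proof -
      have "(\<lambda>a. a * \<sigma> t) ` (\<sigma> ` R) = \<sigma> ` ((\<lambda>a. a * t) ` R)"
        unfolding image_image using RF t by (intro image_cong) (auto simp: \<sigma>_mult subset_iff)
      moreover have "(\<lambda>a. a * t) ` R \<subseteq> F" using RF t sub_field_intros(4)[OF F] by auto
      ultimately show ?thesis unfolding PI using image_eq[OF Q] by metis
    qed
    have 2: "\<sigma> z = \<sigma> t powi n * \<sigma> u \<longleftrightarrow> z = t powi n * u" if "t \<in> R" "u \<in> R" for t u
    proof -
      have tu: "t \<in> F" "u \<in> F" using that RF by auto
      have "\<sigma> t powi n * \<sigma> u = \<sigma> (t powi n * u)" using tu \<sigma>_mult \<sigma>_powi sub_field_powi[OF F] by simp
      moreover have "t powi n * u \<in> F" using tu sub_field_powi[OF F] sub_field_intros(4)[OF F] by blast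
      ultimately show ?thesis using \<sigma>_eq z by simp
    qed
    show ?thesis unfolding RQ using 1 2 by (auto simp del: ring_on_simps)
  qed
  show ?thesis unfolding place_val_def R' eq unfolding R_def ..
qed

end

lemma group_Aut:
  assumes F: "sub_field F" and K: "sub_field K" "K \<subseteq> F"
  shows "group (Aut_group K F)"
    "\<And>\<sigma> \<tau>. \<sigma> \<in> carrier (Aut_group K F) \<Longrightarrow> \<tau> \<in> carrier (Aut_group K F) \<Longrightarrow> \<sigma> \<otimes>\<^bsub>Aut_group K F\<^esub> \<tau> = compose F \<sigma> \<tau>"
    "\<one>\<^bsub>Aut_group K F\<^esub> = (\<lambda>x\<in>F. x)"
proof -
  have Bij: "\<sigma> \<in> Bij F" if "\<sigma> \<in> carrier (Aut_group K F)" for \<sigma>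
    using that unfolding Aut_iff Bij_def by blast
  then show m: "\<sigma> \<otimes>\<^bsub>Aut_group K F\<^esub> \<tau> = compose F \<sigma> \<tau>"
    if "\<sigma> \<in> carrier (Aut_group K F)" "\<tau> \<in> carrier (Aut_group K F)" for \<sigma> \<tau>
    using that by (simp add: Aut_group_def BijGroup_def)
  show "\<one>\<^bsub>Aut_group K F\<^esub> = (\<lambda>x\<in>F. x)" by (simp add: Aut_group_def BijGroup_def)
  have "subgroup (carrier (Aut_group K F)) (BijGroup F)"
  proof (rule group.subgroupI[OF group_BijGroup])
    show "carrier (Aut_group K F) \<subseteq> carrier (BijGroup F)" using Bij by (auto simp: BijGroup_def)
    have "(\<lambda>x\<in>F. x) \<in> carrier (Aut_group K F)" unfolding Aut_iff
      using sub_field_intros[OF F] K by (auto simp: bij_betw_def inj_on_def)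
    then show "carrier (Aut_group K F) \<noteq> {}" by blast
    fix \<sigma> assume s: "\<sigma> \<in> carrier (Aut_group K F)"
    interpret s: aut_ctx K F \<sigma> by unfold_locales (use F K s in auto)
    define \<rho> where "\<rho> = (\<lambda>x\<in>F. inv_into F \<sigma> x)"
    have r: "\<rho> (\<sigma> z) = z" if "z \<in> F" for z
      using s.bij that s.\<sigma>F by (auto simp: \<rho>_def bij_betw_def inv_into_f_f)
    have "\<rho> \<in> carrier (Aut_group K F)" unfolding Aut_iff
    proof (intro conjI ballI)
      show "\<rho> \<in> extensional F" by (simp add: \<rho>_def)
      show "bij_betw \<rho> F F" using bij_betw_inv_into[OF s.bij] by (simp add: \<rho>_def)
      show "\<rho> 1 = 1" using r[of 1] s.\<sigma>1 sub_field_intros(1)[OF F] by simp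
      fix c assume "c \<in> K"
      then show "\<rho> c = c" using r[of c] s.\<sigma>K K(2) by auto
    next
      fix a b assume "a \<in> F" "b \<in> F"
      then obtain a' b' where ab: "a' \<in> F" "a = \<sigma> a'" "b' \<in> F" "b = \<sigma> b'" using s.surj by blast
      show "\<rho> (a + b) = \<rho> a + \<rho> b" unfolding ab s.\<sigma>_add[OF ab(1,3), symmetric]
        using ab(1,3) sub_field_intros(6)[OF F] by (simp add: r)
      show "\<rho> (a * b) = \<rho> a * \<rho> b" unfolding ab s.\<sigma>_mult[OF ab(1,3), symmetric]
        using ab(1,3) sub_field_intros(4)[OF F] by (simp add: r)
    qed
    then show "inv\<^bsub>BijGroup F\<^esub> \<sigma> \<in> carrier (Aut_group K F)" using inv_BijGroup[OF Bij[OF s]] by (simp add: \<rho>_def)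
    fix \<tau> assume t: "\<tau> \<in> carrier (Aut_group K F)"
    interpret t: aut_ctx K F \<tau> by unfold_locales (use F K t in auto)
    have "compose F \<sigma> \<tau> \<in> carrier (Aut_group K F)" unfolding Aut_iff
    proof (intro conjI ballI)
      show "bij_betw (compose F \<sigma> \<tau>) F F" using bij_betw_compose[OF t.bij s.bij] .
    qed (use sub_field_intros[OF F] K(2) in \<open>auto simp: compose_def s.\<sigma>1 t.\<sigma>1 s.\<sigma>_add t.\<sigma>_add s.\<sigma>_mult t.\<sigma>_mult
        s.\<sigma>K t.\<sigma>K t.\<sigma>F\<close>)
    then show "\<sigma> \<otimes>\<^bsub>BijGroup F\<^esub> \<tau> \<in> carrier (Aut_group K F)" using Bij s t by (simp add: BijGroup_def)
  qed
  from group.subgroup_imp_group[OF group_BijGroup this] show "group (Aut_group K F)"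
    by (simp add: Aut_group_def)
qed

text \<open>Equality of two fractions \<open>elt a b / poly c x\<close> is decided by polynomial
  identities that do not involve the generators, and sums and products depend only on
  \<open>h\<close> and \<open>f\<close>. So sending each expression to the same expression in the
  other generators is well defined and an isomorphism.\<close>

lemma quad_iso:
  assumes A: "quad K x y h f" and B: "quad K \<xi> \<eta> h f"
  shows "\<exists>\<sigma>. bij_betw \<sigma> (qset K x y) (qset K \<xi> \<eta>) \<and> \<sigma> 1 = 1 \<and> \<sigma> x = \<xi> \<and> \<sigma> y = \<eta> \<and> (\<forall>c\<in>K. \<sigma> c = c) \<and>
    (\<forall>a\<in>qset K x y. \<forall>b\<in>qset K x y. \<sigma> (a + b) = \<sigma> a + \<sigma> b \<and> \<sigma> (a * b) = \<sigma> a * \<sigma> b)"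
proof -
  interpret A: quad K x y h f by (rule A)
  interpret B: quad K \<xi> \<eta> h f by (rule B)
  define \<sigma> where "\<sigma> z = (SOME s. \<exists>a\<in>pols K. \<exists>b\<in>pols K. \<exists>c\<in>pols K. c \<noteq> 0 \<and> z = A.elt a b / poly c x \<and>
    s = B.elt a b / poly c \<xi>)" for z
  have iff: "A.elt a b / poly c x = A.elt a' b' / poly c' x \<longleftrightarrow> B.elt a b / poly c \<xi> = B.elt a' b' / poly c' \<xi>"
    if p: "a \<in> pols K" "b \<in> pols K" "c \<in> pols K" "c \<noteq> 0" "a' \<in> pols K" "b' \<in> pols K" "c' \<in> pols K" "c' \<noteq> 0"
    for a b c a' b' c'
  proof -
    have nz: "poly c x \<noteq> 0" "poly c' x \<noteq> 0" "poly c \<xi> \<noteq> 0" "poly c' \<xi> \<noteq> 0"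
      using p A.poly_x_eq_0 B.poly_x_eq_0 by auto
    have pol: "c' * a - c * a' \<in> pols K" "c' * b - c * b' \<in> pols K" by (intro A.K_pols p)+
    have "A.elt a b / poly c x = A.elt a' b' / poly c' x \<longleftrightarrow> poly c' x * A.elt a b - poly c x * A.elt a' b' = 0"
      using nz by (simp add: frac_eq_eq mult.commute)
    also have "\<dots> \<longleftrightarrow> c' * a - c * a' = 0 \<and> c' * b - c * b' = 0"
      unfolding A.elt_scale A.elt_diff using A.elt_eq_0[OF pol] .
    also have "\<dots> \<longleftrightarrow> poly c' \<xi> * B.elt a b - poly c \<xi> * B.elt a' b' = 0"
      unfolding B.elt_scale B.elt_diff using B.elt_eq_0[OF pol] by blast
    also have "\<dots> \<longleftrightarrow> B.elt a b / poly c \<xi> = B.elt a' b' / poly c' \<xi>"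
      using nz by (simp add: frac_eq_eq mult.commute)
    finally show ?thesis .
  qed
  have \<sigma>: "\<sigma> (A.elt a b / poly c x) = B.elt a b / poly c \<xi>"
    if p: "a \<in> pols K" "b \<in> pols K" "c \<in> pols K" "c \<noteq> 0" for a b c
    unfolding \<sigma>_def
  proof (rule some_equality)
    show "\<exists>a'\<in>pols K. \<exists>b'\<in>pols K. \<exists>c'\<in>pols K. c' \<noteq> 0 \<and> A.elt a b / poly c x = A.elt a' b' / poly c' x \<and>
      B.elt a b / poly c \<xi> = B.elt a' b' / poly c' \<xi>" using p by blast
    fix s assume "\<exists>a'\<in>pols K. \<exists>b'\<in>pols K. \<exists>c'\<in>pols K. c' \<noteq> 0 \<and> A.elt a b / poly c x = A.elt a' b' / poly c' x \<and>
      s = B.elt a' b' / poly c' \<xi>"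
    then show "s = B.elt a b / poly c \<xi>" using iff[OF p] by metis
  qed
  have \<sigma>elt: "\<sigma> (A.elt a b) = B.elt a b" if "a \<in> pols K" "b \<in> pols K" for a b
    using \<sigma>[OF that A.K_pols(2)] by simp
  have hom: "\<sigma> (z + t) = \<sigma> z + \<sigma> t \<and> \<sigma> (z * t) = \<sigma> z * \<sigma> t" if zt: "z \<in> A.E" "t \<in> A.E" for z t
  proof -
    obtain a b c where z: "a \<in> pols K" "b \<in> pols K" "c \<in> pols K" "c \<noteq> 0" "z = A.elt a b / poly c x"
      using zt(1) unfolding A.E_iff by blast
    obtain a' b' c' where t: "a' \<in> pols K" "b' \<in> pols K" "c' \<in> pols K" "c' \<noteq> 0" "t = A.elt a' b' / poly c' x"
      using zt(2) unfolding A.E_iff by blast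
    have nz: "poly c x \<noteq> 0" "poly c' x \<noteq> 0" "poly c \<xi> \<noteq> 0" "poly c' \<xi> \<noteq> 0"
      using z t A.poly_x_eq_0 B.poly_x_eq_0 by auto
    have cc: "c * c' \<in> pols K" "c * c' \<noteq> 0" using z t A.K_pols(8) by auto
    have "z + t = A.elt (c' * a + c * a') (c' * b + c * b') / poly (c * c') x"
      using nz unfolding z t by (simp add: A.elt_def field_simps)
    then have "\<sigma> (z + t) = B.elt (c' * a + c * a') (c' * b + c * b') / poly (c * c') \<xi>"
      by (simp only:) (rule \<sigma>; (intro A.K_pols z t cc)?)
    also have "\<dots> = \<sigma> z + \<sigma> t" unfolding z(5) t(5) \<sigma>[OF z(1-4)] \<sigma>[OF t(1-4)]
      using nz by (simp add: B.elt_def field_simps)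
    finally have add: "\<sigma> (z + t) = \<sigma> z + \<sigma> t" .
    have "z * t = A.elt (a * a' + b * b' * f) (a * b' + a' * b - b * b' * h) / poly (c * c') x"
      unfolding z t A.elt_mult[symmetric] by simp
    then have "\<sigma> (z * t) = B.elt (a * a' + b * b' * f) (a * b' + a' * b - b * b' * h) / poly (c * c') \<xi>"
      by (simp only:) (rule \<sigma>; (intro A.K_pols z t cc A.h A.f)?)
    also have "\<dots> = \<sigma> z * \<sigma> t" unfolding z(5) t(5) \<sigma>[OF z(1-4)] \<sigma>[OF t(1-4)] B.elt_mult[symmetric] by simp
    finally show ?thesis using add by simp
  qed
  have "bij_betw \<sigma> A.E B.E" unfolding bij_betw_def
  proof
    show "inj_on \<sigma> A.E"
    proof (rule inj_onI)
      fix z t assume zt: "z \<in> A.E" "t \<in> A.E" "\<sigma> z = \<sigma> t"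
      obtain a b c where z: "a \<in> pols K" "b \<in> pols K" "c \<in> pols K" "c \<noteq> 0" "z = A.elt a b / poly c x"
        using zt(1) unfolding A.E_iff by blast
      obtain a' b' c' where t: "a' \<in> pols K" "b' \<in> pols K" "c' \<in> pols K" "c' \<noteq> 0" "t = A.elt a' b' / poly c' x"
        using zt(2) unfolding A.E_iff by blast
      show "z = t" using zt(3) unfolding z(5) t(5) \<sigma>[OF z(1-4)] \<sigma>[OF t(1-4)] iff[OF z(1-4) t(1-4)] .
    qed
    show "\<sigma> ` A.E = B.E"
    proof
      show "\<sigma> ` A.E \<subseteq> B.E"
      proof safe
        fix z assume "z \<in> A.E"
        then obtain a b c where z: "a \<in> pols K" "b \<in> pols K" "c \<in> pols K" "c \<noteq> 0" "z = A.elt a b / poly c x"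
          unfolding A.E_iff by blast
        show "\<sigma> z \<in> B.E" unfolding z(5) \<sigma>[OF z(1-4)] by (rule B.E_I[OF z(1-4)])
      qed
      show "B.E \<subseteq> \<sigma> ` A.E"
      proof
        fix z assume "z \<in> B.E"
        then obtain a b c where z: "a \<in> pols K" "b \<in> pols K" "c \<in> pols K" "c \<noteq> 0" "z = B.elt a b / poly c \<xi>"
          unfolding B.E_iff by blast
        show "z \<in> \<sigma> ` A.E" unfolding z(5) \<sigma>[OF z(1-4), symmetric] using A.E_I[OF z(1-4)] by blast
      qed
    qed
  qed
  moreover have "\<sigma> c = c" if "c \<in> K" for c
    using \<sigma>elt[OF A.K_pols(3)[OF that] A.K_pols(1)] by (simp add: A.elt_def B.elt_def)
  moreover from this have "\<sigma> 1 = 1" using sub_ring_one[OF A.K_ring] .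
  moreover have "\<sigma> x = \<xi>" using \<sigma>elt[OF A.X_pols A.K_pols(1)] by (simp add: A.elt_def B.elt_def)
  moreover have "\<sigma> y = \<eta>" using \<sigma>elt[OF A.K_pols(1,2)] by (simp add: A.elt_def B.elt_def)
  ultimately show ?thesis using hom by blast
qed

context ell_closed
begin

text \<open>An automorphism fixing every rational place fixes the residues of every function, so the
  difference of a function and its image vanishes at all but finitely many points.\<close>

lemma faithful:
  assumes \<sigma>: "\<sigma> \<in> carrier (Aut_group K E)" and fixes_places: "\<And>Q. Q \<in> rational_places K E \<Longrightarrow> \<sigma> ` Q = Q" and z: "z \<in> E"
  shows "\<sigma> z = z"
proof (rule ccontr)
  assume ne: "\<sigma> z \<noteq> z"
  interpret s: aut_ctx K E \<sigma> by unfold_locales (use E_field K_field K_E \<sigma> in auto)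
  define t where "t = \<sigma> z - z"
  have t: "t \<in> E" "t \<noteq> 0" using s.\<sigma>F[OF z] z sub_field_intros(3)[OF E_field] ne by (auto simp: t_def)
  obtain a b c where zz: "a \<in> pols K" "b \<in> pols K" "c \<in> pols K" "c \<noteq> 0" "z = elt a b / poly c x"
    using z unfolding E_iff by blast
  obtain a' b' c' where tt: "a' \<in> pols K" "b' \<in> pols K" "c' \<in> pols K" "c' \<noteq> 0" "t = elt a' b' / poly c' x"
    using t unfolding E_iff by blast
  have n: "nrm a' b' \<in> pols K" "nrm a' b' \<noteq> 0" using nrm_pols[OF tt(1,2)] nrm_eq_0[OF tt(1,2)] t tt by (auto simp: elt_def)
  \<comment> \<open>A root \<open>u\<close> of \<open>p\<close> is a zero neither of
    \<open>c\<close> nor of the norm, so above \<open>u\<close> the function \<open>z\<close> is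
    regular and the numerator of \<open>t\<close> does not vanish. The factor \<open>X\<close>
    ensures that \<open>p\<close> is not constant.\<close>
  define p where "p = [:0, 1:] * (c * nrm a' b') + 1"
  have pp: "p \<in> pols K" unfolding p_def by (intro K_pols X_pols zz n)
  have "degree ([:0, 1:] * (c * nrm a' b')) > 0" using n zz by (subst degree_mult_eq) auto
  then have "degree p > 0" unfolding p_def by (subst degree_add_eq_left) auto
  then obtain u where u: "u \<in> K" "poly p u = 0" using root[OF pp] by blast
  then have nz: "poly c u \<noteq> 0" "poly (nrm a' b') u \<noteq> 0" by (auto simp: p_def)
  obtain v where on: "on_E u v" using point_above[OF u(1)] by blast
  interpret Q: quad_point K x y h f "Vp u v" u v by (rule Vp[OF on])
  have "inverse (poly c x) \<in> Vp u v" using Q.unit_inverse[OF Q.poly_unit[OF zz(3) nz(1)]] by blast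
  then have zV: "z \<in> Vp u v" unfolding zz(5) divide_inverse using Q.elt_V[OF zz(1,2)] Q.V_intros(4) by blast
  have ns: "poly h u + 2 * v \<noteq> 0 \<or> poly (pderiv f) u \<noteq> v * poly (pderiv h) u"
    using nonsing_point on by (auto simp: on_E_def)
  obtain k where k: "k \<in> K" "z - k \<in> Q.P" using Q.rational[OF ns zV] by blast
  have Qr: "Q.P \<in> rational_places K E" using pl_rational[of "Some (u, v)"] on by (auto simp: pts_def)
  have "\<sigma> (z - k) \<in> Q.P" using fixes_places[OF Qr] k(2) by blast
  moreover have "\<sigma> (z - k) = \<sigma> z - k" using s.\<sigma>_diff[OF z] s.\<sigma>K k(1) K_E by auto
  ultimately have "\<sigma> z - k - (z - k) \<in> Q.P" using Q.P_diff[OF _ k(2)] by metis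
  then have "t \<in> Q.P" by (simp add: t_def)
  then have "t * poly c' x \<in> Q.P" by (rule Q.P_mult(2)[OF _ Q.poly_V[OF tt(3)]])
  then have "elt a' b' \<in> Q.P" using tt poly_x_eq_0 by simp
  then have "poly (nrm a' b') x \<in> Q.P" unfolding elt_conj[symmetric]
    by (rule Q.P_mult(2)) (use Q.elt_V Q.conj_pols[OF tt(1,2)] in auto)
  then show False using nz Q.poly_P_iff[OF n(1)] by simp
qed

end

section \<open>The action of automorphisms on rational places\<close>

context ell_group
begin

lemma image_place_subset: "Q \<in> rational_places K E \<Longrightarrow> Q \<subseteq> E"
  unfolding rational_E by (auto simp: vring_def nonunits_def)

lemma rational_image:
  assumes \<sigma>: "\<sigma> \<in> carrier (Aut_group K E)" and Q: "Q \<in> rational_places K E" shows "\<sigma> ` Q \<in> rational_places K E"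
proof -
  interpret s: aut_ctx K E \<sigma> by unfold_locales (use E_field K_field K_E \<sigma> in auto)
  obtain V where V: "vring K E V" "Q = nonunits V" "\<And>z. z \<in> V \<Longrightarrow> \<exists>c\<in>K. z - c \<in> Q"
    using Q unfolding rational_E by blast
  have "\<exists>c\<in>K. w - c \<in> \<sigma> ` Q" if "w \<in> \<sigma> ` V" for w
  proof -
    obtain z where z: "z \<in> V" "w = \<sigma> z" using \<open>w \<in> \<sigma> ` V\<close> by blast
    obtain c where c: "c \<in> K" "z - c \<in> Q" using V(3)[OF z(1)] by blast
    have "\<sigma> (z - c) = w - c" using s.\<sigma>_diff[of z c] s.\<sigma>K[OF c(1)] z V(1) c(1) K_E by (auto simp: vring_def)
    then show ?thesis using c by (metis imageI)
  qed
  then show ?thesis unfolding rational_E using s.vring_image[OF V(1)] V(2) by metis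
qed

text \<open>If \<open>z\<close> witnesses the equivalence for \<open>P\<close> and \<open>Q\<close>,
  then \<open>\<sigma> z\<close> witnesses it for their images. As \<open>O\<close> enters the law
  of addition, it has to be fixed.\<close>

lemma mult_image:
  assumes \<sigma>: "\<sigma> \<in> carrier (Aut_group K E)" and O: "\<sigma> ` PO = PO"
    and P: "P \<in> rational_places K E" and Q: "Q \<in> rational_places K E"
  shows "\<sigma> ` (P \<otimes>\<^bsub>G\<^esub> Q) = \<sigma> ` P \<otimes>\<^bsub>G\<^esub> \<sigma> ` Q"
proof -
  interpret s: aut_ctx K E \<sigma> by unfold_locales (use E_field K_field K_E \<sigma> in auto)
  define R where "R = P \<otimes>\<^bsub>G\<^esub> Q"
  note R = mult_prop[OF P Q, folded R_def]
  obtain z where z: "z \<in> E" "z \<noteq> 0" "\<And>T. T \<in> places K E \<Longrightarrow>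
      Poly_Mapping.lookup (frag_of P + frag_of Q - (frag_of R + frag_of PO)) T = place_val E T z"
    using R(2) unfolding lin_equiv_def by blast
  have "lin_equiv K E (frag_of (\<sigma> ` P) + frag_of (\<sigma> ` Q)) (frag_of (\<sigma> ` R) + frag_of (\<sigma> ` PO))"
    unfolding lin_equiv_def
  proof (intro bexI[of _ "\<sigma> z"] conjI ballI)
    show "\<sigma> z \<in> E" using s.\<sigma>F z by blast
    show "\<sigma> z \<noteq> 0" using s.\<sigma>_eq[OF z(1) sub_field_intros(2)[OF E_field]] s.\<sigma>0 z by simp
    fix T assume "T \<in> places K E"
    then obtain W where W: "vring K E W" "T = nonunits W" unfolding places_E by blast
    \<comment> \<open>The order of \<open>\<sigma> z\<close> at \<open>T\<close> is compared with
      that of \<open>z\<close> at the preimage of \<open>T\<close>, obtained with the inverse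
      automorphism.\<close>
    define \<rho> where "\<rho> = inv\<^bsub>Aut_group K E\<^esub> \<sigma>"
    interpret Aut: group "Aut_group K E" by (rule group_Aut(1)[OF E_field K_field K_E])
    have \<rho>: "\<rho> \<in> carrier (Aut_group K E)" unfolding \<rho>_def using \<sigma> by simp
    interpret r: aut_ctx K E \<rho> by unfold_locales (use E_field K_field K_E \<rho> in auto)
    have "\<sigma> \<otimes>\<^bsub>Aut_group K E\<^esub> \<rho> = \<one>\<^bsub>Aut_group K E\<^esub>" unfolding \<rho>_def using \<sigma> by simp
    then have "compose E \<sigma> \<rho> = (\<lambda>z\<in>E. z)" using group_Aut(2,3)[OF E_field K_field K_E] \<sigma> \<rho> by simp
    then have sr: "\<sigma> (\<rho> t) = t" if "t \<in> E" for t using that by (metis compose_eq restrict_apply')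
    have WE: "nonunits W \<subseteq> E" using W(1) by (auto simp: vring_def nonunits_def)
    define T0 where "T0 = \<rho> ` T"
    have T0: "T0 \<in> places K E" unfolding T0_def places_E W(2) using r.vring_image[OF W(1)] by metis
    have T0E: "T0 \<subseteq> E" unfolding T0_def W(2) by (rule r.image_subset[OF WE])
    have T: "T = \<sigma> ` T0" unfolding T0_def image_image W(2) using sr WE by force
    have "(\<sigma> ` S = T) = (S = T0)" if "S \<in> rational_places K E" for S
      unfolding T by (rule s.image_eq[OF image_place_subset[OF that] T0E])
    then have "Poly_Mapping.lookup (frag_of (\<sigma> ` P) + frag_of (\<sigma> ` Q) - (frag_of (\<sigma> ` R) + frag_of (\<sigma> ` PO))) T
        = Poly_Mapping.lookup (frag_of P + frag_of Q - (frag_of R + frag_of PO)) T0"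
      unfolding lookup_pl using P Q R(1) PO_rational by simp
    also have "\<dots> = place_val E T0 z" by (rule z(3)[OF T0])
    also have "\<dots> = place_val E T (\<sigma> z)" unfolding T by (rule s.place_val_image[OF T0E z(1), symmetric])
    finally show "Poly_Mapping.lookup (frag_of (\<sigma> ` P) + frag_of (\<sigma> ` Q) - (frag_of (\<sigma> ` R) + frag_of (\<sigma> ` PO))) T
        = place_val E T (\<sigma> z)" .
  qed
  then show ?thesis unfolding R_def[symmetric] O by (intro mult_eqI[symmetric] rational_image[OF \<sigma> R(1)])
qed

end

section \<open>Extension of automorphisms to the larger constant field, and translations\<close>

context ell_pair
begin

sublocale AG: ell_group K x y a1 a2 a3 a4 a6
  by (rule ell_group_A)

sublocale BG: ell_group K' x' y' b1 b2 b3 b4 b6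
  by (rule B.ell_group_closed)

abbreviation "AutA \<equiv> Aut_group K A.E"
abbreviation "AutB \<equiv> Aut_group K' B.E"

lemmas AutA = group_Aut[OF A.E_field A.K_field A.K_E]
lemmas AutB = group_Aut[OF B.E_field B.K_field B.K_E]

lemma aut_ctx_A: "\<sigma> \<in> carrier AutA \<Longrightarrow> aut_ctx K A.E \<sigma>"
  by unfold_locales (use A.E_field A.K_field A.K_E in auto)

lemma aut_ctx_B: "\<sigma> \<in> carrier AutB \<Longrightarrow> aut_ctx K' B.E \<sigma>"
  by unfold_locales (use B.E_field B.K_field B.K_E in auto)

text \<open>The residues of \<open>x\<close> and \<open>y\<close> downstairs already determine those
  upstairs, so only one rational place of the large field lies above the given one.\<close>

lemma lift_unique:
  assumes q: "q \<in> A.pts" and q': "q' \<in> B.pts" and eq: "{z \<in> A.E. \<phi> z \<in> B.pl q'} = A.pl q"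
  shows "q' = lift q"
proof -
  obtain V where V: "vring K' B.E V" "B.pl q' = nonunits V" using B.pl_place[OF q'] unfolding B.places_E by blast
  define R where "R = {z \<in> A.E. \<phi> z \<in> V}"
  have R: "vring K A.E R" "nonunits R = A.pl q" using restrict[OF V(1)] eq V(2) by (auto simp: R_def)
  have xR: "x \<in> R \<longleftrightarrow> x' \<in> V" using A.x_E by (simp add: R_def \<phi>x)
  have "nonunits V = B.pl (lift q)"
  proof (cases q)
    case None
    then show ?thesis using A.pl_O_iff[OF R(1)] B.pl_O_iff[OF V(1)] R(2) xR by simp
  next
    case (Some p)
    then obtain u v where uv: "q = Some (u, v)" "A.on_E u v" using q by (auto simp: A.pts_def)
    have "x \<in> R" "x - u \<in> A.pl q" "y - v \<in> A.pl q"
      using A.pl_Some_iff[OF R(1) uv(2)] R(2) uv(1) by auto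
    then have "x' \<in> V" "\<phi> (x - u) \<in> nonunits V" "\<phi> (y - v) \<in> nonunits V"
      using xR eq V(2) by blast+
    then show ?thesis using B.pl_Some_iff[OF V(1) on_E_lift[OF uv(2)]] uv(1) by (simp add: \<phi>x \<phi>y)
  qed
  then show ?thesis using V(2) B.pl_inj[OF q' lift_pts[OF q]] by simp
qed

definition compatible where
  "compatible \<sigma> \<sigma>' \<longleftrightarrow> \<sigma> \<in> carrier AutA \<and> \<sigma>' \<in> carrier AutB \<and> (\<forall>z\<in>A.E. \<sigma>' (\<phi> z) = \<phi> (\<sigma> z))"

lemma restrict_image:
  assumes c: "compatible \<sigma> \<sigma>'" and S: "S \<subseteq> B.E"
  shows "{z \<in> A.E. \<phi> z \<in> \<sigma>' ` S} = \<sigma> ` {z \<in> A.E. \<phi> z \<in> S}"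
proof -
  interpret s: aut_ctx K A.E \<sigma> using c aut_ctx_A by (simp add: compatible_def)
  interpret s': aut_ctx K' B.E \<sigma>' using c aut_ctx_B by (simp add: compatible_def)
  have iff: "\<phi> (\<sigma> z) \<in> \<sigma>' ` S \<longleftrightarrow> \<phi> z \<in> S" if "z \<in> A.E" for z
    using c that s'.mem_image[OF S \<phi>E[OF that]] by (auto simp: compatible_def)
  show ?thesis
  proof safe
    fix z s assume "z \<in> A.E" "\<phi> z = \<sigma>' s" "s \<in> S"
    moreover from this obtain t where "t \<in> A.E" "z = \<sigma> t" using s.surj by blast
    ultimately show "z \<in> \<sigma> ` {z \<in> A.E. \<phi> z \<in> S}" using iff[of t] by (metis (mono_tags) imageI mem_Collect_eq)
  qed (use iff s.\<sigma>F in auto)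
qed

lemma compatible_mult:
  assumes "compatible \<sigma> \<sigma>'" "compatible \<tau> \<tau>'" shows "compatible (\<sigma> \<otimes>\<^bsub>AutA\<^esub> \<tau>) (\<sigma>' \<otimes>\<^bsub>AutB\<^esub> \<tau>')"
proof -
  interpret GA: group AutA by (rule AutA(1))
  interpret GB: group AutB by (rule AutB(1))
  interpret t: aut_ctx K A.E \<tau> using assms aut_ctx_A by (simp add: compatible_def)
  have c: "\<sigma> \<in> carrier AutA" "\<sigma>' \<in> carrier AutB" "\<tau> \<in> carrier AutA" "\<tau>' \<in> carrier AutB"
    using assms by (auto simp: compatible_def)
  have "(\<sigma>' \<otimes>\<^bsub>AutB\<^esub> \<tau>') (\<phi> z) = \<phi> ((\<sigma> \<otimes>\<^bsub>AutA\<^esub> \<tau>) z)" if "z \<in> A.E" for z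
    unfolding AutA(2)[OF c(1,3)] AutB(2)[OF c(2,4)] using assms that \<phi>E t.\<sigma>F
    by (simp add: compatible_def compose_eq)
  then show ?thesis using c by (simp add: compatible_def)
qed

lemma compatible_inv:
  assumes "compatible \<sigma> \<sigma>'" shows "compatible (inv\<^bsub>AutA\<^esub> \<sigma>) (inv\<^bsub>AutB\<^esub> \<sigma>')"
proof -
  interpret GA: group AutA by (rule AutA(1))
  interpret GB: group AutB by (rule AutB(1))
  have c: "\<sigma> \<in> carrier AutA" "\<sigma>' \<in> carrier AutB" using assms by (auto simp: compatible_def)
  interpret s: aut_ctx K A.E \<sigma> using c aut_ctx_A by blast
  define \<rho> \<rho>' where "\<rho> = inv\<^bsub>AutA\<^esub> \<sigma>" and "\<rho>' = inv\<^bsub>AutB\<^esub> \<sigma>'"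
  have r: "\<rho> \<in> carrier AutA" "\<rho>' \<in> carrier AutB" using c by (auto simp: \<rho>_def \<rho>'_def)
  have "compose A.E \<rho> \<sigma> = (\<lambda>z\<in>A.E. z)" using AutA(2)[OF r(1) c(1)] AutA(3) c by (simp add: \<rho>_def)
  then have rs: "\<rho> (\<sigma> z) = z" if "z \<in> A.E" for z using that by (metis compose_eq restrict_apply')
  have "compose B.E \<rho>' \<sigma>' = (\<lambda>z\<in>B.E. z)" using AutB(2)[OF r(2) c(2)] AutB(3) c by (simp add: \<rho>'_def)
  then have rs': "\<rho>' (\<sigma>' z) = z" if "z \<in> B.E" for z using that by (metis compose_eq restrict_apply')
  have "\<rho>' (\<phi> z) = \<phi> (\<rho> z)" if "z \<in> A.E" for z
  proof -
    obtain t where t: "t \<in> A.E" "z = \<sigma> t" using s.surj \<open>z \<in> A.E\<close> by blast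
    have "\<phi> z = \<sigma>' (\<phi> t)" using assms t by (simp add: compatible_def)
    then show ?thesis using rs[OF t(1)] rs'[OF \<phi>E[OF t(1)]] t(2) by simp
  qed
  then show ?thesis using r by (simp add: compatible_def \<rho>_def \<rho>'_def)
qed

lemma image_mult_A: "\<sigma> \<in> carrier AutA \<Longrightarrow> \<tau> \<in> carrier AutA \<Longrightarrow> S \<subseteq> A.E \<Longrightarrow> (\<sigma> \<otimes>\<^bsub>AutA\<^esub> \<tau>) ` S = \<sigma> ` \<tau> ` S"
  unfolding AutA(2) image_image by (intro image_cong) (auto simp: compose_eq)

lemma image_mult_B: "\<sigma> \<in> carrier AutB \<Longrightarrow> \<tau> \<in> carrier AutB \<Longrightarrow> S \<subseteq> B.E \<Longrightarrow> (\<sigma> \<otimes>\<^bsub>AutB\<^esub> \<tau>) ` S = \<sigma> ` \<tau> ` S"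
  unfolding AutB(2) image_image by (intro image_cong) (auto simp: compose_eq)

lemma image_inv_A:
  assumes "\<sigma> \<in> carrier AutA" "S \<subseteq> A.E" shows "\<sigma> ` (inv\<^bsub>AutA\<^esub> \<sigma>) ` S = S" "(inv\<^bsub>AutA\<^esub> \<sigma>) ` \<sigma> ` S = S"
proof -
  interpret GA: group AutA by (rule AutA(1))
  have "\<one>\<^bsub>AutA\<^esub> ` S = S" unfolding AutA(3) using assms(2) by (force simp: image_iff)
  then show "\<sigma> ` (inv\<^bsub>AutA\<^esub> \<sigma>) ` S = S" "(inv\<^bsub>AutA\<^esub> \<sigma>) ` \<sigma> ` S = S"
    using image_mult_A[of \<sigma> "inv\<^bsub>AutA\<^esub> \<sigma>" S] image_mult_A[of "inv\<^bsub>AutA\<^esub> \<sigma>" \<sigma> S] assms by simp_all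
qed

lemma image_inv_B:
  assumes "\<sigma> \<in> carrier AutB" "S \<subseteq> B.E" shows "\<sigma> ` (inv\<^bsub>AutB\<^esub> \<sigma>) ` S = S" "(inv\<^bsub>AutB\<^esub> \<sigma>) ` \<sigma> ` S = S"
proof -
  interpret GB: group AutB by (rule AutB(1))
  have "\<one>\<^bsub>AutB\<^esub> ` S = S" unfolding AutB(3) using assms(2) by (force simp: image_iff)
  then show "\<sigma> ` (inv\<^bsub>AutB\<^esub> \<sigma>) ` S = S" "(inv\<^bsub>AutB\<^esub> \<sigma>) ` \<sigma> ` S = S"
    using image_mult_B[of \<sigma> "inv\<^bsub>AutB\<^esub> \<sigma>" S] image_mult_B[of "inv\<^bsub>AutB\<^esub> \<sigma>" \<sigma> S] assms by simp_all
qed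

text \<open>The property behind \<open>is_translation\<close> with the extension made explicit. By
  \<open>transl_base\<close>, \<open>Q'\<close> is the lift of the image of \<open>O\<close> under
  \<open>\<tau>\<close>.\<close>

definition transl where
  "transl \<tau> \<tau>' Q' \<longleftrightarrow> compatible \<tau> \<tau>' \<and> Q' \<in> rational_places K' B.E \<and>
    (\<forall>P\<in>rational_places K' B.E. \<tau>' ` P = P \<otimes>\<^bsub>BG.G\<^esub> Q')"

text \<open>The image of \<open>O\<close> upstairs is rational and lies above the image downstairs,
  so \<open>lift_unique\<close> identifies it.\<close>

lemma compatible_O:
  assumes c: "compatible \<alpha> \<alpha>'" and q: "q \<in> A.pts" "\<alpha> ` A.PO = A.pl q" shows "\<alpha>' ` B.PO = B.pl (lift q)"
proof -
  have "\<alpha>' \<in> carrier AutB" using c by (simp add: compatible_def)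
  then have "\<alpha>' ` B.PO \<in> rational_places K' B.E" using BG.rational_image BG.PO_rational by blast
  then obtain q' where q': "q' \<in> B.pts" "\<alpha>' ` B.PO = B.pl q'" using B.rational_pl by blast
  have "{z \<in> A.E. \<phi> z \<in> B.PO} = A.PO" using restrict_pl[of None] by (simp add: A.pts_def)
  then have "{z \<in> A.E. \<phi> z \<in> B.pl q'} = A.pl q"
    using restrict_image[OF c BG.image_place_subset[OF BG.PO_rational]] q q'(2) by simp
  then show ?thesis using lift_unique[OF q(1) q'(1)] q'(2) by simp
qed

lemma transl_base:
  assumes t: "transl \<tau> \<tau>' Q'" and q: "q \<in> A.pts" "\<tau> ` A.PO = A.pl q" shows "Q' = B.pl (lift q)"
proof -
  have "\<tau>' ` B.PO = Q'" using t BG.PO_rational BG.one_mult by (simp add: transl_def)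
  then show ?thesis using compatible_O[of \<tau> \<tau>' q] t q by (simp add: transl_def)
qed

lemma image_O:
  assumes "\<tau> \<in> carrier AutA" shows "\<exists>q\<in>A.pts. \<tau> ` A.PO = A.pl q"
  using A.rational_pl[OF AG.rational_image[OF assms AG.PO_rational]] by blast

text \<open>The translation law is given only in the large field. It is applied there to the lifted
  point, a chord over \<open>K\<close> computes the sum upstairs as well as downstairs, and the
  outcome is restricted to the small field.\<close>

lemma transl_image:
  assumes t: "transl \<tau> \<tau>' Q'" and S: "S \<in> rational_places K A.E"
  shows "\<tau> ` S = S \<otimes>\<^bsub>AG.G\<^esub> (\<tau> ` A.PO)"
proof -
  have c: "compatible \<tau> \<tau>'" "\<tau> \<in> carrier AutA" using t by (auto simp: transl_def compatible_def)
  obtain q where q: "q \<in> A.pts" "\<tau> ` A.PO = A.pl q" using image_O[OF c(2)] by blast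
  obtain p where p: "p \<in> A.pts" "S = A.pl p" using A.rational_pl[OF S] by blast
  obtain s where s: "s \<in> A.pts" "chord K a1 a2 a3 a4 a6 p q s" using A.chord_exists[OF p(1) q(1)] by blast
  have lp: "B.pl (lift p) \<in> rational_places K' B.E" using B.pl_rational lift_pts p(1) by blast
  have "\<tau>' ` B.pl (lift p) = B.pl (lift p) \<otimes>\<^bsub>BG.G\<^esub> B.pl (lift q)"
    using t lp transl_base[OF t q] by (simp add: transl_def)
  also have "\<dots> = B.pl (lift s)" by (rule BG.mult_pl[OF lift_chord[OF s(2)] lift_pts[OF p(1)] lift_pts[OF q(1)]])
  finally have "{z \<in> A.E. \<phi> z \<in> B.pl (lift s)} = \<tau> ` {z \<in> A.E. \<phi> z \<in> B.pl (lift p)}"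
    using restrict_image[OF c(1) BG.image_place_subset[OF lp]] by simp
  then have "A.pl s = \<tau> ` S" unfolding restrict_pl[OF s(1)] restrict_pl[OF p(1)] p(2) .
  then show ?thesis using AG.mult_pl[OF s(2) p(1) q(1)] p q by simp
qed

text \<open>Equal images of \<open>O\<close> mean translation by the same \<open>Q'\<close>, so the
  quotient of the two extensions fixes every rational place over \<open>K'\<close>. By
  \<open>faithful\<close>, which needs algebraically closed constants, that quotient is
  trivial.\<close>

lemma transl_unique:
  assumes t1: "transl \<tau>1 \<tau>1' Q1" and t2: "transl \<tau>2 \<tau>2' Q2" and eq: "\<tau>1 ` A.PO = \<tau>2 ` A.PO"
  shows "\<tau>1 = \<tau>2"
proof -
  interpret GB: group AutB by (rule AutB(1))
  have c: "\<tau>1 \<in> carrier AutA" "\<tau>1' \<in> carrier AutB" "\<tau>2 \<in> carrier AutA" "\<tau>2' \<in> carrier AutB"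
    using t1 t2 by (auto simp: transl_def compatible_def)
  obtain q where q: "q \<in> A.pts" "\<tau>1 ` A.PO = A.pl q" using image_O[OF c(1)] by blast
  have QQ: "Q1 = Q2" using transl_base[OF t1 q] transl_base[OF t2 q(1)] q(2) eq by simp
  define \<rho> where "\<rho> = inv\<^bsub>AutB\<^esub> \<tau>2' \<otimes>\<^bsub>AutB\<^esub> \<tau>1'"
  have \<rho>: "\<rho> \<in> carrier AutB" unfolding \<rho>_def using c by simp
  have "\<rho> ` P = P" if P: "P \<in> rational_places K' B.E" for P
  proof -
    have "\<rho> ` P = (inv\<^bsub>AutB\<^esub> \<tau>2') ` \<tau>1' ` P"
      unfolding \<rho>_def using c image_mult_B BG.image_place_subset[OF P] by simp
    also have "\<tau>1' ` P = \<tau>2' ` P" using t1 t2 P QQ by (simp add: transl_def)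
    also have "(inv\<^bsub>AutB\<^esub> \<tau>2') ` \<tau>2' ` P = P" by (rule image_inv_B(2)[OF c(4) BG.image_place_subset[OF P]])
    finally show ?thesis .
  qed
  then have \<rho>z: "\<rho> z = z" if "z \<in> B.E" for z using B.faithful[OF \<rho> _ that] by blast
  have "\<rho> \<in> extensional B.E" using \<rho> by (simp add: Aut_iff)
  then have "\<rho> = \<one>\<^bsub>AutB\<^esub>" unfolding AutB(3) by (intro extensionalityI[of _ B.E]) (auto simp: \<rho>z)
  then have "\<tau>1' = \<tau>2'" unfolding \<rho>_def using c by (metis GB.inv_closed GB.inv_equality GB.inv_inv)
  then have "\<phi> (\<tau>1 z) = \<phi> (\<tau>2 z)" if "z \<in> A.E" for z
    using t1 t2 that by (metis transl_def compatible_def)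
  then show ?thesis using c by (intro extensionalityI[of _ A.E]) (auto simp: Aut_iff)
qed

text \<open>Upstairs \<open>\<alpha>'\<close> respects the group law, so conjugating the translation
  by \<open>Q'\<close> gives the translation by the image of \<open>Q'\<close> under
  \<open>\<alpha>'\<close>.\<close>

lemma transl_conj:
  assumes t: "transl \<tau> \<tau>' Q'" and c: "compatible \<alpha> \<alpha>'" and O: "\<alpha> ` A.PO = A.PO"
  shows "\<exists>\<rho>' R'. transl (\<alpha> \<otimes>\<^bsub>AutA\<^esub> \<tau> \<otimes>\<^bsub>AutA\<^esub> inv\<^bsub>AutA\<^esub> \<alpha>) \<rho>' R'"
proof (intro exI)
  interpret GB: group AutB by (rule AutB(1))
  have \<alpha>': "\<alpha>' \<in> carrier AutB" and \<tau>': "\<tau>' \<in> carrier AutB" "compatible \<tau> \<tau>'" and Q': "Q' \<in> rational_places K' B.E"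
    using t c by (auto simp: transl_def compatible_def)
  have O': "\<alpha>' ` B.PO = B.PO" using compatible_O[OF c, of None] O by (simp add: A.pts_def)
  define \<rho>' where "\<rho>' = \<alpha>' \<otimes>\<^bsub>AutB\<^esub> \<tau>' \<otimes>\<^bsub>AutB\<^esub> inv\<^bsub>AutB\<^esub> \<alpha>'"
  have "\<rho>' ` P = P \<otimes>\<^bsub>BG.G\<^esub> \<alpha>' ` Q'" if P: "P \<in> rational_places K' B.E" for P
  proof -
    define P1 where "P1 = (inv\<^bsub>AutB\<^esub> \<alpha>') ` P"
    have P1: "P1 \<in> rational_places K' B.E" unfolding P1_def by (rule BG.rational_image[OF _ P]) (simp add: \<alpha>')
    have "\<rho>' ` P = \<alpha>' ` \<tau>' ` P1"
      unfolding \<rho>'_def P1_def using \<alpha>' \<tau>' image_mult_B BG.image_place_subset[OF P] BG.image_place_subset[OF P1[unfolded P1_def]]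
      by simp
    also have "\<tau>' ` P1 = P1 \<otimes>\<^bsub>BG.G\<^esub> Q'" using t P1 by (simp add: transl_def)
    also have "\<alpha>' ` \<dots> = \<alpha>' ` P1 \<otimes>\<^bsub>BG.G\<^esub> \<alpha>' ` Q'" by (rule BG.mult_image[OF \<alpha>' O' P1 Q'])
    also have "\<alpha>' ` P1 = P" unfolding P1_def by (rule image_inv_B(1)[OF \<alpha>' BG.image_place_subset[OF P]])
    finally show ?thesis .
  qed
  then show "transl (\<alpha> \<otimes>\<^bsub>AutA\<^esub> \<tau> \<otimes>\<^bsub>AutA\<^esub> inv\<^bsub>AutA\<^esub> \<alpha>) \<rho>' (\<alpha>' ` Q')"
    unfolding transl_def using BG.rational_image[OF \<alpha>' Q'] compatible_mult[OF compatible_mult[OF c \<tau>'(2)] compatible_inv[OF c]]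
    by (simp add: \<rho>'_def)
qed

text \<open>The images of \<open>x\<close> and \<open>y\<close> under \<open>\<sigma>\<close>, moved
  up by \<open>\<phi>\<close>, satisfy the same Weierstrass equation and, by \<open>tr\<close>,
  generate an elliptic function field over \<open>K'\<close>. Since \<open>\<sigma>\<close> is onto,
  this contains the image of \<open>\<phi>\<close> and is the whole large field;
  \<open>quad_iso\<close> then supplies the extension.\<close>

lemma aut_extension:
  assumes \<sigma>: "\<sigma> \<in> carrier AutA" and tr: "\<And>p. p \<in> pols K' \<Longrightarrow> poly p (\<phi> (\<sigma> x)) = 0 \<Longrightarrow> p = 0"
  shows "\<exists>\<sigma>'. compatible \<sigma> \<sigma>'"
proof -
  interpret s: aut_ctx K A.E \<sigma> by (rule aut_ctx_A[OF \<sigma>])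
  define \<xi> \<eta> where "\<xi> = \<phi> (\<sigma> x)" and "\<eta> = \<phi> (\<sigma> y)"
  have \<xi>E: "\<xi> \<in> B.E" "\<eta> \<in> B.E" using \<phi>E s.\<sigma>F A.x_E A.y_E by (auto simp: \<xi>_def \<eta>_def)
  have hf: "map_poly \<phi> A.h = B.h" "map_poly \<phi> A.f = B.f" by (simp_all add: map_poly_pCons \<phi>a)
  have pE: "poly p x \<in> A.E" if "p \<in> pols K" for p
    using A.elt_E[OF that A.K_pols(1)] by (simp add: A.elt_def)
  have "\<sigma> (y\<^sup>2 + poly A.h x * y) = \<sigma> (poly A.f x)" unfolding A.rel ..
  then have "\<sigma> y ^ 2 + poly A.h (\<sigma> x) * \<sigma> y = poly A.f (\<sigma> x)"
    using pE[OF A.h] A.y_E A.x_E sub_field_intros(4,7)[OF A.E_field]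
    by (simp only: s.\<sigma>_add s.\<sigma>_mult s.\<sigma>_power s.\<sigma>_poly[OF A.h A.x_E] s.\<sigma>_poly[OF A.f A.x_E])
  then have "\<phi> (\<sigma> y ^ 2 + poly A.h (\<sigma> x) * \<sigma> y) = \<phi> (poly A.f (\<sigma> x))" by simp
  then have W: "\<eta>\<^sup>2 + poly B.h \<xi> * \<eta> = poly B.f \<xi>"
    by (simp only: hom_add hom_mult hom_power hom_poly hf \<xi>_def \<eta>_def)
  interpret C: ell K' \<xi> \<eta> b1 b2 b3 b4 b6
    by unfold_locales (use B.K_field B.coeffs_K tr W B.weierstrass_iff B.nonsingular in \<open>auto simp: \<xi>_def\<close>)
  have \<phi>\<sigma>: "\<phi> (\<sigma> (A.elt a b / poly c x)) = C.elt (map_poly \<phi> a) (map_poly \<phi> b) / poly (map_poly \<phi> c) \<xi>"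
    if "a \<in> pols K" "b \<in> pols K" "c \<in> pols K" for a b c
  proof -
    have "\<sigma> (A.elt a b) = poly a (\<sigma> x) + poly b (\<sigma> x) * \<sigma> y"
      unfolding A.elt_def using that pE A.y_E sub_field_intros(4)[OF A.E_field]
      by (simp add: s.\<sigma>_add s.\<sigma>_mult s.\<sigma>_poly[OF _ A.x_E])
    then have "\<sigma> (A.elt a b / poly c x) = (poly a (\<sigma> x) + poly b (\<sigma> x) * \<sigma> y) / poly c (\<sigma> x)"
      using s.\<sigma>_divide[OF A.elt_E[OF that(1,2)] pE[OF that(3)]] s.\<sigma>_poly[OF that(3) A.x_E] by simp
    then show ?thesis unfolding C.elt_def by (simp add: hom_poly \<xi>_def \<eta>_def)
  qed
  have in_C: "\<phi> z \<in> C.E" if "z \<in> A.E" for z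
  proof -
    obtain t where t: "t \<in> A.E" "z = \<sigma> t" using s.surj \<open>z \<in> A.E\<close> by blast
    obtain a b c where abc: "a \<in> pols K" "b \<in> pols K" "c \<in> pols K" "c \<noteq> 0" "t = A.elt a b / poly c x"
      using t(1) unfolding A.E_iff by blast
    show ?thesis unfolding t(2) abc(5) \<phi>\<sigma>[OF abc(1-3)]
      using abc map_poly_pols[OF \<phi>K] map_poly_eq_0 by (intro C.E_I) auto
  qed
  have CE: "C.E = B.E"
  proof
    show "C.E \<subseteq> B.E" by (rule C.E_least[OF B.E_field B.K_E \<xi>E])
    show "B.E \<subseteq> C.E" by (rule B.E_least[OF C.E_field C.K_E]) (use in_C[OF A.x_E] in_C[OF A.y_E] in \<open>simp_all add: \<phi>x \<phi>y\<close>)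
  qed
  obtain \<sigma>0 where s0: "bij_betw \<sigma>0 B.E C.E" "\<sigma>0 1 = 1" "\<sigma>0 x' = \<xi>" "\<sigma>0 y' = \<eta>" "\<And>c. c \<in> K' \<Longrightarrow> \<sigma>0 c = c"
    "\<And>a b. a \<in> B.E \<Longrightarrow> b \<in> B.E \<Longrightarrow> \<sigma>0 (a + b) = \<sigma>0 a + \<sigma>0 b \<and> \<sigma>0 (a * b) = \<sigma>0 a * \<sigma>0 b"
    using quad_iso[OF B.quad_axioms C.quad_axioms] by (elim exE conjE) blast
  define \<sigma>' where "\<sigma>' = restrict \<sigma>0 B.E"
  have s': "\<sigma>' \<in> carrier AutB" unfolding Aut_iff
  proof (intro conjI ballI)
    show "bij_betw \<sigma>' B.E B.E" using s0(1) unfolding CE by (simp add: \<sigma>'_def)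
  qed (use s0 B.K_E sub_field_intros[OF B.E_field] in \<open>auto simp: \<sigma>'_def\<close>)
  interpret s': aut_ctx K' B.E \<sigma>' by (rule aut_ctx_B[OF s'])
  have x'y': "\<sigma>' x' = \<xi>" "\<sigma>' y' = \<eta>" using s0 B.x_E B.y_E by (auto simp: \<sigma>'_def)
  have "\<sigma>' (\<phi> z) = \<phi> (\<sigma> z)" if z: "z \<in> A.E" for z
  proof -
    obtain a b c where abc: "a \<in> pols K" "b \<in> pols K" "c \<in> pols K" "c \<noteq> 0" "z = A.elt a b / poly c x"
      using z unfolding A.E_iff by blast
    define a' b' c' where "a' = map_poly \<phi> a" and "b' = map_poly \<phi> b" and "c' = map_poly \<phi> c"
    have pol: "a' \<in> pols K'" "b' \<in> pols K'" "c' \<in> pols K'"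
      using abc map_poly_pols[OF \<phi>K] by (auto simp: a'_def b'_def c'_def)
    have pE': "poly p x' \<in> B.E" if "p \<in> pols K'" for p
      using B.elt_E[OF that B.K_pols(1)] by (simp add: B.elt_def)
    have "\<phi> z = (poly a' x' + poly b' x' * y') / poly c' x'"
      by (simp add: abc(5) A.elt_def hom_poly \<phi>x \<phi>y a'_def b'_def c'_def)
    also have "\<sigma>' \<dots> = (poly a' \<xi> + poly b' \<xi> * \<eta>) / poly c' \<xi>"
      using pol pE' B.y_E sub_field_intros(4,6)[OF B.E_field]
      by (simp add: s'.\<sigma>_divide s'.\<sigma>_add s'.\<sigma>_mult s'.\<sigma>_poly[OF _ B.x_E] x'y')
    finally show ?thesis unfolding abc(5) \<phi>\<sigma>[OF abc(1-3)] by (simp add: C.elt_def a'_def b'_def c'_def)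
  qed
  then show ?thesis using \<sigma> s' by (auto simp: compatible_def)
qed

lemma normalizes:
  assumes cyc: "cyclic_group AG.G" and T: "subgroup T AutA" and transl: "\<And>\<tau>. \<tau> \<in> T \<Longrightarrow> \<exists>\<tau>' Q'. transl \<tau> \<tau>' Q'"
    and \<alpha>: "\<alpha> \<in> carrier AutA" "\<alpha> ` A.PO = A.PO" "\<exists>\<alpha>'. compatible \<alpha> \<alpha>'" and \<tau>: "\<tau> \<in> T"
  shows "\<alpha> \<otimes>\<^bsub>AutA\<^esub> \<tau> \<otimes>\<^bsub>AutA\<^esub> inv\<^bsub>AutA\<^esub> \<alpha> \<in> T"
proof -
  interpret GA: group AutA by (rule AutA(1))
  interpret CG: comm_group AG.G by (rule AG.comm_group_G)
  let ?TG = "AutA\<lparr>carrier := T\<rparr>"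
  interpret TG: group ?TG by (rule GA.subgroup_imp_group[OF T])
  have TA: "\<tau> \<in> carrier AutA" if "\<tau> \<in> T" for \<tau> using subgroup.subset[OF T] that by blast
  define N where "N \<tau> = \<tau> ` A.PO" for \<tau> :: "'a \<Rightarrow> 'a"
  have NT: "N \<tau> \<in> carrier AG.G" if "\<tau> \<in> carrier AutA" for \<tau>
    unfolding N_def AG.G_simps using AG.rational_image[OF that AG.PO_rational] .
  have "N \<in> hom ?TG AG.G"
  proof (rule homI)
    fix \<tau> \<rho> assume t: "\<tau> \<in> carrier ?TG" "\<rho> \<in> carrier ?TG"
    then have t': "\<tau> \<in> carrier AutA" "\<rho> \<in> carrier AutA" using TA by auto
    obtain \<tau>' Q' where tr: "transl \<tau> \<tau>' Q'" using transl[of \<tau>] t(1) by auto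
    have "N (\<tau> \<otimes>\<^bsub>AutA\<^esub> \<rho>) = \<tau> ` N \<rho>"
      unfolding N_def using image_mult_A[OF t'] AG.image_place_subset[OF AG.PO_rational] by simp
    \<comment> \<open>Applying \<open>\<tau>\<close> last puts its image on the right, so the
      factors come out in reverse order; commutativity of the group restores it.\<close>
    also have "\<dots> = N \<rho> \<otimes>\<^bsub>AG.G\<^esub> N \<tau>"
      using transl_image[OF tr] NT[OF t'(2)] unfolding AG.G_simps by (simp add: N_def)
    finally show "N (\<tau> \<otimes>\<^bsub>?TG\<^esub> \<rho>) = N \<tau> \<otimes>\<^bsub>AG.G\<^esub> N \<rho>" using AG.mult_comm by simp
  qed (use NT TA in auto)
  then interpret NH: group_hom ?TG AG.G N by unfold_locales
  have "(\<lambda>Q. \<alpha> ` Q) \<in> hom AG.G AG.G"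
    by (rule homI) (use AG.rational_image[OF \<alpha>(1)] AG.mult_image[OF \<alpha>(1,2)] in \<open>auto simp: AG.G_simps\<close>)
  then interpret AH: group_hom AG.G AG.G "\<lambda>Q. \<alpha> ` Q" by unfold_locales
  obtain g where g: "g \<in> carrier AG.G" "carrier AG.G = range (\<lambda>n::int. g [^]\<^bsub>AG.G\<^esub> n)"
    using cyc unfolding CG.cyclic_group by blast
  obtain k :: int where k: "\<alpha> ` g = g [^]\<^bsub>AG.G\<^esub> k" using AH.hom_closed[OF g(1)] g(2) by auto
  have pow: "\<alpha> ` Q = Q [^]\<^bsub>AG.G\<^esub> k" if "Q \<in> carrier AG.G" for Q
  proof -
    obtain n :: int where n: "Q = g [^]\<^bsub>AG.G\<^esub> n" using \<open>Q \<in> carrier AG.G\<close> g(2) by auto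
    show ?thesis unfolding n using AH.hom_int_pow[OF g(1)] k g(1) by (simp add: CG.int_pow_pow mult.commute)
  qed
  define \<tau>k where "\<tau>k = \<tau> [^]\<^bsub>?TG\<^esub> k"
  have \<tau>kT: "\<tau>k \<in> T" using TG.int_pow_closed[of \<tau> k] \<tau> by (simp add: \<tau>k_def)
  define \<beta> where "\<beta> = \<alpha> \<otimes>\<^bsub>AutA\<^esub> \<tau> \<otimes>\<^bsub>AutA\<^esub> inv\<^bsub>AutA\<^esub> \<alpha>"
  have PE: "A.PO \<subseteq> A.E" by (rule AG.image_place_subset[OF AG.PO_rational])
  have "(inv\<^bsub>AutA\<^esub> \<alpha>) ` A.PO = A.PO" using image_inv_A(2)[OF \<alpha>(1) PE] \<alpha>(2) by simp
  then have "\<beta> ` A.PO = \<alpha> ` \<tau> ` A.PO"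
    unfolding \<beta>_def using image_mult_A[OF _ _ PE] \<alpha>(1) TA[OF \<tau>] by simp
  also have "\<dots> = N \<tau> [^]\<^bsub>AG.G\<^esub> k" using pow[OF NT[OF TA[OF \<tau>]]] by (simp add: N_def)
  also have "\<dots> = \<tau>k ` A.PO" using NH.hom_int_pow[of \<tau> k] \<tau> by (simp add: N_def \<tau>k_def)
  finally have O: "\<beta> ` A.PO = \<tau>k ` A.PO" .
  obtain \<tau>' Q' where t: "transl \<tau> \<tau>' Q'" using transl[OF \<tau>] by blast
  obtain \<alpha>' where a: "compatible \<alpha> \<alpha>'" using \<alpha>(3) by blast
  obtain \<beta>' R' where b: "transl \<beta> \<beta>' R'" using transl_conj[OF t a \<alpha>(2)] unfolding \<beta>_def by blast
  obtain \<tau>k' Qk where tk: "transl \<tau>k \<tau>k' Qk" using transl[OF \<tau>kT] by blast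
  have "\<beta> = \<tau>k" by (rule transl_unique[OF b tk O])
  then show ?thesis using \<tau>kT by (simp add: \<beta>_def)
qed

end

text \<open>Conjugation moves elements of \<open>A\<close> past those of \<open>T\<close>: the
  product of \<open>t a\<close> and \<open>t' a'\<close> is \<open>t (a t' a^-1)\<close> times
  \<open>a a'\<close>, and the inverse of \<open>t a\<close> is \<open>a^-1 t^-1 a\<close> times
  \<open>a^-1\<close>.\<close>

lemma (in group) subgroup_set_mult:
  assumes T: "subgroup T G" and A: "subgroup A G" and norm: "\<And>a t. a \<in> A \<Longrightarrow> t \<in> T \<Longrightarrow> a \<otimes> t \<otimes> inv a \<in> T"
  shows "subgroup (T <#> A) G"
proof (rule subgroupI)
  have TG: "t \<in> carrier G" if "t \<in> T" for t using subgroup.subset[OF T] that by blast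
  have AG: "a \<in> carrier G" if "a \<in> A" for a using subgroup.subset[OF A] that by blast
  show "T <#> A \<subseteq> carrier G" using TG AG by (auto simp: set_mult_def)
  show "T <#> A \<noteq> {}" using subgroup.one_closed[OF T] subgroup.one_closed[OF A] by (auto simp: set_mult_def)
  fix g assume "g \<in> T <#> A"
  then obtain t a where g: "t \<in> T" "a \<in> A" "g = t \<otimes> a" by (auto simp: set_mult_def)
  have ia: "inv a \<in> A" "inv t \<in> T" using g subgroup.m_inv_closed[OF A] subgroup.m_inv_closed[OF T] by auto
  have "inv g = (inv a \<otimes> inv t \<otimes> inv (inv a)) \<otimes> inv a"
    using g TG[OF g(1)] AG[OF g(2)] by (simp add: inv_mult_group m_assoc)
  then show "inv g \<in> T <#> A" using norm[OF ia] ia(1) by (auto simp: set_mult_def)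
  fix g' assume "g' \<in> T <#> A"
  then obtain t' a' where g': "t' \<in> T" "a' \<in> A" "g' = t' \<otimes> a'" by (auto simp: set_mult_def)
  have "g \<otimes> g' = (t \<otimes> (a \<otimes> t' \<otimes> inv a)) \<otimes> (a \<otimes> a')"
    using g g' TG[OF g(1)] AG[OF g(2)] TG[OF g'(1)] AG[OF g'(2)]
    by (simp add: m_assoc) (simp add: m_assoc[symmetric])
  moreover have "t \<otimes> (a \<otimes> t' \<otimes> inv a) \<in> T" using subgroup.m_closed[OF T g(1) norm[OF g(2) g'(1)]] .
  moreover have "a \<otimes> a' \<in> A" using subgroup.m_closed[OF A g(2) g'(2)] .
  ultimately show "g \<otimes> g' \<in> T <#> A" by (auto simp: set_mult_def)
qed

theorem corollary3p6:
  fixes K E :: "'a::field set" and x y :: 'a and T A :: "('a \<Rightarrow> 'a) set"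
  assumes "elliptic_function_field K E x y"
    and "cyclic_group (place_group K E x y)"
    and "subgroup T (Aut_group K E)" and "T \<subseteq> translation_auts K E x y"
    and "subgroup A (Aut_group K E)" and "A \<subseteq> Aut_fixing_infinity K E x y"
  shows "subgroup (T <#>\<^bsub>Aut_group K E\<^esub> A) (Aut_group K E)"
proof -
  interpret finite_base K
    by unfold_locales (use assms(1) subfield_imp_sub_field in \<open>auto simp: elliptic_function_field_def\<close>)
  obtain a1 a2 a3 a4 a6 where pair: "ell_pair to_ac K x y a1 a2 a3 a4 a6
      K' (to_ac x) (to_ac y) (to_ac a1) (to_ac a2) (to_ac a3) (to_ac a4) (to_ac a6)"
    and E: "E = qset K x y" and E': "constant_extension K E = qset K' (to_ac x) (to_ac y)"
    using elliptic_pair[OF assms(1)] by blast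
  interpret ell_pair to_ac K x y a1 a2 a3 a4 a6
      K' "to_ac x" "to_ac y" "to_ac a1" "to_ac a2" "to_ac a3" "to_ac a4" "to_ac a6" by (rule pair)
  have "\<exists>\<tau>' Q'. transl \<tau> \<tau>' Q'" if \<tau>: "\<tau> \<in> T" for \<tau>
  proof -
    obtain Q where "is_translation K E x y Q \<tau>" using assms(4) \<tau> by (auto simp: translation_auts_def)
    then obtain \<tau>' Q' where "\<tau> \<in> carrier (Aut_group K E)" "\<tau>' \<in> carrier AutB" "Q' \<in> rational_places K' B.E"
      "\<forall>z\<in>E. \<tau>' (to_ac z) = to_ac (\<tau> z)" "\<forall>P\<in>rational_places K' B.E. \<tau>' ` P = P \<otimes>\<^bsub>BG.G\<^esub> Q'"
      unfolding is_translation_def Let_def E' by (elim conjE bexE)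
    then have "transl \<tau> \<tau>' Q'" unfolding transl_def compatible_def E[symmetric] by (intro conjI)
    then show ?thesis by blast
  qed
  moreover have "\<alpha> \<in> carrier AutA" "\<alpha> ` A.PO = A.PO" if "\<alpha> \<in> A" for \<alpha>
    using assms(6) that by (auto simp: Aut_fixing_infinity_def E A.infinite_place_eq)
  \<comment> \<open>\<open>\<alpha> x\<close> is transcendental over \<open>K\<close> because
    \<open>\<alpha>\<close> is injective and fixes \<open>K\<close>. As \<open>K'\<close> is
    algebraic over \<open>K\<close>, it stays transcendental over \<open>K'\<close>, which is the
    condition of \<open>aut_extension\<close>.\<close>
  moreover have "\<exists>\<alpha>'. compatible \<alpha> \<alpha>'" if \<alpha>: "\<alpha> \<in> carrier AutA" for \<alpha>
  proof (rule aut_extension[OF \<alpha>])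
    interpret a: aut_ctx K A.E \<alpha> by (rule aut_ctx_A[OF \<alpha>])
    fix p assume p: "p \<in> pols K'" "poly p (to_ac (\<alpha> x)) = 0"
    show "p = 0"
    proof (rule transcendental_K'[OF _ p])
      fix q assume q: "q \<in> pols K" "poly q (\<alpha> x) = 0"
      have "poly q x \<in> A.E" using A.elt_E[OF q(1) A.K_pols(1)] by (simp add: A.elt_def)
      moreover have "\<alpha> (poly q x) = \<alpha> 0" using a.\<sigma>_poly[OF q(1) A.x_E] q(2) a.\<sigma>0 by simp
      ultimately have "poly q x = 0" using a.\<sigma>_eq sub_field_intros(2)[OF A.E_field] by blast
      then show "q = 0" using A.poly_x_eq_0[OF q(1)] by simp
    qed
  qed
  ultimately have "\<alpha> \<otimes>\<^bsub>AutA\<^esub> \<tau> \<otimes>\<^bsub>AutA\<^esub> inv\<^bsub>AutA\<^esub> \<alpha> \<in> T" if "\<alpha> \<in> A" "\<tau> \<in> T" for \<alpha> \<tau>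
    using normalizes[of T \<alpha> \<tau>] that assms(2,3) unfolding E by blast
  then show ?thesis using group.subgroup_set_mult[OF AutA(1)] assms(3,5) unfolding E by blast
qed

end
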